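(* Let $M$ be a manifold with a metric mixed 3-structure $((\phi_\alpha,\xi_\alpha,\eta_\alpha)_{\alpha=1,2,3},g)$, and let $P=P(M,\pi,S^1)$ be any principal circle bundle over $M$. Then there is an almost para-hyperhermitian structure on the manifold $P$.
   Context: Manifolds and tensor fields are smooth. Set $\epsilon_1=1$, $\epsilon_2=\epsilon_3=-1$. Mixed 3-structure. Let $M$ be a manifold with a triple $(\phi,\xi,\eta)$, where $\phi$ is a $(1,1)$-tensor field, $\xi$ a vector field and $\eta$ a 1-form. If $\phi^2=-\epsilon\,\mathrm{Id}+\eta\otimes\xi$ and $\eta(\xi)=\epsilon$, the triple is called an almost contact structure when $\epsilon=1$ and a Lorentzian almost paracontact structure when $\epsilon=-1$ (these conditions imply $\phi\xi=0$ and $\eta\circ\phi=0$). A mixed 3-structure on $M$ consists of an almost contact structure $(\phi_1,\xi_1,\eta_1)$ and two Lorentzian almost paracontact structures $(\phi_2,\xi_2,\eta_2)$, $(\phi_3,\xi_3,\eta_3)$ such that $\eta_\alpha(\xi_\beta)=0$ for all $\alpha\ne\beta$ and, for every even permutation $(\alpha,\beta,\gamma)$ of $(1,2,3)$: $$\phi_\alpha(\xi_\beta)=-\phi_\beta(\xi_\alpha)=\epsilon_\gamma\xi_\gamma,\qquad \eta_\alpha\circ\phi_\beta=-\eta_\beta\circ\phi_\alpha=\epsilon_\gamma\eta_\gamma,$$ $$\phi_\alpha\phi_\beta-\eta_\beta\otimes\xi_\alpha=-\phi_\beta\phi_\alpha+\eta_\alpha\otimes\xi_\beta=\epsilon_\gamma\phi_\gamma.$$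 A metric mixed 3-structure is a mixed 3-structure together with a semi-Riemannian metric $g$ on $M$ (called compatible) such that $g(\phi_\alpha X,\phi_\alpha Y)=\epsilon_\alpha g(X,Y)-\eta_\alpha(X)\eta_\alpha(Y)$ and $g(X,\xi_\alpha)=\eta_\alpha(X)$ for all vector fields $X,Y$ on $M$ and $\alpha=1,2,3$. Almost para-hyperhermitian structure. An almost para-hypercomplex structure on a manifold $N$ is a triple $H=(J_1,J_2,J_3)$ of $(1,1)$-tensor fields with $J_1^2=-\mathrm{Id}$, $J_2^2=J_3^2=\mathrm{Id}$, $J_2,J_3\ne\pm\mathrm{Id}$, and $J_2J_1=-J_1J_2=J_3$. An almost para-hyperhermitian structure on $N$ is such an $H$ together with a semi-Riemannian metric $g$ on $N$ with $g(J_\alpha X,J_\alpha Y)=\epsilon_\alpha g(X,Y)$ for all vector fields $X,Y$ and $\alpha=1,2,3$. *)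

theory Defs
  imports "HOL-Analysis.Analysis" "HOL-Library.Function_Algebras"
begin

section \<open>Smooth maps between open sets of Euclidean spaces\<close>

text \<open>The definitions are meant for an open set \<open>S\<close>; then they depend only on the restriction
  of \<open>f\<close> to \<open>S\<close>.\<close>

primrec C_on :: "nat \<Rightarrow> 'a::real_normed_vector set \<Rightarrow> ('a \<Rightarrow> 'b::real_normed_vector) \<Rightarrow> bool" where
  "C_on 0 S f \<longleftrightarrow> continuous_on S f"
| "C_on (Suc k) S f \<longleftrightarrow>
     (\<forall>x\<in>S. f differentiable (at x)) \<and> (\<forall>v. C_on k S (\<lambda>x. frechet_derivative f (at x) v))"

definition smooth_on :: "'a::real_normed_vector set \<Rightarrow> ('a \<Rightarrow> 'b::real_normed_vector) \<Rightarrow> bool" where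
  "smooth_on S f \<longleftrightarrow> (\<forall>k. C_on k S f)"


section \<open>Smooth manifolds\<close>

text \<open>A chart is its domain together with the coordinate map; the latter is relevant only on the
  domain. Manifolds are nonempty, Hausdorff and second countable, of dimension \<open>DIM('e)\<close>.
  The smooth structure is given by an atlas, which need not be maximal.\<close>

type_synonym ('a, 'e) chart = "'a set \<times> ('a \<Rightarrow> 'e)"
type_synonym ('a, 'e) atlas = "('a, 'e) chart set"

definition chart_image :: "('a, 'e) chart \<Rightarrow> 'e set" where
  "chart_image c = snd c ` fst c"

definition inv_chart :: "('a, 'e) chart \<Rightarrow> 'e \<Rightarrow> 'a" where
  "inv_chart c = inv_into (fst c) (snd c)"

definition is_chart :: "'a topology \<Rightarrow> ('a, 'e::euclidean_space) chart \<Rightarrow> bool" where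
  "is_chart X c \<longleftrightarrow> openin X (fst c) \<and> open (chart_image c) \<and>
     homeomorphic_map (subtopology X (fst c)) (top_of_set (chart_image c)) (snd c)"

definition transition :: "('a, 'e) chart \<Rightarrow> ('a, 'f) chart \<Rightarrow> 'e \<Rightarrow> 'f" where
  "transition c d = snd d \<circ> inv_chart c"

locale smooth_manifold =
  fixes X :: "'a topology" and A :: "('a, 'e::euclidean_space) atlas"
  assumes nonempty: "topspace X \<noteq> {}"
    and Hausdorff: "Hausdorff_space X"
    and second_countable: "second_countable X"
    and charts: "c \<in> A \<Longrightarrow> is_chart X c"
    and cover: "(\<Union>c\<in>A. fst c) = topspace X"
    and compatible: "\<lbrakk>c \<in> A; d \<in> A\<rbrakk> \<Longrightarrow> smooth_on (snd c ` (fst c \<inter> fst d)) (transition c d)"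

definition smooth_map :: "'a topology \<Rightarrow> ('a, 'e::euclidean_space) atlas \<Rightarrow>
    'b topology \<Rightarrow> ('b, 'f::euclidean_space) atlas \<Rightarrow> ('a \<Rightarrow> 'b) \<Rightarrow> bool" where
  "smooth_map X A Y B f \<longleftrightarrow> continuous_map X Y f \<and>
     (\<forall>c\<in>A. \<forall>d\<in>B. smooth_on (snd c ` (fst c \<inter> f -` fst d)) (snd d \<circ> f \<circ> inv_chart c))"

definition diffeomorphism :: "'a topology \<Rightarrow> ('a, 'e::euclidean_space) atlas \<Rightarrow>
    'b topology \<Rightarrow> ('b, 'f::euclidean_space) atlas \<Rightarrow> ('a \<Rightarrow> 'b) \<Rightarrow> bool" where
  "diffeomorphism X A Y B f \<longleftrightarrow> bij_betw f (topspace X) (topspace Y) \<and>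
     smooth_map X A Y B f \<and> smooth_map Y B X A (inv_into (topspace X) f)"

definition restrict_atlas :: "'a set \<Rightarrow> ('a, 'e) atlas \<Rightarrow> ('a, 'e) atlas" where
  "restrict_atlas U A = (\<lambda>c. (fst c \<inter> U, snd c)) ` A"

definition prod_atlas :: "('a, 'e) atlas \<Rightarrow> ('b, 'f) atlas \<Rightarrow> ('a \<times> 'b, 'e \<times> 'f) atlas" where
  "prod_atlas A B = {(fst c \<times> fst d, map_prod (snd c) (snd d)) | c d. c \<in> A \<and> d \<in> B}"


section \<open>Principal circle bundles\<close>

definition circle :: "complex topology" where
  "circle = top_of_set (sphere 0 1)"

text \<open>The charts of the circle are the branches of the angle with values in \<open>(a, a + 2\<pi>)\<close>.\<close>

definition circle_atlas :: "(complex, real) atlas" where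
  "circle_atlas = {(cis ` {a<..<a + 2 * pi}, inv_into {a<..<a + 2 * pi} cis) | a. True}"

locale principal_circle_bundle =
  total: smooth_manifold Y B + base: smooth_manifold X A
  for Y :: "'p topology" and B :: "('p, 'f::euclidean_space) atlas"
    and X :: "'a topology" and A :: "('a, 'e::euclidean_space) atlas" +
  fixes \<pi> :: "'p \<Rightarrow> 'a" and act :: "'p \<times> complex \<Rightarrow> 'p"
  assumes proj_smooth: "smooth_map Y B X A \<pi>"
    and proj_surj: "\<pi> ` topspace Y = topspace X"
    and act_smooth: "smooth_map (prod_topology Y circle) (prod_atlas B circle_atlas) Y B act"
    and act_one: "u \<in> topspace Y \<Longrightarrow> act (u, 1) = u"
    and act_mult: "\<lbrakk>u \<in> topspace Y; z \<in> topspace circle; w \<in> topspace circle\<rbrakk>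
      \<Longrightarrow> act (act (u, z), w) = act (u, z * w)"
    and act_free: "\<lbrakk>u \<in> topspace Y; z \<in> topspace circle; act (u, z) = u\<rbrakk> \<Longrightarrow> z = 1"
    and fibres_orbits: "\<lbrakk>u \<in> topspace Y; v \<in> topspace Y\<rbrakk>
      \<Longrightarrow> \<pi> u = \<pi> v \<longleftrightarrow> (\<exists>z\<in>topspace circle. v = act (u, z))"
    and locally_trivial: "x \<in> topspace X \<Longrightarrow>
      \<exists>U \<Psi>. openin X U \<and> x \<in> U \<and>
        (let W = topspace Y \<inter> \<pi> -` U in
          diffeomorphism
            (subtopology Y W) (restrict_atlas W B)
            (prod_topology (subtopology X U) circle)
            (prod_atlas (restrict_atlas U A) circle_atlas) \<Psi> \<and>
          (\<forall>u\<in>W. fst (\<Psi> u) = \<pi> u \<and>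
            (\<forall>z\<in>topspace circle. snd (\<Psi> (act (u, z))) = snd (\<Psi> u) * z)))"


section \<open>Tangent spaces and tensor fields\<close>

instantiation "fun" :: (type, real_vector) real_vector
begin

definition scaleR_fun :: "real \<Rightarrow> ('a \<Rightarrow> 'b) \<Rightarrow> 'a \<Rightarrow> 'b" where
  "scaleR_fun r f = (\<lambda>x. r *\<^sub>R f x)"

instance
  by standard (auto simp: scaleR_fun_def plus_fun_def fun_eq_iff algebra_simps)

end

text \<open>A tangent vector at \<open>p\<close> is the family of its coordinate vectors with respect to all charts
  around \<open>p\<close>, related by the differentials of the transition maps. The components at the other
  charts are set to \<open>0\<close>, so that the tangent space is a subspace of the real vector space of
  functions.\<close>

type_synonym ('a, 'e) tvec = "('a, 'e) chart \<Rightarrow> 'e"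

definition points :: "('a, 'e) atlas \<Rightarrow> 'a set" where
  "points A = (\<Union>c\<in>A. fst c)"

definition tangent_space :: "('a, 'e::euclidean_space) atlas \<Rightarrow> 'a \<Rightarrow> ('a, 'e) tvec set" where
  "tangent_space A p =
     {v. (\<forall>c\<in>A. \<forall>d\<in>A. p \<in> fst c \<longrightarrow> p \<in> fst d \<longrightarrow>
            v d = frechet_derivative (transition c d) (at (snd c p)) (v c)) \<and>
         (\<forall>c. \<not> (c \<in> A \<and> p \<in> fst c) \<longrightarrow> v c = 0)}"

text \<open>The tangent vector at \<open>p\<close> with coordinate vector \<open>e\<close> in the chart \<open>c\<close>; for a fixed basis
  vector \<open>e\<close> this is the usual coordinate field \<open>\<partial>/\<partial>x\<^sup>i\<close> of the chart.\<close>

definition coord_vector ::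
    "('a, 'e::euclidean_space) atlas \<Rightarrow> ('a, 'e) chart \<Rightarrow> 'a \<Rightarrow> 'e \<Rightarrow> ('a, 'e) tvec" where
  "coord_vector A c p e =
     (\<lambda>d. if d \<in> A \<and> p \<in> fst d then frechet_derivative (transition c d) (at (snd c p)) e else 0)"

definition linear_on_subspace ::
    "'v::real_vector set \<Rightarrow> ('v \<Rightarrow> 'w::real_vector) \<Rightarrow> bool" where
  "linear_on_subspace V L \<longleftrightarrow>
     (\<forall>v\<in>V. \<forall>w\<in>V. \<forall>a b. L (a *\<^sub>R v + b *\<^sub>R w) = a *\<^sub>R L v + b *\<^sub>R L w)"

text \<open>A tensor field assigns to every point a multilinear object on the tangent space, and its
  components in every chart are smooth. Values outside the tangent spaces are irrelevant.\<close>

definition vector_field ::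
    "('a, 'e::euclidean_space) atlas \<Rightarrow> ('a \<Rightarrow> ('a, 'e) tvec) \<Rightarrow> bool" where
  "vector_field A V \<longleftrightarrow>
     (\<forall>p\<in>points A. V p \<in> tangent_space A p) \<and>
     (\<forall>c\<in>A. smooth_on (chart_image c) (\<lambda>x. V (inv_chart c x) c))"

definition one_form ::
    "('a, 'e::euclidean_space) atlas \<Rightarrow> ('a \<Rightarrow> ('a, 'e) tvec \<Rightarrow> real) \<Rightarrow> bool" where
  "one_form A \<eta> \<longleftrightarrow>
     (\<forall>p\<in>points A. linear_on_subspace (tangent_space A p) (\<eta> p)) \<and>
     (\<forall>c\<in>A. \<forall>e. smooth_on (chart_image c)
        (\<lambda>x. let p = inv_chart c x in \<eta> p (coord_vector A c p e)))"

definition endo_field ::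
    "('a, 'e::euclidean_space) atlas \<Rightarrow> ('a \<Rightarrow> ('a, 'e) tvec \<Rightarrow> ('a, 'e) tvec) \<Rightarrow> bool" where
  "endo_field A J \<longleftrightarrow>
     (\<forall>p\<in>points A. linear_on_subspace (tangent_space A p) (J p) \<and>
        J p ` tangent_space A p \<subseteq> tangent_space A p) \<and>
     (\<forall>c\<in>A. \<forall>e. smooth_on (chart_image c)
        (\<lambda>x. let p = inv_chart c x in J p (coord_vector A c p e) c))"

definition bilinear_form_field ::
    "('a, 'e::euclidean_space) atlas \<Rightarrow>
     ('a \<Rightarrow> ('a, 'e) tvec \<Rightarrow> ('a, 'e) tvec \<Rightarrow> real) \<Rightarrow> bool" where
  "bilinear_form_field A g \<longleftrightarrow>
     (\<forall>p\<in>points A. \<forall>v\<in>tangent_space A p.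
        linear_on_subspace (tangent_space A p) (\<lambda>w. g p v w) \<and>
        linear_on_subspace (tangent_space A p) (\<lambda>w. g p w v)) \<and>
     (\<forall>c\<in>A. \<forall>e e'. smooth_on (chart_image c)
        (\<lambda>x. let p = inv_chart c x in g p (coord_vector A c p e) (coord_vector A c p e')))"

text \<open>The index of a symmetric bilinear form \<open>b\<close> on \<open>V\<close> is the largest dimension of a subspace
  of \<open>V\<close> on which \<open>b\<close> is negative definite.\<close>

definition negative_definite_on :: "'v::real_vector set \<Rightarrow> ('v \<Rightarrow> 'v \<Rightarrow> real) \<Rightarrow> bool" where
  "negative_definite_on W b \<longleftrightarrow> (\<forall>w\<in>W. w \<noteq> 0 \<longrightarrow> b w w < 0)"

definition has_index :: "'v::real_vector set \<Rightarrow> ('v \<Rightarrow> 'v \<Rightarrow> real) \<Rightarrow> nat \<Rightarrow> bool" where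
  "has_index V b \<nu> \<longleftrightarrow>
     (\<exists>W. subspace W \<and> W \<subseteq> V \<and> negative_definite_on W b \<and> dim W = \<nu>) \<and>
     (\<forall>W. subspace W \<and> W \<subseteq> V \<and> negative_definite_on W b \<longrightarrow> dim W \<le> \<nu>)"

definition semi_Riemannian_metric ::
    "('a, 'e::euclidean_space) atlas \<Rightarrow>
     ('a \<Rightarrow> ('a, 'e) tvec \<Rightarrow> ('a, 'e) tvec \<Rightarrow> real) \<Rightarrow> bool" where
  "semi_Riemannian_metric A g \<longleftrightarrow> bilinear_form_field A g \<and>
     (\<forall>p\<in>points A. \<forall>v\<in>tangent_space A p. \<forall>w\<in>tangent_space A p. g p v w = g p w v) \<and>
     (\<forall>p\<in>points A. \<forall>v\<in>tangent_space A p. (\<forall>w\<in>tangent_space A p. g p v w = 0) \<longrightarrow> v = 0) \<and>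
     (\<exists>\<nu>. \<forall>p\<in>points A. has_index (tangent_space A p) (g p) \<nu>)"


section \<open>Metric mixed 3-structures\<close>

definition eps :: "nat \<Rightarrow> real" where
  "eps \<alpha> = (if \<alpha> = 1 then 1 else - 1)"

definition even_perms3 :: "(nat \<times> nat \<times> nat) set" where
  "even_perms3 = {(1, 2, 3), (2, 3, 1), (3, 1, 2)}"

text \<open>For \<open>\<epsilon> = 1\<close> an almost contact structure, for \<open>\<epsilon> = - 1\<close> a Lorentzian almost paracontact
  structure.\<close>

definition almost_eps_contact_structure ::
    "('a, 'e::euclidean_space) atlas \<Rightarrow> real \<Rightarrow> ('a \<Rightarrow> ('a, 'e) tvec \<Rightarrow> ('a, 'e) tvec) \<Rightarrow>
     ('a \<Rightarrow> ('a, 'e) tvec) \<Rightarrow> ('a \<Rightarrow> ('a, 'e) tvec \<Rightarrow> real) \<Rightarrow> bool" where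
  "almost_eps_contact_structure A \<epsilon> \<phi> \<xi> \<eta> \<longleftrightarrow>
     endo_field A \<phi> \<and> vector_field A \<xi> \<and> one_form A \<eta> \<and>
     (\<forall>p\<in>points A. \<forall>v\<in>tangent_space A p. \<phi> p (\<phi> p v) = - (\<epsilon> *\<^sub>R v) + \<eta> p v *\<^sub>R \<xi> p) \<and>
     (\<forall>p\<in>points A. \<eta> p (\<xi> p) = \<epsilon>)"

definition mixed_3_structure ::
    "('a, 'e::euclidean_space) atlas \<Rightarrow> (nat \<Rightarrow> 'a \<Rightarrow> ('a, 'e) tvec \<Rightarrow> ('a, 'e) tvec) \<Rightarrow>
     (nat \<Rightarrow> 'a \<Rightarrow> ('a, 'e) tvec) \<Rightarrow> (nat \<Rightarrow> 'a \<Rightarrow> ('a, 'e) tvec \<Rightarrow> real) \<Rightarrow> bool" where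
  "mixed_3_structure A \<phi> \<xi> \<eta> \<longleftrightarrow>
     (\<forall>\<alpha>\<in>{1, 2, 3}. almost_eps_contact_structure A (eps \<alpha>) (\<phi> \<alpha>) (\<xi> \<alpha>) (\<eta> \<alpha>)) \<and>
     (\<forall>\<alpha>\<in>{1, 2, 3}. \<forall>\<beta>\<in>{1, 2, 3}. \<alpha> \<noteq> \<beta> \<longrightarrow> (\<forall>p\<in>points A. \<eta> \<alpha> p (\<xi> \<beta> p) = 0)) \<and>
     (\<forall>(\<alpha>, \<beta>, \<gamma>)\<in>even_perms3. \<forall>p\<in>points A.
        \<phi> \<alpha> p (\<xi> \<beta> p) = eps \<gamma> *\<^sub>R \<xi> \<gamma> p \<and>
        - \<phi> \<beta> p (\<xi> \<alpha> p) = eps \<gamma> *\<^sub>R \<xi> \<gamma> p \<and>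
        (\<forall>v\<in>tangent_space A p.
           \<eta> \<alpha> p (\<phi> \<beta> p v) = eps \<gamma> * \<eta> \<gamma> p v \<and>
           - \<eta> \<beta> p (\<phi> \<alpha> p v) = eps \<gamma> * \<eta> \<gamma> p v \<and>
           \<phi> \<alpha> p (\<phi> \<beta> p v) - \<eta> \<beta> p v *\<^sub>R \<xi> \<alpha> p = eps \<gamma> *\<^sub>R \<phi> \<gamma> p v \<and>
           - \<phi> \<beta> p (\<phi> \<alpha> p v) + \<eta> \<alpha> p v *\<^sub>R \<xi> \<beta> p = eps \<gamma> *\<^sub>R \<phi> \<gamma> p v))"

definition metric_mixed_3_structure ::
    "('a, 'e::euclidean_space) atlas \<Rightarrow> (nat \<Rightarrow> 'a \<Rightarrow> ('a, 'e) tvec \<Rightarrow> ('a, 'e) tvec) \<Rightarrow>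
     (nat \<Rightarrow> 'a \<Rightarrow> ('a, 'e) tvec) \<Rightarrow> (nat \<Rightarrow> 'a \<Rightarrow> ('a, 'e) tvec \<Rightarrow> real) \<Rightarrow>
     ('a \<Rightarrow> ('a, 'e) tvec \<Rightarrow> ('a, 'e) tvec \<Rightarrow> real) \<Rightarrow> bool" where
  "metric_mixed_3_structure A \<phi> \<xi> \<eta> g \<longleftrightarrow>
     mixed_3_structure A \<phi> \<xi> \<eta> \<and> semi_Riemannian_metric A g \<and>
     (\<forall>\<alpha>\<in>{1, 2, 3}. \<forall>V W. vector_field A V \<and> vector_field A W \<longrightarrow>
        (\<forall>p\<in>points A.
           g p (\<phi> \<alpha> p (V p)) (\<phi> \<alpha> p (W p))
             = eps \<alpha> * g p (V p) (W p) - \<eta> \<alpha> p (V p) * \<eta> \<alpha> p (W p) \<and>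
           g p (V p) (\<xi> \<alpha> p) = \<eta> \<alpha> p (V p)))"


section \<open>Almost para-hyperhermitian structures\<close>

definition endo_eq :: "('a, 'e::euclidean_space) atlas \<Rightarrow>
    ('a \<Rightarrow> ('a, 'e) tvec \<Rightarrow> ('a, 'e) tvec) \<Rightarrow> ('a \<Rightarrow> ('a, 'e) tvec \<Rightarrow> ('a, 'e) tvec) \<Rightarrow> bool" where
  "endo_eq A J K \<longleftrightarrow> (\<forall>p\<in>points A. \<forall>v\<in>tangent_space A p. J p v = K p v)"

definition almost_para_hypercomplex_structure ::
    "('a, 'e::euclidean_space) atlas \<Rightarrow> (nat \<Rightarrow> 'a \<Rightarrow> ('a, 'e) tvec \<Rightarrow> ('a, 'e) tvec) \<Rightarrow> bool" where
  "almost_para_hypercomplex_structure A J \<longleftrightarrow>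
     (\<forall>\<alpha>\<in>{1, 2, 3}. endo_field A (J \<alpha>)) \<and>
     endo_eq A (\<lambda>p v. J 1 p (J 1 p v)) (\<lambda>p v. - v) \<and>
     endo_eq A (\<lambda>p v. J 2 p (J 2 p v)) (\<lambda>p v. v) \<and>
     endo_eq A (\<lambda>p v. J 3 p (J 3 p v)) (\<lambda>p v. v) \<and>
     (\<forall>\<alpha>\<in>{2, 3}. \<not> endo_eq A (J \<alpha>) (\<lambda>p v. v) \<and> \<not> endo_eq A (J \<alpha>) (\<lambda>p v. - v)) \<and>
     endo_eq A (\<lambda>p v. J 2 p (J 1 p v)) (J 3) \<and>
     endo_eq A (\<lambda>p v. - J 1 p (J 2 p v)) (J 3)"

definition almost_para_hyperhermitian_structure ::
    "('a, 'e::euclidean_space) atlas \<Rightarrow> (nat \<Rightarrow> 'a \<Rightarrow> ('a, 'e) tvec \<Rightarrow> ('a, 'e) tvec) \<Rightarrow>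
     ('a \<Rightarrow> ('a, 'e) tvec \<Rightarrow> ('a, 'e) tvec \<Rightarrow> real) \<Rightarrow> bool" where
  "almost_para_hyperhermitian_structure A J g \<longleftrightarrow>
     almost_para_hypercomplex_structure A J \<and> semi_Riemannian_metric A g \<and>
     (\<forall>\<alpha>\<in>{1, 2, 3}. \<forall>V W. vector_field A V \<and> vector_field A W \<longrightarrow>
        (\<forall>p\<in>points A. g p (J \<alpha> p (V p)) (J \<alpha> p (W p)) = eps \<alpha> * g p (V p) (W p)))"

end

theory Submission
  imports Defs
begin

text \<open>
  Let \<open>\<zeta>\<close> be the fundamental vector field of the circle action on the bundle, and let \<open>\<omega>\<close> be a
  1-form on the bundle with \<open>\<omega>(\<zeta>) = 1\<close>. The vectors killed by the differential of the projection
  \<open>\<pi>\<close> are the multiples of \<open>\<zeta>\<close>, so \<open>v \<mapsto> (d\<pi> v, \<omega> v)\<close> identifies the tangent space of the bundle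
  at \<open>u\<close> with the tangent space of the base at \<open>\<pi> u\<close> plus a line. In this splitting put
  \<open>J\<^sub>\<alpha> (X, f) = (\<phi>\<^sub>\<alpha> X - f \<xi>\<^sub>\<alpha>, \<eta>\<^sub>\<alpha> X)\<close> and \<open>h ((X, f), (Y, f')) = g (X, Y) + f f'\<close>.

  All algebraic conditions become identities at a point. From \<open>\<phi>\<^sub>\<alpha>\<^sup>2 = - \<epsilon>\<^sub>\<alpha> Id + \<eta>\<^sub>\<alpha> \<otimes> \<xi>\<^sub>\<alpha>\<close>,
  \<open>\<phi>\<^sub>\<alpha> \<xi>\<^sub>\<alpha> = 0\<close> and \<open>\<eta>\<^sub>\<alpha> \<circ> \<phi>\<^sub>\<alpha> = 0\<close> one gets \<open>J\<^sub>\<alpha>\<^sup>2 = - \<epsilon>\<^sub>\<alpha> Id\<close> (\<open>lift_endo_square\<close>); the term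
  \<open>\<eta>\<^sub>\<beta> \<otimes> \<xi>\<^sub>\<alpha>\<close> that separates \<open>\<phi>\<^sub>\<alpha> \<phi>\<^sub>\<beta>\<close> from \<open>\<epsilon>\<^sub>\<gamma> \<phi>\<^sub>\<gamma>\<close> is exactly what \<open>J\<^sub>\<alpha>\<close> subtracts on
  account of the line component of \<open>J\<^sub>\<beta> X\<close>, which gives the quaternionic relations
  (\<open>lift_endo_compose\<close>); and the
  product \<open>\<eta>\<^sub>\<alpha>(X) \<eta>\<^sub>\<alpha>(Y)\<close> subtracted in the compatibility of \<open>g\<close> is restored by the line part of
  \<open>h (J\<^sub>\<alpha> X, J\<^sub>\<alpha> Y)\<close> (\<open>lift_metric_lift_endo\<close>). Since \<open>J\<^sub>\<alpha> \<zeta>\<close> has line component 0, \<open>J\<^sub>\<alpha>\<close> is not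
  \<open>\<plusminus>Id\<close>. The form \<open>h\<close> is positive on the line, so \<open>d\<pi>\<close> is injective on subspaces on which \<open>h\<close> is
  negative definite and carries them to such subspaces for \<open>g\<close>; hence \<open>h\<close> has the index of \<open>g\<close>
  (\<open>has_index_lift_metric\<close>).

  The existence of \<open>\<omega>\<close> is the only global step (\<open>dual_form\<close>): smooth cut-off functions and
  second countability give a locally finite sum of Euclidean inner products in charts, that is, a
  Riemannian metric, and \<open>\<omega>\<close> is the inner product with \<open>\<zeta>\<close>, normalised.

  Smoothness is local and is read off in charts made from local trivialisations
  (\<open>adapted_chart_at\<close>): their values are pairs of a coordinate vector of the base and an angle,
  \<open>\<pi>\<close> is the first projection, and \<open>\<zeta>\<close> is the constant vector \<open>(0, 1)\<close>. There the inverse of the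
  splitting is an explicit smooth expression in \<open>\<omega>\<close> (\<open>assemble_adapted\<close>).
\<close>

section \<open>Calculus of smooth maps\<close>

text \<open>The assumption \<open>cong\<close> is the congruence rule \<open>C_on_cong\<close> for \<open>k\<close>; it is taken as a premise
  because the induction that proves \<open>C_on_cong\<close> applies this rule at \<open>k\<close>.\<close>

lemma C_on_SucI:
  fixes f :: "'a::real_normed_vector \<Rightarrow> 'b::real_normed_vector"
  assumes "open S"
    and "\<And>x. x \<in> S \<Longrightarrow> (f has_derivative f' x) (at x)"
    and "\<And>v. C_on k S (\<lambda>x. f' x v)"
    and cong: "\<And>g h. (\<And>x. x \<in> S \<Longrightarrow> g x = (h x :: 'b)) \<Longrightarrow> C_on k S g = C_on k S h"
  shows "C_on (Suc k) S f"
proof -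
  have "C_on k S (\<lambda>x. frechet_derivative f (at x) v)" for v
    using cong[of "\<lambda>x. frechet_derivative f (at x) v" "\<lambda>x. f' x v"] assms(3)[of v]
      frechet_derivative_at[OF assms(2)] by simp
  then show ?thesis
    using assms(2) by (auto simp: differentiable_def)
qed

lemma C_on_SucD:
  assumes "C_on (Suc k) S f" "x \<in> S"
  shows "(f has_derivative frechet_derivative f (at x)) (at x)"
  using assms frechet_derivative_works[of f "at x"] by simp

lemma C_on_cong:
  assumes "open S" "\<And>x. x \<in> S \<Longrightarrow> f x = g x"
  shows "C_on k S f = C_on k S g"
  using assms(2)
proof (induction k arbitrary: f g)
  case 0
  show ?case
    unfolding C_on.simps by (rule continuous_on_cong[OF refl]) (rule 0)
next
  case (Suc k)
  have *: "C_on (Suc k) S q" if "C_on (Suc k) S r" "\<And>x. x \<in> S \<Longrightarrow> r x = q x" for r q :: "'a \<Rightarrow> 'b"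
  proof (rule C_on_SucI[OF assms(1)])
    show "(q has_derivative frechet_derivative r (at x)) (at x)" if "x \<in> S" for x
      using has_derivative_transform_within_open[OF C_on_SucD assms(1)] that \<open>C_on (Suc k) S r\<close>
        \<open>\<And>x. x \<in> S \<Longrightarrow> r x = q x\<close> by blast
    show "C_on k S (\<lambda>x. frechet_derivative r (at x) v)" for v
      using that(1) by simp
    show "C_on k S u = C_on k S h" if "\<And>x. x \<in> S \<Longrightarrow> u x = h x" for u h :: "'a \<Rightarrow> 'b"
      using Suc.IH that by blast
  qed
  show ?case
    using *[of f g, OF _ Suc.prems] *[of g f, OF _ Suc.prems[symmetric]] by blast
qed

lemma C_on_Suc_has_derivative:
  assumes "open S"
    and "\<And>x. x \<in> S \<Longrightarrow> (f has_derivative f' x) (at x)"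
    and "\<And>v. C_on k S (\<lambda>x. f' x v)"
  shows "C_on (Suc k) S f"
  by (rule C_on_SucI[OF assms C_on_cong[OF assms(1)]])

lemma C_on_Suc_imp: "C_on (Suc k) S f \<Longrightarrow> C_on k S f"
proof (induction k arbitrary: f)
  case 0
  then show ?case
    by (auto intro!: continuous_at_imp_continuous_on differentiable_imp_continuous_within)
next
  case (Suc k)
  have "C_on (Suc k) S (\<lambda>x. frechet_derivative f (at x) v)" for v
    using Suc.prems by simp
  then show ?case
    using Suc.IH Suc.prems by simp
qed

lemma C_on_subset: "C_on k S f \<Longrightarrow> T \<subseteq> S \<Longrightarrow> C_on k T f"
  by (induction k arbitrary: f) (auto intro: continuous_on_subset)

lemma C_on_local:
  assumes "\<And>x. x \<in> S \<Longrightarrow> \<exists>T. open T \<and> x \<in> T \<and> C_on k T f"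
  shows "C_on k S f"
  using assms
proof (induction k arbitrary: f)
  case 0
  then show ?case
    by (metis C_on.simps(1) continuous_at_imp_continuous_on continuous_on_eq_continuous_at)
next
  case (Suc k)
  have "f differentiable (at x)" if "x \<in> S" for x
    using Suc.prems[OF that] by auto
  moreover have "C_on k S (\<lambda>x. frechet_derivative f (at x) v)" for v
    using Suc.prems by (intro Suc.IH) (metis C_on.simps(2))
  ultimately show ?case by simp
qed

lemma C_on_const: "open S \<Longrightarrow> C_on k S (\<lambda>x. c)"
proof (induction k arbitrary: c)
  case (Suc k)
  then show ?case
    by (intro C_on_Suc_has_derivative[where f' = "\<lambda>x v. 0"]) (auto intro!: derivative_eq_intros)
qed auto

lemma C_on_bounded_linear:
  assumes "bounded_linear L" "open S" "C_on k S f"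
  shows "C_on k S (\<lambda>x. L (f x))"
  using assms(3)
proof (induction k arbitrary: f)
  case 0
  then show ?case
    using assms(1) by (simp add: bounded_linear.continuous_on)
next
  case (Suc k)
  show ?case
  proof (rule C_on_Suc_has_derivative[OF assms(2)])
    show "((\<lambda>x. L (f x)) has_derivative (\<lambda>v. L (frechet_derivative f (at x) v))) (at x)"
      if "x \<in> S" for x
      using bounded_linear.has_derivative[OF assms(1) C_on_SucD[OF Suc.prems that]] .
    show "C_on k S (\<lambda>x. L (frechet_derivative f (at x) v))" for v
      using Suc.prems by (intro Suc.IH) simp
  qed
qed

lemma C_on_add:
  assumes "open S" "C_on k S f" "C_on k S g"
  shows "C_on k S (\<lambda>x. f x + g x)"
  using assms(2,3)
proof (induction k arbitrary: f g)
  case (Suc k)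
  show ?case
  proof (rule C_on_Suc_has_derivative[OF assms(1)])
    show "((\<lambda>x. f x + g x) has_derivative
        (\<lambda>v. frechet_derivative f (at x) v + frechet_derivative g (at x) v)) (at x)"
      if "x \<in> S" for x
      using C_on_SucD[OF Suc.prems(1) that] C_on_SucD[OF Suc.prems(2) that]
      by (rule has_derivative_add)
    show "C_on k S (\<lambda>x. frechet_derivative f (at x) v + frechet_derivative g (at x) v)" for v
      using Suc.prems by (intro Suc.IH) auto
  qed
qed (auto intro: continuous_intros)

lemma C_on_bilinear:
  assumes "bounded_bilinear b" "open S" "C_on k S f" "C_on k S g"
  shows "C_on k S (\<lambda>x. b (f x) (g x))"
  using assms(3,4)
proof (induction k arbitrary: f g)
  case 0
  then show ?case
    using bounded_bilinear.continuous_on[OF assms(1)] by simp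
next
  case (Suc k)
  show ?case
  proof (rule C_on_Suc_has_derivative[OF assms(2)])
    show "((\<lambda>x. b (f x) (g x)) has_derivative
        (\<lambda>v. b (f x) (frechet_derivative g (at x) v) + b (frechet_derivative f (at x) v) (g x))) (at x)"
      if "x \<in> S" for x
      using C_on_SucD[OF Suc.prems(1) that] C_on_SucD[OF Suc.prems(2) that]
      by (rule bounded_bilinear.FDERIV[OF assms(1)])
    show "C_on k S (\<lambda>x. b (f x) (frechet_derivative g (at x) v)
        + b (frechet_derivative f (at x) v) (g x))" for v
      using Suc.prems C_on_Suc_imp[OF Suc.prems(1)] C_on_Suc_imp[OF Suc.prems(2)]
      by (intro C_on_add[OF assms(2)] Suc.IH) auto
  qed
qed

lemma C_on_sum:
  assumes "open S" "\<And>i. i \<in> I \<Longrightarrow> C_on k S (f i)"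
  shows "C_on k S (\<lambda>x. \<Sum>i\<in>I. f i x)"
  using assms(2)
  by (induction I rule: infinite_finite_induct)
    (auto simp: C_on_const[OF assms(1)] intro!: C_on_add[OF assms(1)])

lemma linear_euclidean_expansion:
  fixes e :: "'e::euclidean_space"
  assumes "linear L"
  shows "L e = (\<Sum>i\<in>Basis. (e \<bullet> i) *\<^sub>R L i)"
  by (metis (no_types, lifting) assms euclidean_representation linear_sum linear_scale sum.cong)

text \<open>By the chain rule the derivative of \<open>f \<circ> g\<close> in direction \<open>v\<close> is \<open>Df(g x) (Dg(x) v)\<close>, where both
  the point and the direction depend on \<open>x\<close>. Expanding the direction in the standard basis turns this
  into a sum of products of functions \<open>Df(g x) i\<close> and \<open>Dg(x) v \<bullet> i\<close>, to which the induction
  hypothesis applies; this is why the intermediate space is Euclidean.\<close>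

lemma C_on_compose:
  fixes f :: "'a::euclidean_space \<Rightarrow> 'b::real_normed_vector"
  assumes "open S" "open T" "C_on k T f" "C_on k S g" "g ` S \<subseteq> T"
  shows "C_on k S (\<lambda>x. f (g x))"
  using assms(3-5)
proof (induction k arbitrary: f g)
  case 0
  then show ?case
    using continuous_on_compose2[of T f S g] by auto
next
  case (Suc k)
  show ?case
  proof (rule C_on_Suc_has_derivative[OF assms(1)])
    let ?D = "\<lambda>f x. frechet_derivative f (at x)"
    show "((\<lambda>x. f (g x)) has_derivative
        (\<lambda>v. \<Sum>i\<in>Basis. (?D g x v \<bullet> i) *\<^sub>R ?D f (g x) i)) (at x)"
      if "x \<in> S" for x
    proof -
      have f: "(f has_derivative ?D f (g x)) (at (g x))"
        using C_on_SucD[OF Suc.prems(1), of "g x"] Suc.prems(3) that by auto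
      have "((\<lambda>x. f (g x)) has_derivative (\<lambda>v. ?D f (g x) (?D g x v))) (at x)"
        using has_derivative_compose[OF C_on_SucD[OF Suc.prems(2) that] f] .
      moreover have "?D f (g x) (?D g x v) = (\<Sum>i\<in>Basis. (?D g x v \<bullet> i) *\<^sub>R ?D f (g x) i)" for v
        by (rule linear_euclidean_expansion[OF has_derivative_linear[OF f]])
      ultimately show ?thesis by simp
    qed
    show "C_on k S (\<lambda>x. \<Sum>i\<in>Basis. (?D g x v \<bullet> i) *\<^sub>R ?D f (g x) i)" for v
    proof (intro C_on_sum C_on_bilinear[OF bounded_bilinear_scaleR] assms(1))
      fix i :: 'a
      show "C_on k S (\<lambda>x. ?D g x v \<bullet> i)"
        using Suc.prems(2) by (intro C_on_bounded_linear[OF bounded_linear_inner_left assms(1)]) simp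
      show "C_on k S (\<lambda>x. ?D f (g x) i)"
        using Suc.prems C_on_Suc_imp[OF Suc.prems(2)] by (intro Suc.IH) auto
    qed
  qed
qed

lemma smooth_on_cong: "open S \<Longrightarrow> (\<And>x. x \<in> S \<Longrightarrow> f x = g x) \<Longrightarrow> smooth_on S f = smooth_on S g"
  unfolding smooth_on_def using C_on_cong by metis

lemma smooth_on_eq:
  assumes "open S" "smooth_on S g" "\<And>x. x \<in> S \<Longrightarrow> f x = g x"
  shows "smooth_on S f"
  using assms(2) smooth_on_cong[OF assms(1), of f g, OF assms(3)] by simp

lemma smooth_on_subset: "smooth_on S f \<Longrightarrow> T \<subseteq> S \<Longrightarrow> smooth_on T f"
  unfolding smooth_on_def using C_on_subset by metis

lemma smooth_on_local:
  "(\<And>x. x \<in> S \<Longrightarrow> \<exists>T. open T \<and> x \<in> T \<and> smooth_on T f) \<Longrightarrow> smooth_on S f"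
  unfolding smooth_on_def by (intro allI C_on_local) metis

lemma smooth_on_has_derivative:
  "smooth_on S f \<Longrightarrow> x \<in> S \<Longrightarrow> (f has_derivative frechet_derivative f (at x)) (at x)"
  unfolding smooth_on_def using C_on_SucD by metis

lemma smooth_on_frechet: "smooth_on S f \<Longrightarrow> smooth_on S (\<lambda>x. frechet_derivative f (at x) v)"
  unfolding smooth_on_def by (metis C_on.simps(2))

lemma smooth_on_imp_continuous_on: "smooth_on S f \<Longrightarrow> continuous_on S f"
  unfolding smooth_on_def by (metis C_on.simps(1))

lemma smooth_on_const: "open S \<Longrightarrow> smooth_on S (\<lambda>x. c)"
  by (simp add: smooth_on_def C_on_const)

lemma smooth_on_bounded_linear:
  "bounded_linear L \<Longrightarrow> open S \<Longrightarrow> smooth_on S f \<Longrightarrow> smooth_on S (\<lambda>x. L (f x))"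
  by (simp add: smooth_on_def C_on_bounded_linear)

lemma smooth_on_id: "open S \<Longrightarrow> smooth_on S (\<lambda>x. x)"
  unfolding smooth_on_def
proof
  fix k assume S: "open S"
  show "C_on k S (\<lambda>x. x)"
  proof (cases k)
    case (Suc k)
    then show ?thesis
      using C_on_Suc_has_derivative[OF S, of "\<lambda>x. x" "\<lambda>x v. v"] by (simp add: C_on_const[OF S])
  qed auto
qed

lemma smooth_on_add:
  "open S \<Longrightarrow> smooth_on S f \<Longrightarrow> smooth_on S g \<Longrightarrow> smooth_on S (\<lambda>x. f x + g x)"
  by (simp add: smooth_on_def C_on_add)

lemma smooth_on_bilinear:
  "bounded_bilinear b \<Longrightarrow> open S \<Longrightarrow> smooth_on S f \<Longrightarrow> smooth_on S g \<Longrightarrow>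
    smooth_on S (\<lambda>x. b (f x) (g x))"
  by (simp add: smooth_on_def C_on_bilinear)

lemmas smooth_on_scaleR = smooth_on_bilinear[OF bounded_bilinear_scaleR]
lemmas smooth_on_inner = smooth_on_bilinear[OF bounded_bilinear_inner]
lemmas smooth_on_mult = smooth_on_bilinear[OF bounded_bilinear_mult]

lemma smooth_on_uminus: "open S \<Longrightarrow> smooth_on S f \<Longrightarrow> smooth_on S (\<lambda>x. - f x)"
  by (rule smooth_on_bounded_linear[OF bounded_linear_minus[OF bounded_linear_ident]])

lemma smooth_on_diff:
  "open S \<Longrightarrow> smooth_on S f \<Longrightarrow> smooth_on S g \<Longrightarrow> smooth_on S (\<lambda>x. f x - g x)"
  using smooth_on_add[of S f "\<lambda>x. - g x"] smooth_on_uminus[of S g] by simp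

lemma smooth_on_sum:
  "open S \<Longrightarrow> (\<And>i. i \<in> I \<Longrightarrow> smooth_on S (f i)) \<Longrightarrow> smooth_on S (\<lambda>x. \<Sum>i\<in>I. f i x)"
  by (simp add: smooth_on_def C_on_sum)

lemma smooth_on_prod:
  fixes f :: "'i \<Rightarrow> 'a::real_normed_vector \<Rightarrow> real"
  assumes "open S" "\<And>i. i \<in> I \<Longrightarrow> smooth_on S (f i)"
  shows "smooth_on S (\<lambda>x. \<Prod>i\<in>I. f i x)"
  using assms(2)
  by (induction I rule: infinite_finite_induct)
    (auto simp: smooth_on_const[OF assms(1)] intro!: smooth_on_mult[OF assms(1)])

lemma smooth_on_Pair:
  assumes "open S" "smooth_on S f" "smooth_on S g"
  shows "smooth_on S (\<lambda>x. (f x, g x))"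
proof -
  have "smooth_on S (\<lambda>x. (f x, 0))" "smooth_on S (\<lambda>x. (0, g x))"
    using smooth_on_bounded_linear[of "\<lambda>y. (y, 0)" S f] smooth_on_bounded_linear[of "\<lambda>y. (0, y)" S g]
      assms by (simp_all add: bounded_linear_Pair)
  then have "smooth_on S (\<lambda>x. (f x, 0) + (0, g x))"
    by (rule smooth_on_add[OF assms(1)])
  then show ?thesis by simp
qed

lemma smooth_on_compose:
  fixes f :: "'a::euclidean_space \<Rightarrow> 'b::real_normed_vector"
  shows "open S \<Longrightarrow> open T \<Longrightarrow> smooth_on T f \<Longrightarrow> smooth_on S g \<Longrightarrow> g ` S \<subseteq> T \<Longrightarrow>
    smooth_on S (\<lambda>x. f (g x))"
  unfolding smooth_on_def using C_on_compose by metis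

text \<open>Tensor components are smooth in the point for constant arguments only; expansion in the basis
  extends this to arguments that vary smoothly with the point.\<close>

lemma smooth_on_linear_family:
  fixes L :: "'x::real_normed_vector \<Rightarrow> 'e::euclidean_space \<Rightarrow> 'b::real_normed_vector"
  assumes "open S" "\<And>x. x \<in> S \<Longrightarrow> linear (L x)" "\<And>i. i \<in> Basis \<Longrightarrow> smooth_on S (\<lambda>x. L x i)"
    and "smooth_on S v"
  shows "smooth_on S (\<lambda>x. L x (v x))"
proof -
  have "smooth_on S (\<lambda>x. \<Sum>i\<in>Basis. (v x \<bullet> i) *\<^sub>R L x i)"
    using assms by (intro smooth_on_sum smooth_on_scaleR smooth_on_inner smooth_on_const) auto
  then show ?thesis
    by (subst smooth_on_cong[OF assms(1) linear_euclidean_expansion[OF assms(2)]])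
qed

lemma smooth_on_frechet_apply:
  fixes f :: "'a::euclidean_space \<Rightarrow> 'b::real_normed_vector"
  assumes "open S" "open T" "smooth_on T f" "smooth_on S g" "g ` S \<subseteq> T" "smooth_on S v"
  shows "smooth_on S (\<lambda>x. frechet_derivative f (at (g x)) (v x))"
proof (rule smooth_on_linear_family[OF assms(1) _ _ assms(6)])
  show "linear (frechet_derivative f (at (g x)))" if "x \<in> S" for x
    using smooth_on_has_derivative[OF assms(3)] assms(5) that has_derivative_linear by blast
  show "smooth_on S (\<lambda>x. frechet_derivative f (at (g x)) i)" for i
    by (rule smooth_on_compose[OF assms(1,2) smooth_on_frechet[OF assms(3)] assms(4,5)])
qed

lemma smooth_on_inverse:
  fixes f :: "'a::real_normed_vector \<Rightarrow> real"
  assumes "open S" "smooth_on S f" "\<And>x. x \<in> S \<Longrightarrow> f x \<noteq> 0"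
  shows "smooth_on S (\<lambda>x. inverse (f x))"
proof -
  have o: "open (- {0::real})" by (rule open_Compl) simp
  have "C_on k (- {0::real}) inverse" for k
  proof (induction k)
    case 0
    then show ?case by (auto intro!: continuous_intros)
  next
    case (Suc k)
    show ?case
    proof (rule C_on_Suc_has_derivative[OF o])
      show "(inverse has_derivative (\<lambda>v. (inverse x * inverse x) *\<^sub>R (- v))) (at x)"
        if "x \<in> - {0::real}" for x
        using that by (auto intro!: derivative_eq_intros)
      show "C_on k (- {0::real}) (\<lambda>x. (inverse x * inverse x) *\<^sub>R (- v))" for v
        by (intro C_on_bilinear[OF bounded_bilinear_scaleR] C_on_bilinear[OF bounded_bilinear_mult]
            C_on_const o Suc)
    qed
  qed
  then have "smooth_on (- {0::real}) inverse"
    by (simp add: smooth_on_def)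
  moreover have "f ` S \<subseteq> - {0}"
    using assms(3) by (intro image_subsetI) simp
  ultimately show ?thesis
    by (rule smooth_on_compose[OF assms(1) o _ assms(2)])
qed

section \<open>A smooth step function\<close>

text \<open>The functions \<open>t\<^sup>-\<^sup>n exp(- 1/t)\<close>, extended by 0 to \<open>t \<le> 0\<close>. The derivative of each is a linear
  combination of two others, so an induction over the order shows that all of them are smooth.\<close>

definition flat_exp :: "nat \<Rightarrow> real \<Rightarrow> real" where
  "flat_exp n t = (if t > 0 then inverse t ^ n * exp (- inverse t) else 0)"

lemma flat_exp_tendsto_0: "((flat_exp n) \<longlongrightarrow> 0) (at 0)"
proof (rule filterlim_split_at)
  have "((\<lambda>t. inverse t ^ n / exp (inverse t)) \<longlongrightarrow> 0) (at_right (0::real))"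
    by (rule filterlim_compose[OF tendsto_power_div_exp_0 filterlim_inverse_at_top_right])
  then show "(flat_exp n \<longlongrightarrow> 0) (at_right 0)"
    by (rule Lim_transform_eventually)
      (auto simp: eventually_at_filter flat_exp_def exp_minus divide_inverse)
  show "(flat_exp n \<longlongrightarrow> 0) (at_left 0)"
    by (rule tendsto_eventually) (auto simp: eventually_at_filter flat_exp_def)
qed

lemma DERIV_flat_exp:
  "(flat_exp n has_real_derivative flat_exp (n + 2) t - real n * flat_exp (n + 1) t) (at t)"
proof -
  consider "t > 0" | "t = 0" | "t < 0" by linarith
  then show ?thesis
  proof cases
    case 1
    have "((\<lambda>t. inverse t ^ n * exp (- inverse t)) has_real_derivative
        flat_exp (n + 2) t - real n * flat_exp (n + 1) t) (at t)"
      using 1 by (auto intro!: derivative_eq_intros simp: flat_exp_def)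
        (cases n; simp add: algebra_simps power2_eq_square)
    then show ?thesis
      by (rule has_field_derivative_transform_within_open[where S = "{0<..}"])
        (use 1 in \<open>auto simp: flat_exp_def\<close>)
  next
    case 2
    have "((\<lambda>y. (flat_exp n y - flat_exp n 0) / (y - 0)) \<longlongrightarrow> 0) (at 0)"
      by (rule Lim_transform_eventually[OF flat_exp_tendsto_0[of "Suc n"]])
        (auto simp: eventually_at_filter flat_exp_def divide_inverse)
    then show ?thesis
      using 2 by (simp add: has_field_derivative_iff flat_exp_def)
  next
    case 3
    have "((\<lambda>t. 0) has_real_derivative flat_exp (n + 2) t - real n * flat_exp (n + 1) t) (at t)"
      using 3 by (simp add: flat_exp_def)
    then show ?thesis
      by (rule has_field_derivative_transform_within_open[where S = "{..<0}"])
        (use 3 in \<open>auto simp: flat_exp_def\<close>)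
  qed
qed

lemma smooth_flat_exp: "smooth_on UNIV (flat_exp n)"
  unfolding smooth_on_def
proof
  fix k show "C_on k UNIV (flat_exp n)"
  proof (induction k arbitrary: n)
    case 0
    then show ?case
      unfolding C_on.simps by (meson DERIV_flat_exp DERIV_isCont continuous_at_imp_continuous_on)
  next
    case (Suc k)
    show ?case
    proof (rule C_on_Suc_has_derivative)
      show "(flat_exp n has_derivative
          (\<lambda>v. v * flat_exp (n + 2) x + (- real n * v) * flat_exp (n + 1) x)) (at x)" for x
        using DERIV_flat_exp[of n x] unfolding has_field_derivative_def
        by (rule has_derivative_eq_rhs) (auto simp: algebra_simps)
      show "C_on k UNIV (\<lambda>x. v * flat_exp (n + 2) x + (- real n * v) * flat_exp (n + 1) x)" for v
        by (intro C_on_add C_on_bilinear[OF bounded_bilinear_mult] C_on_const Suc.IH) auto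
    qed auto
  qed
qed

definition step :: "real \<Rightarrow> real" where
  "step = flat_exp 0"

lemma smooth_step: "smooth_on UNIV step"
  by (simp add: step_def smooth_flat_exp)

lemma step_pos_iff: "step t > 0 \<longleftrightarrow> t > 0"
  by (simp add: step_def flat_exp_def)

lemma step_nonneg: "step t \<ge> 0"
  by (simp add: step_def flat_exp_def)

lemma step_eq_0_iff: "step t = 0 \<longleftrightarrow> t \<le> 0"
  using step_pos_iff[of t] step_nonneg[of t] by linarith

lemma smooth_on_step: "open S \<Longrightarrow> smooth_on S f \<Longrightarrow> smooth_on S (\<lambda>x. step (f x))"
  using smooth_on_compose[OF _ open_UNIV smooth_step] by auto

section \<open>Charts, changes of charts and tangent vectors\<close>

lemma inv_chart_left: "inj_on (snd c) (fst c) \<Longrightarrow> p \<in> fst c \<Longrightarrow> inv_chart c (snd c p) = p"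
  by (simp add: inv_chart_def)

lemma inv_chart_right:
  "x \<in> chart_image c \<Longrightarrow> snd c (inv_chart c x) = x" "x \<in> chart_image c \<Longrightarrow> inv_chart c x \<in> fst c"
  unfolding chart_image_def inv_chart_def by (auto intro: f_inv_into_f inv_into_into)

lemma is_chart_inj: "is_chart X c \<Longrightarrow> inj_on (snd c) (fst c)"
  unfolding is_chart_def homeomorphic_map_def
  by (metis openin_subset topspace_subtopology_subset)

lemma is_chart_open_image:
  assumes "is_chart X c" "openin X U"
  shows "open (snd c ` (fst c \<inter> U))"
proof -
  have "openin (top_of_set (chart_image c)) (snd c ` (fst c \<inter> U))"
    using assms homeomorphic_imp_open_map
    unfolding is_chart_def open_map_def by (metis inf_commute openin_subtopology_Int2)
  then show ?thesis
    using assms(1) openin_open_trans unfolding is_chart_def by blast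
qed

lemma is_chart_openin_vimage:
  assumes "is_chart X c" "open T"
  shows "openin X (fst c \<inter> snd c -` T)"
proof -
  have c: "openin X (fst c)" "continuous_map (subtopology X (fst c)) (top_of_set (chart_image c)) (snd c)"
    using assms(1) homeomorphic_imp_continuous_map unfolding is_chart_def by auto
  have "openin (top_of_set (chart_image c)) (chart_image c \<inter> T)"
    using assms(2) by (simp add: openin_open_Int)
  then have "openin (subtopology X (fst c))
      {x \<in> topspace (subtopology X (fst c)). snd c x \<in> chart_image c \<inter> T}"
    using c(2) openin_continuous_map_preimage by blast
  moreover have "{x \<in> topspace (subtopology X (fst c)). snd c x \<in> chart_image c \<inter> T}
      = fst c \<inter> snd c -` T"
    using openin_subset[OF c(1)] by (auto simp: chart_image_def)
  ultimately show ?thesis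
    using c(1) by (simp add: openin_open_subtopology)
qed

lemma is_chart_continuous_inv:
  assumes "is_chart X c"
  shows "continuous_map (top_of_set (chart_image c)) X (inv_chart c)"
proof -
  have o: "openin X (fst c)"
    using assms by (simp add: is_chart_def)
  have "continuous_map (top_of_set (chart_image c)) (subtopology X (fst c)) (inv_chart c)"
    unfolding continuous_map_def
  proof (intro conjI allI impI)
    show "inv_chart c \<in> topspace (top_of_set (chart_image c)) \<rightarrow> topspace (subtopology X (fst c))"
      using inv_chart_right(2) openin_subset[OF o] by fastforce
    fix U assume "openin (subtopology X (fst c)) U"
    then have U: "openin X U" "U \<subseteq> fst c"
      using o openin_open_subtopology by blast+
    have "{x \<in> topspace (top_of_set (chart_image c)). inv_chart c x \<in> U} = snd c ` (fst c \<inter> U)"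
      using is_chart_inj[OF assms] U(2) inv_chart_right[of _ c]
      by (auto simp: inv_chart_left chart_image_def image_iff)
    then show "openin (top_of_set (chart_image c))
        {x \<in> topspace (top_of_set (chart_image c)). inv_chart c x \<in> U}"
      using is_chart_open_image[OF assms U(1)] assms
      by (auto simp: is_chart_def chart_image_def intro!: open_subset)
  qed
  then show ?thesis
    using continuous_map_in_subtopology by blast
qed

text \<open>The two charts may have different model spaces: the atlas of a bundle and its local trivialisations
  take values in different Euclidean spaces.\<close>

definition smooth_change :: "('a, 'e::euclidean_space) chart \<Rightarrow> ('a, 'f::euclidean_space) chart \<Rightarrow> bool" where
  "smooth_change c d \<longleftrightarrow> inj_on (snd c) (fst c) \<and> inj_on (snd d) (fst d) \<and>
     open (snd c ` (fst c \<inter> fst d)) \<and> smooth_on (snd c ` (fst c \<inter> fst d)) (transition c d)"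

lemma transition_apply:
  "inj_on (snd c) (fst c) \<Longrightarrow> p \<in> fst c \<Longrightarrow> transition c d (snd c p) = snd d p"
  by (simp add: transition_def inv_chart_left)

lemma smooth_change_has_derivative:
  assumes "smooth_change c d" "p \<in> fst c" "p \<in> fst d"
  shows "(transition c d has_derivative frechet_derivative (transition c d) (at (snd c p)))
    (at (snd c p))"
  using assms smooth_on_has_derivative unfolding smooth_change_def by blast

lemma smooth_change_linear:
  "smooth_change c d \<Longrightarrow> p \<in> fst c \<Longrightarrow> p \<in> fst d \<Longrightarrow>
    linear (frechet_derivative (transition c d) (at (snd c p)))"
  by (rule has_derivative_linear[OF smooth_change_has_derivative])

text \<open>Both sides agree near the point as maps: on the overlap of \<open>c\<close> and \<open>d\<close> the transition from \<open>c\<close> to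
  \<open>e\<close> factors through \<open>d\<close>, even at points outside the domain of \<open>e\<close>, as all transitions are
  formed with the same coordinate map of \<open>e\<close>.\<close>

lemma transition_cocycle:
  assumes "smooth_change c d" "smooth_change d e" "p \<in> fst c" "p \<in> fst d" "p \<in> fst e"
  shows "frechet_derivative (transition d e) (at (snd d p))
      (frechet_derivative (transition c d) (at (snd c p)) v)
    = frechet_derivative (transition c e) (at (snd c p)) v"
proof -
  let ?D = "\<lambda>c d. frechet_derivative (transition c d) (at (snd c p))"
  have inj: "inj_on (snd c) (fst c)" "inj_on (snd d) (fst d)"
    and op: "open (snd c ` (fst c \<inter> fst d))"
    using assms(1) by (auto simp: smooth_change_def)
  have "(transition d e has_derivative ?D d e) (at (transition c d (snd c p)))"
    using smooth_change_has_derivative[OF assms(2,4,5)] transition_apply[OF inj(1) assms(3), of d] by simp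
  from has_derivative_compose[OF smooth_change_has_derivative[OF assms(1,3,4)] this]
  have "((\<lambda>x. transition d e (transition c d x)) has_derivative (\<lambda>v. ?D d e (?D c d v)))
      (at (snd c p))" .
  then have "(transition c e has_derivative (\<lambda>v. ?D d e (?D c d v))) (at (snd c p))"
    by (rule has_derivative_transform_within_open[OF _ op])
      (use assms(3,4) in \<open>auto simp: transition_apply[OF inj(1)] transition_apply[OF inj(2)]\<close>)
  then show ?thesis
    using frechet_derivative_at by metis
qed

lemma transition_self_derivative:
  assumes "smooth_change c d" "p \<in> fst c" "p \<in> fst d"
  shows "frechet_derivative (transition c c) (at (snd c p)) v = v"
proof -
  have op: "open (snd c ` (fst c \<inter> fst d))" and inj: "inj_on (snd c) (fst c)"
    using assms(1) by (auto simp: smooth_change_def)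
  have "(transition c c has_derivative (\<lambda>v. v)) (at (snd c p))"
    by (rule has_derivative_transform_within_open[OF has_derivative_ident op])
      (use assms(2,3) in \<open>auto simp: transition_apply[OF inj]\<close>)
  then show ?thesis
    using frechet_derivative_at by metis
qed

text \<open>This is \<open>coord_vector\<close> for a chart with a possibly different model space.\<close>

definition chart_vector ::
    "('a, 'e::euclidean_space) atlas \<Rightarrow> ('a, 'f::euclidean_space) chart \<Rightarrow> 'a \<Rightarrow> 'f \<Rightarrow> ('a, 'e) tvec" where
  "chart_vector A c p e =
     (\<lambda>d. if d \<in> A \<and> p \<in> fst d then frechet_derivative (transition c d) (at (snd c p)) e else 0)"

text \<open>The coordinates of a tangent vector in a chart outside the atlas, computed through some chart of the
  atlas; by the cocycle rule the choice does not matter (\<open>chart_coords_eq\<close>).\<close>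

definition chart_coords ::
    "('a, 'e::euclidean_space) atlas \<Rightarrow> ('a, 'f::euclidean_space) chart \<Rightarrow> 'a \<Rightarrow> ('a, 'e) tvec \<Rightarrow> 'f" where
  "chart_coords A c p v =
     (let b = (SOME b. b \<in> A \<and> p \<in> fst b) in frechet_derivative (transition b c) (at (snd b p)) (v b))"

definition smooth_fun :: "('a, 'e::euclidean_space) atlas \<Rightarrow> ('a \<Rightarrow> 'b::real_normed_vector) \<Rightarrow> bool" where
  "smooth_fun A f \<longleftrightarrow> (\<forall>c\<in>A. smooth_on (chart_image c) (\<lambda>x. f (inv_chart c x)))"

lemma coord_vector_eq_chart_vector: "coord_vector A c p e = chart_vector A c p e"
  by (simp add: coord_vector_def chart_vector_def)

lemma tangent_spaceD:
  assumes "v \<in> tangent_space A p" "c \<in> A" "d \<in> A" "p \<in> fst c" "p \<in> fst d"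
  shows "frechet_derivative (transition c d) (at (snd c p)) (v c) = v d"
proof -
  have "v d = frechet_derivative (transition c d) (at (snd c p)) (v c)"
    using assms unfolding tangent_space_def by blast
  then show ?thesis by (rule sym)
qed

lemma tangent_space_outside: "v \<in> tangent_space A p \<Longrightarrow> \<not> (c \<in> A \<and> p \<in> fst c) \<Longrightarrow> v c = 0"
  unfolding tangent_space_def by blast

lemma tangent_spaceI:
  assumes "\<And>c d. c \<in> A \<Longrightarrow> d \<in> A \<Longrightarrow> p \<in> fst c \<Longrightarrow> p \<in> fst d \<Longrightarrow>
      frechet_derivative (transition c d) (at (snd c p)) (v c) = v d"
    and "\<And>c. \<not> (c \<in> A \<and> p \<in> fst c) \<Longrightarrow> v c = 0"
  shows "v \<in> tangent_space A p"
  unfolding tangent_space_def mem_Collect_eq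
  by (intro conjI ballI allI impI) (auto intro: assms(1)[symmetric] assms(2))

context smooth_manifold
begin

lemma points_eq: "points A = topspace X"
  using cover by (simp add: points_def)

lemma chart_inj: "c \<in> A \<Longrightarrow> inj_on (snd c) (fst c)"
  using charts is_chart_inj by blast

lemma chart_openin: "c \<in> A \<Longrightarrow> openin X (fst c)"
  using charts unfolding is_chart_def by blast

lemma chart_at: assumes "p \<in> topspace X" obtains c where "c \<in> A" "p \<in> fst c"
  using assms cover by blast

lemma atlas_smooth_change: "c \<in> A \<Longrightarrow> d \<in> A \<Longrightarrow> smooth_change c d"
  using compatible[of c d] chart_inj is_chart_open_image[OF charts chart_openin, of c d]
  unfolding smooth_change_def by simp

text \<open>The charts of the maximal atlas, but with values in an arbitrary model space.\<close>

definition compatible_chart :: "('a, 'f::euclidean_space) chart \<Rightarrow> bool" where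
  "compatible_chart c \<longleftrightarrow> openin X (fst c) \<and> inj_on (snd c) (fst c) \<and>
     (\<forall>b\<in>A. smooth_change c b \<and> smooth_change b c)"

lemma compatible_chartD:
  assumes "compatible_chart c"
  shows "openin X (fst c)" "inj_on (snd c) (fst c)" "fst c \<subseteq> topspace X"
    "b \<in> A \<Longrightarrow> smooth_change c b" "b \<in> A \<Longrightarrow> smooth_change b c"
  using assms openin_subset by (auto simp: compatible_chart_def)

lemma compatible_chart_atlas: "c \<in> A \<Longrightarrow> compatible_chart c"
  by (simp add: compatible_chart_def chart_inj chart_openin atlas_smooth_change)

lemma compatible_chart_at:
  assumes "compatible_chart c" "p \<in> fst c"
  obtains b where "b \<in> A" "p \<in> fst b" "smooth_change c b" "smooth_change b c"
  using assms compatible_chartD chart_at by (metis subsetD)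

lemma compatible_chart_open_image:
  assumes "compatible_chart c"
  shows "open (chart_image c)"
proof -
  have "chart_image c = (\<Union>b\<in>A. snd c ` (fst c \<inter> fst b))"
    unfolding image_UN[symmetric] Int_UN_distrib[symmetric] cover chart_image_def
    using compatible_chartD(3)[OF assms] by (simp add: Int_absorb2)
  then show ?thesis
    using compatible_chartD(4)[OF assms] by (auto simp: smooth_change_def)
qed

text \<open>\<open>U\<close> is seen in \<open>c\<close> as the preimage, under the continuous transition to \<open>b\<close>, of its image in \<open>b\<close>.\<close>

lemma compatible_chart_open_Int:
  assumes "compatible_chart c" "b \<in> A" "openin X U"
  shows "open (snd c ` (fst c \<inter> fst b \<inter> U))"
proof -
  have sc: "smooth_change c b" using compatible_chartD assms by blast
  then have "open (transition c b -` (snd b ` (fst b \<inter> U)) \<inter> snd c ` (fst c \<inter> fst b))"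
    using smooth_on_imp_continuous_on is_chart_open_image[OF charts[OF assms(2)] assms(3)]
    unfolding smooth_change_def by (metis continuous_on_open_vimage)
  moreover have "transition c b -` (snd b ` (fst b \<inter> U)) \<inter> snd c ` (fst c \<inter> fst b)
      = snd c ` (fst c \<inter> fst b \<inter> U)"
  proof -
    have "transition c b (snd c q) \<in> snd b ` (fst b \<inter> U) \<longleftrightarrow> q \<in> U" if "q \<in> fst c" "q \<in> fst b" for q
      using sc that inj_on_image_mem_iff[of "snd b" "fst b" q "fst b \<inter> U"]
      by (simp add: smooth_change_def transition_apply)
    then show ?thesis by auto
  qed
  ultimately show ?thesis by simp
qed

lemma compatible_chart_open_subset:
  assumes "compatible_chart c" "openin X U"
  shows "open (snd c ` (fst c \<inter> U))"
proof -
  have "snd c ` (fst c \<inter> U) = (\<Union>b\<in>A. snd c ` (fst c \<inter> fst b \<inter> U))"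
    unfolding image_UN[symmetric] using compatible_chartD(3)[OF assms(1)] cover
    by (intro arg_cong[where f = "image (snd c)"]) blast
  then show ?thesis
    using compatible_chart_open_Int[OF assms(1) _ assms(2)] by auto
qed

lemma subspace_tangent_space: "subspace (tangent_space A p)"
proof -
  have lin: "linear (frechet_derivative (transition c d) (at (snd c p)))"
    if "c \<in> A" "d \<in> A" "p \<in> fst c" "p \<in> fst d" for c d
    using smooth_change_linear[OF atlas_smooth_change] that by blast
  show ?thesis
    unfolding subspace_def
  proof (intro conjI ballI allI)
    show "0 \<in> tangent_space A p"
      by (rule tangent_spaceI) (simp_all add: linear_0[OF lin] zero_fun_def)
    fix v w assume v: "v \<in> tangent_space A p" and w: "w \<in> tangent_space A p"
    show "v + w \<in> tangent_space A p"
      by (rule tangent_spaceI) (simp_all add: linear_add[OF lin] plus_fun_def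
          tangent_spaceD[OF v] tangent_spaceD[OF w] tangent_space_outside[OF v] tangent_space_outside[OF w])
  next
    fix r v assume v: "v \<in> tangent_space A p"
    show "r *\<^sub>R v \<in> tangent_space A p"
      by (rule tangent_spaceI)
        (simp_all add: linear_scale[OF lin] scaleR_fun_def tangent_spaceD[OF v] tangent_space_outside[OF v])
  qed
qed

lemma tangent_vector_in:
  assumes "compatible_chart c" "p \<in> fst c"
  shows "chart_vector A c p y \<in> tangent_space A p"
  using transition_cocycle[OF compatible_chartD(4)[OF assms(1)] atlas_smooth_change assms(2)]
  by (intro tangent_spaceI) (auto simp: chart_vector_def)

lemma chart_vector_linear:
  assumes "compatible_chart c" "p \<in> fst c"
  shows "linear (chart_vector A c p)"
proof -
  have lin: "linear (frechet_derivative (transition c d) (at (snd c p)))"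
    if "d \<in> A" "p \<in> fst d" for d
    by (intro smooth_change_linear compatible_chartD(4)[OF assms(1)] that assms(2))
  show ?thesis
    by (rule linearI) (auto simp: chart_vector_def linear_add[OF lin] linear_scale[OF lin]
        fun_eq_iff plus_fun_def scaleR_fun_def)
qed

lemma chart_coords_linear:
  assumes "compatible_chart c" "p \<in> fst c"
  shows "linear (chart_coords A c p)"
proof -
  define b where "b = (SOME b. b \<in> A \<and> p \<in> fst b)"
  obtain b' where "b' \<in> A" "p \<in> fst b'"
    using compatible_chart_at assms by blast
  then have b: "b \<in> A" "p \<in> fst b"
    using someI[of "\<lambda>b. b \<in> A \<and> p \<in> fst b" b'] by (auto simp: b_def)
  have lin: "linear (frechet_derivative (transition b c) (at (snd b p)))"
    by (rule smooth_change_linear[OF compatible_chartD(5)[OF assms(1) b(1)] b(2) assms(2)])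
  show ?thesis
    by (rule linearI) (simp_all add: chart_coords_def b_def[symmetric] plus_fun_def scaleR_fun_def
        linear_add[OF lin] linear_scale[OF lin])
qed

lemma chart_coords_eq:
  assumes "compatible_chart c" "p \<in> fst c" "v \<in> tangent_space A p" "b \<in> A" "p \<in> fst b"
  shows "chart_coords A c p v = frechet_derivative (transition b c) (at (snd b p)) (v b)"
proof -
  define d where "d = (SOME b. b \<in> A \<and> p \<in> fst b)"
  have d: "d \<in> A" "p \<in> fst d"
    using someI[of "\<lambda>b. b \<in> A \<and> p \<in> fst b", OF conjI[OF assms(4,5)]] by (auto simp: d_def)
  show ?thesis
    using transition_cocycle[of d b c p "v d"] tangent_spaceD[OF assms(3) d(1) assms(4) d(2) assms(5)]
      atlas_smooth_change compatible_chartD(5)[OF assms(1)] assms d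
    by (simp add: chart_coords_def d_def[symmetric])
qed

lemma chart_vector_coords:
  assumes "compatible_chart c" "p \<in> fst c" "v \<in> tangent_space A p"
  shows "chart_vector A c p (chart_coords A c p v) = v"
proof
  fix d
  obtain b where b: "b \<in> A" "p \<in> fst b" "smooth_change c b" "smooth_change b c"
    using compatible_chart_at assms by blast
  show "chart_vector A c p (chart_coords A c p v) d = v d"
  proof (cases "d \<in> A \<and> p \<in> fst d")
    case True
    then show ?thesis
      using transition_cocycle[of b c d p "v b"] b assms compatible_chartD(4)[OF assms(1), of d]
      by (simp add: chart_coords_eq[OF assms b(1,2)] chart_vector_def tangent_spaceD)
  next
    case False
    then show ?thesis
      using tangent_space_outside[OF assms(3) False] by (auto simp: chart_vector_def)
  qed
qed

lemma chart_coords_vector: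
  assumes "compatible_chart c" "p \<in> fst c"
  shows "chart_coords A c p (chart_vector A c p y) = y"
proof -
  obtain b where b: "b \<in> A" "p \<in> fst b" "smooth_change c b" "smooth_change b c"
    using compatible_chart_at assms by blast
  have "chart_coords A c p (chart_vector A c p y)
      = frechet_derivative (transition b c) (at (snd b p)) (chart_vector A c p y b)"
    by (rule chart_coords_eq[OF assms tangent_vector_in[OF assms] b(1,2)])
  also have "\<dots> = frechet_derivative (transition c c) (at (snd c p)) y"
    using transition_cocycle[of c b c p y] b assms by (simp add: chart_vector_def)
  also have "\<dots> = y"
    using transition_self_derivative[OF b(3) assms(2) b(2)] .
  finally show ?thesis .
qed

lemma chart_coords_atlas:
  assumes "c \<in> A" "p \<in> fst c" "v \<in> tangent_space A p"
  shows "chart_coords A c p v = v c"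
  using chart_coords_eq[OF compatible_chart_atlas[OF assms(1)] assms(2,3,1,2)]
    tangent_spaceD[OF assms(3,1,1,2,2)] by simp

lemma chart_vector_atlas:
  assumes "c \<in> A" "p \<in> fst c"
  shows "v \<in> tangent_space A p \<Longrightarrow> chart_vector A c p (v c) = v"
    "chart_vector A c p y c = y"
  using chart_coords_atlas[OF assms] chart_vector_coords[OF compatible_chart_atlas[OF assms(1)] assms(2)]
    chart_coords_vector[OF compatible_chart_atlas[OF assms(1)] assms(2)]
    tangent_vector_in[OF compatible_chart_atlas[OF assms(1)] assms(2)] by metis+

section \<open>Cut-off functions and the existence of a dual form\<close>

lemma smooth_on_chartI:
  assumes "compatible_chart c"
    and "\<And>p. p \<in> fst c \<Longrightarrow> \<exists>U. openin X U \<and> p \<in> U \<and> smooth_on (snd c ` (fst c \<inter> U)) h"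
  shows "smooth_on (chart_image c) h"
proof (rule smooth_on_local)
  fix x assume "x \<in> chart_image c"
  then obtain p where p: "p \<in> fst c" "x = snd c p"
    by (auto simp: chart_image_def)
  obtain U where "openin X U" "p \<in> U" "smooth_on (snd c ` (fst c \<inter> U)) h"
    using assms(2)[OF p(1)] by blast
  then show "\<exists>T. open T \<and> x \<in> T \<and> smooth_on T h"
    using compatible_chart_open_subset[OF assms(1)] p by blast
qed

text \<open>Off the closed support the product vanishes identically, and on \<open>W\<close> it is a product of smooth
  functions; these two open sets cover the chart.\<close>

lemma smooth_on_cutoff:
  fixes f :: "'a \<Rightarrow> real" and h :: "'f::euclidean_space \<Rightarrow> 'b::real_normed_vector"
  assumes c: "compatible_chart c" and f: "smooth_on (chart_image c) (\<lambda>x. f (inv_chart c x))"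
    and K: "closedin X K" "K \<subseteq> W" "\<And>q. q \<notin> K \<Longrightarrow> f q = 0"
    and W: "openin X W" and h: "smooth_on (snd c ` (fst c \<inter> W)) h"
  shows "smooth_on (chart_image c) (\<lambda>x. f (inv_chart c x) *\<^sub>R h x)"
proof (rule smooth_on_chartI[OF c])
  fix p assume p: "p \<in> fst c"
  show "\<exists>U. openin X U \<and> p \<in> U \<and> smooth_on (snd c ` (fst c \<inter> U)) (\<lambda>x. f (inv_chart c x) *\<^sub>R h x)"
  proof (cases "p \<in> W")
    case True
    have "snd c ` (fst c \<inter> W) \<subseteq> chart_image c"
      by (auto simp: chart_image_def)
    then show ?thesis
      using smooth_on_scaleR[OF compatible_chart_open_subset[OF c W] smooth_on_subset[OF f] h] True W
      by blast
  next
    case False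
    have o: "openin X (topspace X - K)"
      using K(1) by blast
    have "f (inv_chart c x) *\<^sub>R h x = 0" if "x \<in> snd c ` (fst c \<inter> (topspace X - K))" for x
      using that K(3) compatible_chartD(2)[OF c] by (auto simp: inv_chart_left)
    then have "smooth_on (snd c ` (fst c \<inter> (topspace X - K))) (\<lambda>x. f (inv_chart c x) *\<^sub>R h x)"
      by (rule smooth_on_eq[OF compatible_chart_open_subset[OF c o]
            smooth_on_const[OF compatible_chart_open_subset[OF c o]]])
    moreover have "p \<in> topspace X - K"
      using False p K(2) compatible_chartD(3)[OF c] by blast
    ultimately show ?thesis
      using o by blast
  qed
qed

definition supported_in :: "('a \<Rightarrow> real) \<Rightarrow> 'a set \<Rightarrow> bool" where
  "supported_in f W \<longleftrightarrow> (\<exists>K. closedin X K \<and> K \<subseteq> W \<and> (\<forall>q. q \<notin> K \<longrightarrow> f q = 0))"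

lemma supported_in_cutoff:
  fixes f :: "'a \<Rightarrow> real" and h :: "'e \<Rightarrow> 'b::real_normed_vector"
  assumes "smooth_fun A f" "supported_in f (fst b)" "b \<in> A" "c \<in> A"
    and "smooth_on (snd c ` (fst c \<inter> fst b)) h"
  shows "smooth_on (chart_image c) (\<lambda>x. f (inv_chart c x) *\<^sub>R h x)"
proof -
  obtain K where K: "closedin X K" "K \<subseteq> fst b" "\<And>q. q \<notin> K \<Longrightarrow> f q = 0"
    using assms(2) by (auto simp: supported_in_def)
  show ?thesis
    by (rule smooth_on_cutoff[OF compatible_chart_atlas[OF assms(4)] _ K chart_openin[OF assms(3)] assms(5)])
      (use assms(1,4) in \<open>simp add: smooth_fun_def\<close>)
qed

text \<open>The function is \<open>step (r\<^sup>2 - |x - x\<^sub>0|\<^sup>2)\<close> in the chart, for a closed ball inside its image. The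
  preimage of this ball is compact, hence closed because the manifold is Hausdorff, so the extension by
  0 is smooth.\<close>

lemma bump_function:
  assumes c: "c \<in> A" and p: "p \<in> fst c"
  obtains f where "smooth_fun A f" "\<And>q. 0 \<le> f q" "0 < f p" "supported_in f (fst c)"
proof -
  have op: "open (chart_image c)"
    using charts[OF c] by (simp add: is_chart_def)
  obtain r where r: "r > 0" "cball (snd c p) r \<subseteq> chart_image c"
    using op p open_contains_cball by (metis chart_image_def imageI)
  define K where "K = fst c \<inter> snd c -` cball (snd c p) r"
  define f where "f q = (if q \<in> fst c then step (r\<^sup>2 - (snd c q - snd c p) \<bullet> (snd c q - snd c p)) else 0)" for q
  have sub: "fst c \<subseteq> topspace X"
    using openin_subset[OF chart_openin[OF c]] .
  have KX: "compactin X K"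
  proof -
    have "snd c ` K = cball (snd c p) r"
      using r(2) by (auto simp: K_def chart_image_def)
    then have "compactin (top_of_set (chart_image c)) (snd c ` K)"
      using r(2) by (simp add: compactin_subtopology)
    then have "compactin (subtopology X (fst c)) K"
      using charts[OF c] homeomorphic_map_compactness[of "subtopology X (fst c)" _ "snd c" K] sub
      by (auto simp: is_chart_def K_def)
    then show ?thesis
      by (simp add: compactin_subtopology)
  qed
  have K0: "f q = 0" if "q \<notin> K" for q
  proof (cases "q \<in> fst c")
    case True
    then have "r < norm (snd c q - snd c p)"
      using that by (auto simp: K_def dist_norm norm_minus_commute)
    then have "r\<^sup>2 \<le> (norm (snd c q - snd c p))\<^sup>2"
      using r(1) by (intro power_mono) auto
    then show ?thesis
      using True by (simp add: f_def step_eq_0_iff power2_norm_eq_inner)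
  qed (simp add: f_def)
  have supp: "supported_in f (fst c)"
    using K0 compactin_imp_closedin[OF Hausdorff KX] unfolding supported_in_def K_def by blast
  have "smooth_on (chart_image d) (\<lambda>x. f (inv_chart d x))" if d: "d \<in> A" for d
  proof (rule smooth_on_chartI[OF compatible_chart_atlas[OF d]])
    fix q assume q: "q \<in> fst d"
    show "\<exists>U. openin X U \<and> q \<in> U \<and> smooth_on (snd d ` (fst d \<inter> U)) (\<lambda>x. f (inv_chart d x))"
    proof (cases "q \<in> fst c")
      case True
      let ?S = "snd d ` (fst d \<inter> fst c)"
      have o: "open ?S" and sm: "smooth_on ?S (transition d c)"
        using atlas_smooth_change[OF d c] by (auto simp: smooth_change_def)
      have "smooth_on ?S (\<lambda>x. step (r\<^sup>2 - (transition d c x - snd c p) \<bullet> (transition d c x - snd c p)))"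
        by (intro smooth_on_step smooth_on_diff smooth_on_inner smooth_on_const o sm)
      moreover have "f (inv_chart d x)
          = step (r\<^sup>2 - (transition d c x - snd c p) \<bullet> (transition d c x - snd c p))" if "x \<in> ?S" for x
        using that chart_inj[OF d] by (auto simp: f_def inv_chart_left transition_apply)
      ultimately have "smooth_on ?S (\<lambda>x. f (inv_chart d x))"
        by (rule smooth_on_eq[OF o])
      then show ?thesis
        using True chart_openin[OF c] by blast
    next
      case False
      let ?S = "snd d ` (fst d \<inter> (topspace X - K))"
      have oX: "openin X (topspace X - K)"
        using compactin_imp_closedin[OF Hausdorff KX] by blast
      have o: "open ?S"
        by (rule is_chart_open_image[OF charts[OF d] oX])
      have "f (inv_chart d x) = 0" if "x \<in> ?S" for x
        using that chart_inj[OF d] K0 by (auto simp: inv_chart_left)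
      then have "smooth_on ?S (\<lambda>x. f (inv_chart d x))"
        by (rule smooth_on_eq[OF o smooth_on_const[OF o]])
      moreover have "q \<in> topspace X - K"
        using False q openin_subset[OF chart_openin[OF d]] by (auto simp: K_def)
      ultimately show ?thesis
        using oX by blast
    qed
  qed
  then have "smooth_fun A f"
    by (simp add: smooth_fun_def)
  moreover have "0 < f p"
    using p r(1) by (simp add: f_def step_pos_iff)
  moreover have "0 \<le> f q" for q
    by (simp add: f_def step_nonneg)
  ultimately show ?thesis
    using that supp by blast
qed

text \<open>The compatibility conditions between metrics and structures are stated for vector fields; through
  this lemma they hold for individual tangent vectors.\<close>

lemma vector_field_extension:
  assumes p: "p \<in> topspace X" and v: "v \<in> tangent_space A p"
  obtains V where "vector_field A V" "V p = v"
proof -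
  obtain c where c: "c \<in> A" "p \<in> fst c"
    using chart_at[OF p] .
  obtain f where f: "smooth_fun A f" "0 < f p" "supported_in f (fst c)"
    by (rule bump_function[OF c])
  \<comment> \<open>Scaling by \<open>1 / f p\<close> gives the value \<open>v\<close> at \<open>p\<close>.\<close>
  define V where "V q = f q *\<^sub>R (if q \<in> fst c then chart_vector A c q (inverse (f p) *\<^sub>R v c) else 0)" for q
  have "V p = v"
    using f(2) c chart_vector_atlas(1)[OF c v]
    by (simp add: V_def linear_scale[OF chart_vector_linear[OF compatible_chart_atlas]])
  moreover have "V q \<in> tangent_space A q" for q
    using tangent_vector_in[OF compatible_chart_atlas[OF c(1)]]
    by (auto simp: V_def subspace_0[OF subspace_tangent_space]
        intro!: subspace_scale[OF subspace_tangent_space])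
  moreover have "smooth_on (chart_image d) (\<lambda>x. V (inv_chart d x) d)" if d: "d \<in> A" for d
  proof -
    let ?S = "snd d ` (fst d \<inter> fst c)" and ?h = "\<lambda>x. if inv_chart d x \<in> fst c
      then chart_vector A c (inv_chart d x) (inverse (f p) *\<^sub>R v c) d else 0"
    have sdc: "smooth_change d c" "smooth_change c d"
      using atlas_smooth_change c d by auto
    have o: "open ?S" using sdc by (simp add: smooth_change_def)
    have "smooth_on ?S (\<lambda>x. frechet_derivative (transition c d) (at (transition d c x))
        (inverse (f p) *\<^sub>R v c))"
      by (rule smooth_on_frechet_apply[OF o, of "snd c ` (fst c \<inter> fst d)"])
        (use sdc in \<open>auto simp: smooth_change_def transition_apply intro: smooth_on_const\<close>)
    moreover have "?h x = frechet_derivative (transition c d) (at (transition d c x))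
        (inverse (f p) *\<^sub>R v c)" if "x \<in> ?S" for x
      using that d chart_inj[OF d] by (auto simp: inv_chart_left transition_apply chart_vector_def)
    ultimately have "smooth_on ?S ?h"
      by (rule smooth_on_eq[OF o])
    from supported_in_cutoff[OF f(1,3) c(1) d this]
    show ?thesis
      by (simp add: V_def scaleR_fun_def zero_fun_def if_distribR cong: if_cong)
  qed
  ultimately show ?thesis
    using that[of V] by (simp add: vector_field_def)
qed

lemma smooth_fun_openin:
  fixes f :: "'a \<Rightarrow> real"
  assumes "smooth_fun A f"
  shows "openin X {q \<in> topspace X. a < f q}"
proof -
  have "openin X (fst c \<inter> {q. a < f q})" if c: "c \<in> A" for c
  proof -
    have op: "open (chart_image c)"
      using charts[OF c] by (simp add: is_chart_def)
    let ?T = "(\<lambda>x. f (inv_chart c x)) -` {a<..} \<inter> chart_image c"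
    have "continuous_on (chart_image c) (\<lambda>x. f (inv_chart c x))"
      using assms c smooth_on_imp_continuous_on by (auto simp: smooth_fun_def)
    then have "open ?T"
      by (metis continuous_on_open_vimage op open_greaterThan)
    from is_chart_openin_vimage[OF charts[OF c] this]
    have "openin X (fst c \<inter> snd c -` ?T)" .
    moreover have "fst c \<inter> snd c -` ?T = fst c \<inter> {q. a < f q}"
      by (auto simp: inv_chart_left[OF chart_inj[OF c]] inj_on_eq_iff[OF chart_inj[OF c]] chart_image_def)
    ultimately show ?thesis by simp
  qed
  then have "openin X (\<Union>c\<in>A. fst c \<inter> {q. a < f q})"
    by blast
  moreover have "(\<Union>c\<in>A. fst c \<inter> {q. a < f q}) = {q \<in> topspace X. a < f q}"
    unfolding cover[symmetric] by blast
  ultimately show ?thesis by simp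
qed

lemma smooth_fun_combine:
  assumes "smooth_fun A f" "\<And>j::nat. j < i \<Longrightarrow> smooth_fun A (g j)"
  shows "smooth_fun A (\<lambda>q. f q * (\<Prod>j<i. step (\<delta> - g j q)))"
  unfolding smooth_fun_def
proof
  fix c assume c: "c \<in> A"
  have op: "open (chart_image c)"
    using charts[OF c] by (simp add: is_chart_def)
  show "smooth_on (chart_image c)
      (\<lambda>x. f (inv_chart c x) * (\<Prod>j<i. step (\<delta> - g j (inv_chart c x))))"
    using assms c unfolding smooth_fun_def
    by (intro smooth_on_mult smooth_on_prod smooth_on_step smooth_on_diff smooth_on_const op) auto
qed

text \<open>Take bump functions \<open>f\<^sub>0, f\<^sub>1, \<dots>\<close> whose positivity sets cover (countably many suffice by the
  Lindeloef property) and damp \<open>f\<^sub>i\<close> to 0 wherever an earlier \<open>f\<^sub>j\<close> is at least \<open>1/(i+1)\<close>. At a point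
  the first positive \<open>f\<^sub>i\<close> is not damped to 0. If \<open>f\<^sub>j > \<delta> > 0\<close> on a neighbourhood, then all \<open>f\<^sub>i\<close> with
  \<open>i > j\<close> and \<open>1/(i+1) < \<delta>\<close> are damped to 0 there, which is local finiteness.\<close>

lemma locally_finite_family:
  "\<exists>c. \<exists>\<rho> :: nat \<Rightarrow> 'a \<Rightarrow> real.
    (\<forall>i. c i \<in> A \<and> smooth_fun A (\<rho> i) \<and> (\<forall>q. 0 \<le> \<rho> i q) \<and> supported_in (\<rho> i) (fst (c i))) \<and>
    (\<forall>p\<in>topspace X. \<exists>i. 0 < \<rho> i p) \<and>
    (\<forall>p\<in>topspace X. \<exists>U N. openin X U \<and> p \<in> U \<and> (\<forall>q\<in>U. \<forall>i\<ge>N. \<rho> i q = 0))"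
proof -
  have "\<exists>c f. c \<in> A \<and> smooth_fun A f \<and> (\<forall>q. 0 \<le> f q) \<and> 0 < f p \<and> supported_in f (fst c)"
    if p: "p \<in> topspace X" for p
  proof -
    obtain c where c: "c \<in> A" "p \<in> fst c"
      using chart_at[OF p] .
    show ?thesis
      by (rule bump_function[OF c]) (use c(1) in blast)
  qed
  then obtain C F where CF': "\<forall>p\<in>topspace X. C p \<in> A \<and> smooth_fun A (F p) \<and> (\<forall>q. 0 \<le> F p q) \<and>
      0 < F p p \<and> supported_in (F p) (fst (C p))"
    by metis
  then have CF: "C p \<in> A" "smooth_fun A (F p)" "0 \<le> F p q" "0 < F p p"
    "supported_in (F p) (fst (C p))" if "p \<in> topspace X" for p q
    using that by blast+
  let ?U = "\<lambda>p. {q \<in> topspace X. 0 < F p q}"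
  have "Lindelof_space X"
    by (rule second_countable_imp_Lindelof_space[OF second_countable])
  moreover have "\<forall>U\<in>?U ` topspace X. openin X U" "\<Union> (?U ` topspace X) = topspace X"
    using CF(2,4) smooth_fun_openin by auto
  ultimately have "\<exists>\<V>. countable \<V> \<and> \<V> \<subseteq> ?U ` topspace X \<and> \<Union> \<V> = topspace X"
    unfolding Lindelof_space_def by (elim allE[of _ "?U ` topspace X"] impE) (rule conjI)
  then obtain \<V> where V: "countable \<V>" "\<V> \<subseteq> ?U ` topspace X" "\<Union> \<V> = topspace X"
    by (elim exE conjE)
  obtain I where I: "countable I" "I \<subseteq> topspace X" "\<V> = ?U ` I"
    using countable_subset_image V(1,2) by meson
  have "I \<noteq> {}"
    using V(3) I(3) nonempty by (metis Sup_empty image_empty)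
  define s where "s = from_nat_into I"
  have sI: "range s = I"
    unfolding s_def using range_from_nat_into[OF \<open>I \<noteq> {}\<close> I(1)] .
  have sX: "s i \<in> topspace X" for i
    using sI I(2) by auto
  have pos: "\<exists>i. 0 < F (s i) p" if "p \<in> topspace X" for p
  proof -
    obtain a where "a \<in> I" "0 < F a p"
      using V(3) I(3) \<open>p \<in> topspace X\<close> by blast
    then show ?thesis using sI by blast
  qed
  \<comment> \<open>Damping with threshold \<open>1/(i+1)\<close>, which is positive also for \<open>i = 0\<close>.\<close>
  define \<rho> where "\<rho> i q = F (s i) q * (\<Prod>j<i. step (inverse (real (Suc i)) - F (s j) q))" for i q
  show ?thesis
  proof (intro exI[of _ "\<lambda>i. C (s i)"] exI[of _ \<rho>] conjI allI ballI)
    show "C (s i) \<in> A" for i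
      using CF(1) sX by blast
    show "smooth_fun A (\<rho> i)" for i
      unfolding \<rho>_def by (intro smooth_fun_combine CF(2) sX)
    show "0 \<le> \<rho> i q" for i q
      unfolding \<rho>_def by (intro mult_nonneg_nonneg prod_nonneg CF(3)[OF sX]) (simp add: step_nonneg)
    show "supported_in (\<rho> i) (fst (C (s i)))" for i
      using CF(5)[OF sX, of i] unfolding supported_in_def \<rho>_def by auto
    show "\<exists>i. 0 < \<rho> i p" if p: "p \<in> topspace X" for p
    proof -
      define i where "i = (LEAST i. 0 < F (s i) p)"
      have i: "0 < F (s i) p"
        unfolding i_def by (rule LeastI_ex[OF pos[OF p]])
      have "F (s j) p = 0" if "j < i" for j
        using not_less_Least[OF that[unfolded i_def]] CF(3)[OF sX, of j p] by simp
      then have "0 < \<rho> i p"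
        using i unfolding \<rho>_def by (intro mult_pos_pos prod_pos) (auto simp: step_pos_iff)
      then show ?thesis by blast
    qed
    show "\<exists>U N. openin X U \<and> p \<in> U \<and> (\<forall>q\<in>U. \<forall>i\<ge>N. \<rho> i q = 0)" if p: "p \<in> topspace X" for p
    proof -
      obtain j where j: "0 < F (s j) p"
        using pos[OF p] by blast
      define \<delta> where "\<delta> = F (s j) p / 2"
      have \<delta>: "0 < \<delta>" "\<delta> < F (s j) p" using j by (auto simp: \<delta>_def)
      obtain n where n: "inverse (real (Suc n)) < \<delta>"
        using reals_Archimedean[OF \<delta>(1)] by blast
      have "\<rho> i q = 0" if q: "\<delta> < F (s j) q" and i: "i \<ge> max n (Suc j)" for q i
      proof -
        have "inverse (real (Suc i)) \<le> inverse (real (Suc n))"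
          using i by (intro le_imp_inverse_le) auto
        then have "inverse (real (Suc i)) - F (s j) q \<le> 0"
          using n q by linarith
        then have "step (inverse (real (Suc i)) - F (s j) q) = 0"
          by (simp only: step_eq_0_iff)
        moreover have "j < i" using i by auto
        ultimately show ?thesis
          unfolding \<rho>_def by (simp add: prod_zero_iff) blast
      qed
      then show ?thesis
        using smooth_fun_openin[OF CF(2)[OF sX], of \<delta> j] p \<delta>(2)
        by (intro exI[of _ "{q \<in> topspace X. \<delta> < F (s j) q}"] exI[of _ "max n (Suc j)"]) auto
    qed
  qed
qed

text \<open>With the locally finite family \<open>\<rho>\<close>, the sum of \<open>\<rho>\<^sub>i (v\<^sub>i \<bullet> w\<^sub>i)\<close> over the coordinate vectors in the
  charts \<open>c i\<close> is a Riemannian metric. Its contraction \<open>\<theta>\<close> with \<open>Z\<close> is a 1-form that is positive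
  on \<open>Z\<close>, and \<open>\<theta> / \<theta>(Z)\<close> is the form wanted.\<close>

lemma dual_form:
  assumes Z: "vector_field A Z" and nz: "\<And>p. p \<in> topspace X \<Longrightarrow> Z p \<noteq> 0"
  obtains \<omega> where "one_form A \<omega>" "\<And>p. p \<in> topspace X \<Longrightarrow> \<omega> p (Z p) = 1"
proof -
  obtain c and \<rho> :: "nat \<Rightarrow> 'a \<Rightarrow> real" where
    loc: "\<forall>i. c i \<in> A \<and> smooth_fun A (\<rho> i) \<and> (\<forall>q. 0 \<le> \<rho> i q) \<and> supported_in (\<rho> i) (fst (c i))"
    and ex: "\<forall>p\<in>topspace X. \<exists>i. 0 < \<rho> i p"
    and fin: "\<forall>p\<in>topspace X. \<exists>U N. openin X U \<and> p \<in> U \<and> (\<forall>q\<in>U. \<forall>i\<ge>N. \<rho> i q = 0)"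
    using locally_finite_family by (elim exE conjE)
  have c: "c i \<in> A" and \<rho>: "smooth_fun A (\<rho> i)" and nonneg: "0 \<le> \<rho> i q"
    and supp: "supported_in (\<rho> i) (fst (c i))" for i q
    using loc by blast+
  have ZT: "Z p \<in> tangent_space A p" if "p \<in> topspace X" for p
    using Z that by (simp add: vector_field_def points_eq)
  define \<theta> where "\<theta> p v = (\<Sum>i | \<rho> i p \<noteq> 0. \<rho> i p *\<^sub>R (v (c i) \<bullet> Z p (c i)))" for p v
  have \<theta>_eq: "\<theta> q v = (\<Sum>i<N. \<rho> i q *\<^sub>R (v (c i) \<bullet> Z q (c i)))" if "\<forall>i\<ge>N. \<rho> i q = 0" for q v N
    unfolding \<theta>_def by (rule sum.mono_neutral_left) (use that not_le in auto)
  have \<theta>_lin: "linear (\<theta> p)" for p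
  proof (rule linearI)
    show "\<theta> p (v + w) = \<theta> p v + \<theta> p w" for v w
      by (simp add: \<theta>_def plus_fun_def inner_add_left distrib_left sum.distrib)
    show "\<theta> p (r *\<^sub>R v) = r *\<^sub>R \<theta> p v" for r v
      by (simp add: \<theta>_def scaleR_fun_def sum_distrib_left mult.left_commute)
  qed
  have \<theta>_smooth: "smooth_on (chart_image d)
      (\<lambda>x. \<theta> (inv_chart d x) (chart_vector A d (inv_chart d x) y))" if d: "d \<in> A" for d y
  proof -
    have dc: "compatible_chart d"
      by (rule compatible_chart_atlas[OF d])
    have summand: "smooth_on (chart_image d) (\<lambda>x. \<rho> i (inv_chart d x) *\<^sub>R
        (chart_vector A d (inv_chart d x) y (c i) \<bullet> Z (inv_chart d x) (c i)))" for i
    proof (rule supported_in_cutoff[OF \<rho> supp c d])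
      let ?S = "snd d ` (fst d \<inter> fst (c i))" and ?D = "\<lambda>x. frechet_derivative (transition d (c i)) (at x)"
      have o: "open ?S" and sm: "smooth_on ?S (transition d (c i))"
        using atlas_smooth_change[OF d c] by (auto simp: smooth_change_def)
      have Zd: "smooth_on ?S (\<lambda>x. Z (inv_chart d x) d)"
        by (rule smooth_on_subset[of "chart_image d"])
          (use Z d in \<open>auto simp: vector_field_def chart_image_def\<close>)
      have "smooth_on ?S (\<lambda>x. ?D x y \<bullet> ?D x (Z (inv_chart d x) d))"
        using smooth_on_frechet_apply[OF o o sm smooth_on_id[OF o] _ Zd]
          smooth_on_frechet_apply[OF o o sm smooth_on_id[OF o] _ smooth_on_const[OF o]]
        by (intro smooth_on_inner o) auto
      then show "smooth_on ?S (\<lambda>x. chart_vector A d (inv_chart d x) y (c i) \<bullet> Z (inv_chart d x) (c i))"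
      proof (rule smooth_on_eq[OF o])
        fix x assume "x \<in> ?S"
        then obtain q where q: "q \<in> fst d" "q \<in> fst (c i)" "x = snd d q" by auto
        have "q \<in> topspace X"
          using q(1) compatible_chartD(3)[OF dc] by blast
        then show "chart_vector A d (inv_chart d x) y (c i) \<bullet> Z (inv_chart d x) (c i)
            = ?D x y \<bullet> ?D x (Z (inv_chart d x) d)"
          using q c tangent_spaceD[OF ZT d c q(1,2)]
          by (simp add: inv_chart_left[OF chart_inj[OF d]] chart_vector_def)
      qed
    qed
    show ?thesis
    proof (rule smooth_on_chartI[OF dc])
      fix p assume "p \<in> fst d"
      then have "p \<in> topspace X"
        using compatible_chartD(3)[OF dc] by blast
      from bspec[OF fin this] obtain U N where
        U: "openin X U" "p \<in> U" "\<forall>q\<in>U. \<forall>i\<ge>N. \<rho> i q = 0"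
        by (elim exE conjE)
      have o: "open (snd d ` (fst d \<inter> U))"
        by (rule compatible_chart_open_subset[OF dc U(1)])
      have "smooth_on (snd d ` (fst d \<inter> U)) (\<lambda>x. \<Sum>i<N. \<rho> i (inv_chart d x) *\<^sub>R
          (chart_vector A d (inv_chart d x) y (c i) \<bullet> Z (inv_chart d x) (c i)))"
        by (intro smooth_on_sum[OF o] smooth_on_subset[OF summand]) (simp add: chart_image_def image_mono)
      then have "smooth_on (snd d ` (fst d \<inter> U))
          (\<lambda>x. \<theta> (inv_chart d x) (chart_vector A d (inv_chart d x) y))"
        by (rule smooth_on_eq[OF o])
          (elim imageE IntE, simp only: inv_chart_left[OF chart_inj[OF d]] \<theta>_eq[OF U(3)[THEN bspec]])
      then show "\<exists>U. openin X U \<and> p \<in> U \<and> smooth_on (snd d ` (fst d \<inter> U))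
          (\<lambda>x. \<theta> (inv_chart d x) (chart_vector A d (inv_chart d x) y))"
        using U by blast
    qed
  qed
  have \<theta>_pos: "0 < \<theta> p (Z p)" if p: "p \<in> topspace X" for p
  proof -
    from bspec[OF fin p] obtain U N where UN: "p \<in> U" "\<forall>q\<in>U. \<forall>i\<ge>N. \<rho> i q = 0"
      by (elim exE conjE)
    obtain i where i: "0 < \<rho> i p" using ex p by blast
    have pi: "p \<in> fst (c i)"
      using i supp[of i] unfolding supported_in_def by fastforce
    have "Z p (c i) \<noteq> 0"
      using chart_vector_atlas(1)[OF c pi ZT[OF p]] nz[OF p]
        linear_0[OF chart_vector_linear[OF compatible_chart_atlas[OF c] pi]] by metis
    then have "0 < \<rho> i p *\<^sub>R (Z p (c i) \<bullet> Z p (c i))"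
      using i by simp
    moreover have "i < N"
      using i UN by (metis less_irrefl not_le)
    ultimately show ?thesis
      unfolding \<theta>_eq[OF UN(2)[THEN bspec, OF UN(1)]] using nonneg
      by (intro sum_pos2[of _ i]) auto
  qed
  define \<omega> where "\<omega> p v = inverse (\<theta> p (Z p)) * \<theta> p v" for p v
  have "one_form A \<omega>"
    unfolding one_form_def
  proof (intro conjI ballI allI)
    show "linear_on_subspace (tangent_space A p) (\<omega> p)" for p
      by (simp add: linear_on_subspace_def \<omega>_def linear_add[OF \<theta>_lin] linear_scale[OF \<theta>_lin] algebra_simps)
    fix d y assume d: "d \<in> A"
    have o: "open (chart_image d)"
      by (rule compatible_chart_open_image[OF compatible_chart_atlas[OF d]])
    have Zd: "smooth_on (chart_image d) (\<lambda>x. Z (inv_chart d x) d)"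
      using Z d by (simp add: vector_field_def)
    have inX: "inv_chart d x \<in> fst d" "inv_chart d x \<in> topspace X" if "x \<in> chart_image d" for x
      using inv_chart_right(2)[OF that] compatible_chartD(3)[OF compatible_chart_atlas[OF d]] by auto
    have "smooth_on (chart_image d)
        (\<lambda>x. \<theta> (inv_chart d x) (chart_vector A d (inv_chart d x) (Z (inv_chart d x) d)))"
    proof (rule smooth_on_linear_family[OF o _ \<theta>_smooth[OF d] Zd])
      show "linear (\<lambda>y. \<theta> (inv_chart d x) (chart_vector A d (inv_chart d x) y))"
        if "x \<in> chart_image d" for x
        using linear_compose[OF chart_vector_linear[OF compatible_chart_atlas[OF d] inX(1)[OF that]] \<theta>_lin]
        by (simp add: o_def)
    qed
    then have "smooth_on (chart_image d) (\<lambda>x. \<theta> (inv_chart d x) (Z (inv_chart d x)))"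
      by (rule smooth_on_eq[OF o]) (simp add: chart_vector_atlas(1)[OF d inX(1) ZT[OF inX(2)]])
    then have "smooth_on (chart_image d) (\<lambda>x. \<omega> (inv_chart d x) (chart_vector A d (inv_chart d x) y))"
      unfolding \<omega>_def using \<theta>_pos inX(2)
      by (intro smooth_on_mult smooth_on_inverse o \<theta>_smooth[OF d]) (auto simp: less_le)
    then show "smooth_on (chart_image d) (\<lambda>x. let p = inv_chart d x in \<omega> p (coord_vector A d p y))"
      by (simp add: coord_vector_eq_chart_vector Let_def)
  qed
  moreover have "\<omega> p (Z p) = 1" if "p \<in> topspace X" for p
    using \<theta>_pos[OF that] by (simp add: \<omega>_def)
  ultimately show ?thesis
    using that by blast
qed

end

section \<open>Arcs of the circle\<close>

lemma cis_eq_near: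
  assumes "cis s = cis t" "\<bar>s - t\<bar> < 2 * pi"
  shows "s = t"
proof -
  have "cis (s - t) = 1"
    using assms(1) by (simp add: cis_divide[symmetric])
  then have "cos (s - t) = 1"
    by (metis cis.sel(1) one_complex.sel(1))
  then obtain n :: int where n: "s - t = real_of_int n * (2 * pi)"
    by (auto simp: cos_one_2pi_int)
  have "n = 0"
  proof (rule ccontr)
    assume "n \<noteq> 0"
    then have "1 * (2 * pi) \<le> \<bar>real_of_int n\<bar> * (2 * pi)"
      by (intro mult_right_mono) auto
    then show False
      using n assms(2) by (simp add: abs_mult)
  qed
  then show ?thesis using n by simp
qed

lemma inj_on_cis_arc: "inj_on cis {a<..<a + 2 * pi}"
  by (rule inj_onI) (auto intro!: cis_eq_near)

lemma unit_complex_eq_cis: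
  assumes "norm z = 1"
  obtains s where "0 \<le> s" "s < 2 * pi" "z = cis s"
  using Arg2pi_eq[of z] Arg2pi_ge_0[of z] Arg2pi_lt_2pi[of z] assms that[of "Arg2pi z"]
  by (simp add: cis_conv_exp)

lemma topspace_circle: "topspace circle = sphere 0 1"
  by (simp add: circle_def)

lemma cis_in_circle: "cis t \<in> topspace circle"
  by (simp add: topspace_circle)

text \<open>The arc is the circle without the point \<open>cis a\<close>.\<close>

lemma openin_circle_arc: "openin circle (cis ` {a<..<a + 2 * pi})"
proof -
  have "cis ` {a<..<a + 2 * pi} = sphere 0 1 \<inter> - {cis a}"
  proof (intro equalityI subsetI)
    fix z assume "z \<in> cis ` {a<..<a + 2 * pi}"
    then show "z \<in> sphere 0 1 \<inter> - {cis a}"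
      using cis_eq_near by fastforce
  next
    fix z assume z: "z \<in> sphere 0 1 \<inter> - {cis a}"
    have "norm (z * cis (- a)) = 1"
      using z by (simp add: norm_mult)
    then obtain s where s: "0 \<le> s" "s < 2 * pi" "z * cis (- a) = cis s"
      using unit_complex_eq_cis by blast
    have "z = z * (cis (- a) * cis a)"
      by (simp add: cis_mult)
    also have "\<dots> = cis s * cis a"
      by (simp only: mult.assoc[symmetric] s(3))
    also have "\<dots> = cis (a + s)"
      by (simp only: cis_mult add.commute)
    finally have za: "z = cis (a + s)" .
    then have "s \<noteq> 0"
      using z by auto
    then show "z \<in> cis ` {a<..<a + 2 * pi}"
      using za s by auto
  qed
  then show ?thesis
    by (simp add: circle_def openin_open_Int open_Compl)
qed

section \<open>Charts adapted to a circle bundle\<close>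

context principal_circle_bundle
begin

lemma act_in: "u \<in> topspace Y \<Longrightarrow> z \<in> topspace circle \<Longrightarrow> act (u, z) \<in> topspace Y"
proof -
  assume u: "u \<in> topspace Y" "z \<in> topspace circle"
  have "continuous_map (prod_topology Y circle) Y act"
    using act_smooth by (simp add: smooth_map_def)
  then show ?thesis
    using continuous_map_image_subset_topspace u by fastforce
qed

lemma proj_act: "u \<in> topspace Y \<Longrightarrow> z \<in> topspace circle \<Longrightarrow> \<pi> (act (u, z)) = \<pi> u"
  using fibres_orbits[of u "act (u, z)"] act_in by auto

text \<open>This is what remains of a local trivialisation, composed with a chart of the base and a branch of the
  angle, for computing the projection and the infinitesimal action. The action is a translation for
  small angles only, since larger ones leave the branch.\<close>

definition adapted_chart :: "('a, 'e) chart \<Rightarrow> ('p, 'e \<times> real) chart \<Rightarrow> bool" where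
  "adapted_chart a F \<longleftrightarrow> a \<in> A \<and> total.compatible_chart F \<and>
     (\<forall>u\<in>fst F. \<pi> u \<in> fst a \<and> fst (snd F u) = snd a (\<pi> u)) \<and>
     (\<forall>u\<in>fst F. \<exists>\<epsilon>>0. \<forall>s. \<bar>s\<bar> < \<epsilon> \<longrightarrow>
        act (u, cis s) \<in> fst F \<and> snd F (act (u, cis s)) = snd F u + (0, s))"

lemma adapted_chartD:
  assumes "adapted_chart a F"
  shows "a \<in> A" "base.compatible_chart a" "total.compatible_chart F" "inj_on (snd F) (fst F)"
    "fst F \<subseteq> topspace Y" "u \<in> fst F \<Longrightarrow> \<pi> u \<in> fst a" "u \<in> fst F \<Longrightarrow> fst (snd F u) = snd a (\<pi> u)"
proof -
  show a: "a \<in> A" and F: "total.compatible_chart F"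
    and "u \<in> fst F \<Longrightarrow> \<pi> u \<in> fst a" "u \<in> fst F \<Longrightarrow> fst (snd F u) = snd a (\<pi> u)"
    using assms by (simp_all add: adapted_chart_def)
  show "base.compatible_chart a" by (rule base.compatible_chart_atlas[OF a])
  show "inj_on (snd F) (fst F)" "fst F \<subseteq> topspace Y"
    by (rule total.compatible_chartD(2,3)[OF F])+
qed

text \<open>Compose a local trivialisation with a chart of the base and a branch of the angle. The branch is
  centred at the given point, so that its cut lies opposite to it. The transitions to the atlas are
  smooth because they are the coordinate expressions of the trivialisation and its inverse. Openness of
  the image of an overlap needs continuity of the inverse, which is composed of the inverse
  trivialisation, the inverse chart and \<open>cis\<close>.\<close>

lemma adapted_chart_at:
  assumes u0: "u0 \<in> topspace Y"
  shows "\<exists>a F. adapted_chart a F \<and> u0 \<in> fst F"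
proof -
  have \<pi>u0: "\<pi> u0 \<in> topspace X"
    using proj_surj u0 by blast
  from locally_trivial[OF \<pi>u0] obtain U \<Psi> where U: "openin X U" "\<pi> u0 \<in> U"
    and loc: "let W = topspace Y \<inter> \<pi> -` U in
          diffeomorphism
            (subtopology Y W) (restrict_atlas W B)
            (prod_topology (subtopology X U) circle)
            (prod_atlas (restrict_atlas U A) circle_atlas) \<Psi> \<and>
          (\<forall>u\<in>W. fst (\<Psi> u) = \<pi> u \<and>
            (\<forall>z\<in>topspace circle. snd (\<Psi> (act (u, z))) = snd (\<Psi> u) * z))"
    by (elim exE conjE)
  define W where "W = topspace Y \<inter> \<pi> -` U"
  define T where "T = prod_topology (subtopology X U) circle"
  define \<Phi> where "\<Phi> = inv_into W \<Psi>"
  have WY: "W \<subseteq> topspace Y" by (auto simp: W_def)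
  have topW: "topspace (subtopology Y W) = W" by (auto simp: W_def)
  have topT: "topspace T = U \<times> sphere 0 1"
    using openin_subset[OF U(1)] by (auto simp: T_def topspace_circle)
  have dif: "diffeomorphism (subtopology Y W) (restrict_atlas W B) T
      (prod_atlas (restrict_atlas U A) circle_atlas) \<Psi>"
    and fst_\<Psi>: "\<And>u. u \<in> W \<Longrightarrow> fst (\<Psi> u) = \<pi> u"
    and snd_\<Psi>: "\<And>u z. u \<in> W \<Longrightarrow> z \<in> topspace circle \<Longrightarrow> snd (\<Psi> (act (u, z))) = snd (\<Psi> u) * z"
    using loc by (auto simp: Let_def W_def T_def)
  have bij: "bij_betw \<Psi> W (U \<times> sphere 0 1)"
    using dif by (simp only: diffeomorphism_def topW topT)
  have sm\<Psi>: "smooth_map (subtopology Y W) (restrict_atlas W B) T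
      (prod_atlas (restrict_atlas U A) circle_atlas) \<Psi>"
    and sm\<Phi>: "smooth_map T (prod_atlas (restrict_atlas U A) circle_atlas)
      (subtopology Y W) (restrict_atlas W B) \<Phi>"
    using dif by (simp_all only: diffeomorphism_def topW \<Phi>_def)
  have \<Psi>_in: "fst (\<Psi> u) \<in> U" "norm (snd (\<Psi> u)) = 1" "\<Phi> (\<Psi> u) = u" if "u \<in> W" for u
    using bij that bij_betwE[OF bij] by (force simp: \<Phi>_def bij_betw_def)+
  have \<Phi>_in: "\<Phi> y \<in> W" "\<Psi> (\<Phi> y) = y" if "y \<in> U \<times> sphere 0 1" for y
    using that bij unfolding \<Phi>_def bij_betw_def by (metis inv_into_into, metis f_inv_into_f)
  have Wo: "openin Y W"
  proof -
    have "openin Y {u \<in> topspace Y. \<pi> u \<in> U}"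
      using proj_smooth U(1) openin_continuous_map_preimage by (fastforce simp: smooth_map_def)
    moreover have "{u \<in> topspace Y. \<pi> u \<in> U} = W"
      by (auto simp: W_def)
    ultimately show ?thesis by simp
  qed
  have u0W: "u0 \<in> W"
    using u0 U(2) by (simp add: W_def)
  obtain a where a: "a \<in> A" "\<pi> u0 \<in> fst a"
    using base.chart_at[OF \<pi>u0] .
  have injA: "inj_on (snd a) (fst a)"
    by (rule base.chart_inj[OF a(1)])
  obtain t0 where t0: "snd (\<Psi> u0) = cis t0"
    using unit_complex_eq_cis[OF \<Psi>_in(2)[OF u0W]] by blast
  \<comment> \<open>The branch with values in \<open>(t\<^sub>0 - \<pi>, t\<^sub>0 + \<pi>)\<close> has the given point in its middle.\<close>
  define \<alpha> where "\<alpha> = t0 - pi"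
  define I where "I = {\<alpha><..<\<alpha> + 2 * pi}"
  define arc where "arc = cis ` I"
  define ang where "ang = inv_into I cis"
  have t0I: "t0 \<in> I" by (simp add: I_def \<alpha>_def)
  have cisI: "inj_on cis I" by (simp add: I_def inj_on_cis_arc)
  have ang: "ang (cis t) = t" if "t \<in> I" for t
    using that cisI by (simp add: ang_def)
  have cis_ang: "cis (ang z) = z" "ang z \<in> I" if "z \<in> arc" for z
    using that by (auto simp: arc_def ang)
  have arc_sphere: "arc \<subseteq> sphere 0 1" by (auto simp: arc_def)
  define R where "R = (fst a \<inter> U) \<times> arc"
  have RT: "R \<subseteq> U \<times> sphere 0 1"
    using arc_sphere by (auto simp: R_def)
  define G where "G = map_prod (snd a) ang"
  have injG: "inj_on G R"
    using injA cis_ang unfolding G_def R_def inj_on_def by (auto) metis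
  define Q where "Q = W \<inter> \<Psi> -` R"
  define F where "F = (Q, G \<circ> \<Psi>)"
  have fstF: "fst F = Q" and sndF: "snd F = G \<circ> \<Psi>"
    by (simp_all add: F_def)
  have \<Psi>Q: "\<Psi> ` (Q \<inter> S) = R \<inter> \<Phi> -` (S \<inter> W)" for S
  proof (intro equalityI subsetI)
    fix y assume "y \<in> \<Psi> ` (Q \<inter> S)"
    then obtain u where u: "u \<in> W" "\<Psi> u \<in> R" "u \<in> S" "y = \<Psi> u"
      by (auto simp: Q_def)
    then show "y \<in> R \<inter> \<Phi> -` (S \<inter> W)"
      using \<Psi>_in(3)[OF u(1)] by simp
  next
    fix y assume y: "y \<in> R \<inter> \<Phi> -` (S \<inter> W)"
    then have "\<Psi> (\<Phi> y) = y"
      using \<Phi>_in(2) RT by blast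
    then show "y \<in> \<Psi> ` (Q \<inter> S)"
      using y by (intro image_eqI[of _ _ "\<Phi> y"]) (auto simp: Q_def)
  qed
  have Qo: "openin Y Q"
  proof -
    have "openin T R"
      unfolding T_def R_def openin_prod_Times_iff using openin_circle_arc[of \<alpha>]
      by (simp add: arc_def I_def base.chart_openin[OF a(1)] openin_subtopology_Int)
    then have "openin (subtopology Y W) {u \<in> topspace (subtopology Y W). \<Psi> u \<in> R}"
      by (rule openin_continuous_map_preimage[OF sm\<Psi>[unfolded smooth_map_def, THEN conjunct1]])
    moreover have "{u \<in> topspace (subtopology Y W). \<Psi> u \<in> R} = Q"
      unfolding topW Q_def by auto
    ultimately show ?thesis
      using Wo by (simp add: openin_open_subtopology)
  qed
  have u0Q: "u0 \<in> Q"
    using u0W a(2) U(2) t0I fst_\<Psi>[OF u0W] t0 by (simp add: Q_def R_def mem_Times_iff arc_def)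
  have inj\<Psi>: "inj_on \<Psi> W" using bij by (simp add: bij_betw_def)
  have injF: "inj_on (snd F) (fst F)"
    unfolding fstF sndF
  proof (rule comp_inj_on)
    show "inj_on \<Psi> Q" using inj\<Psi> by (rule inj_on_subset) (auto simp: Q_def)
    show "inj_on G (\<Psi> ` Q)" using injG by (rule inj_on_subset) (auto simp: Q_def)
  qed
  let ?d = "(R, G)"
  have d: "?d \<in> prod_atlas (restrict_atlas U A) circle_atlas"
  proof -
    have "(fst a \<inter> U, snd a) \<in> restrict_atlas U A"
      using a(1) by (auto simp: restrict_atlas_def)
    moreover have "(arc, ang) \<in> circle_atlas"
      by (auto simp: circle_atlas_def arc_def ang_def I_def)
    ultimately show ?thesis
      unfolding prod_atlas_def R_def G_def
      by (intro CollectI exI[of _ "(fst a \<inter> U, snd a)"] exI[of _ "(arc, ang)"]) simp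
  qed
  have compat: "smooth_change F b \<and> smooth_change b F" if b: "b \<in> B" for b
  proof -
    let ?c = "(fst b \<inter> W, snd b)"
    have c: "?c \<in> restrict_atlas W B"
      using b by (auto simp: restrict_atlas_def)
    have injB: "inj_on (snd b) (fst b)"
      by (rule total.chart_inj[OF b])
    have injc: "inj_on (snd ?c) (fst ?c)"
      using injB by (auto intro: inj_on_subset)
    have inv_c: "inv_chart ?c (snd b u) = u" if "u \<in> fst b" "u \<in> W" for u
      using inv_chart_left[OF injc, of u] that by simp
    have inv_d: "inv_chart ?d (G y) = y" if "y \<in> R" for y
      using inv_chart_left[of ?d y] injG that by simp
    have 1: "open (snd b ` (fst b \<inter> fst F))"
      unfolding fstF by (rule is_chart_open_image[OF total.charts[OF b] Qo])
    have "smooth_on (snd ?c ` (fst ?c \<inter> \<Psi> -` fst ?d)) (snd ?d \<circ> \<Psi> \<circ> inv_chart ?c)"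
      using sm\<Psi> c d unfolding smooth_map_def by blast
    moreover have "snd ?c ` (fst ?c \<inter> \<Psi> -` fst ?d) = snd b ` (fst b \<inter> fst F)"
      by (simp add: fstF Q_def Int_assoc)
    ultimately have "smooth_on (snd b ` (fst b \<inter> fst F)) (snd ?d \<circ> \<Psi> \<circ> inv_chart ?c)"
      by simp
    then have 2: "smooth_on (snd b ` (fst b \<inter> fst F)) (transition b F)"
      by (rule smooth_on_eq[OF 1])
        (auto simp: transition_def sndF fstF Q_def inv_c inv_chart_left[OF injB])
    have img: "snd F ` (fst F \<inter> fst b) = G ` (R \<inter> \<Phi> -` (fst b \<inter> W))"
      by (simp only: fstF sndF image_comp[symmetric] \<Psi>Q)
    have "smooth_on (snd ?d ` (fst ?d \<inter> \<Phi> -` fst ?c)) (snd ?c \<circ> \<Phi> \<circ> inv_chart ?d)"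
      using sm\<Phi> c d unfolding smooth_map_def by blast
    then have 3: "smooth_on (snd F ` (fst F \<inter> fst b)) (snd b \<circ> \<Phi> \<circ> inv_chart ?d)"
      unfolding img by simp
    have 4: "open (snd F ` (fst F \<inter> fst b))"
    proof -
      let ?a = "(fst a \<inter> U, snd a)"
      define D where "D = snd a ` (fst a \<inter> U) \<times> I"
      have Do: "open D"
        unfolding D_def by (intro open_Times is_chart_open_image[OF base.charts[OF a(1)] U(1)])
          (simp add: I_def)
      let ?E = "\<lambda>y. (inv_chart a (fst y), cis (snd y))"
      have DR: "?E y \<in> R" "G (?E y) = y" if "y \<in> D" for y
        using that by (auto simp: D_def R_def G_def arc_def ang inv_chart_left[OF injA])
      have cont_a: "continuous_map (top_of_set D) X (\<lambda>y. inv_chart a (fst y))"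
      proof -
        have "continuous_map (top_of_set D) (top_of_set (chart_image a)) fst"
          by (auto simp: D_def chart_image_def intro: continuous_intros)
        from continuous_map_compose[OF this is_chart_continuous_inv[OF base.charts[OF a(1)]]]
        show ?thesis by (simp add: o_def)
      qed
      have "continuous_map (top_of_set D) (subtopology X U) (\<lambda>y. inv_chart a (fst y))"
        using cont_a by (auto simp: continuous_map_in_subtopology D_def inv_chart_left[OF injA])
      moreover have "continuous_map (top_of_set D) circle (\<lambda>y. cis (snd y))"
        by (auto simp: circle_def intro!: continuous_intros)
      ultimately have "continuous_map (top_of_set D) T ?E"
        unfolding T_def by (rule continuous_map_pairedI)
      moreover have "continuous_map T (subtopology Y W) \<Phi>"
        using sm\<Phi> by (simp add: smooth_map_def)
      ultimately have "continuous_map (top_of_set D) (subtopology Y W) (\<Phi> \<circ> ?E)"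
        by (rule continuous_map_compose)
      then have "continuous_map (top_of_set D) Y (\<Phi> \<circ> ?E)"
        using continuous_map_in_subtopology by blast
      then have "openin (top_of_set D) {y \<in> topspace (top_of_set D). (\<Phi> \<circ> ?E) y \<in> fst b}"
        by (rule openin_continuous_map_preimage[OF _ total.chart_openin[OF b]])
      then have "open {y \<in> D. \<Phi> (?E y) \<in> fst b}"
        using Do openin_open_trans by auto
      moreover have "{y \<in> D. \<Phi> (?E y) \<in> fst b} = G ` (R \<inter> \<Phi> -` (fst b \<inter> W))"
      proof (intro equalityI subsetI)
        fix y assume "y \<in> {y \<in> D. \<Phi> (?E y) \<in> fst b}"
        then have y: "y \<in> D" "\<Phi> (?E y) \<in> fst b" by auto
        then have "\<Phi> (?E y) \<in> W"
          using DR(1) RT \<Phi>_in(1) by blast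
        then show "y \<in> G ` (R \<inter> \<Phi> -` (fst b \<inter> W))"
          using y DR[OF y(1)] by (intro image_eqI[of _ _ "?E y"]) auto
      next
        fix y assume "y \<in> G ` (R \<inter> \<Phi> -` (fst b \<inter> W))"
        then obtain r where r: "r \<in> R" "\<Phi> r \<in> fst b" "y = G r" by auto
        have "?E y = r" "y \<in> D"
          using r(1,3) cis_ang by (auto simp: R_def G_def D_def inv_chart_left[OF injA])
        then show "y \<in> {y \<in> D. \<Phi> (?E y) \<in> fst b}"
          using r by auto
      qed
      ultimately show ?thesis
        unfolding img by simp
    qed
    have 5: "smooth_on (snd F ` (fst F \<inter> fst b)) (transition F b)"
      using 4 3
    proof (rule smooth_on_eq)
      fix x assume "x \<in> snd F ` (fst F \<inter> fst b)"
      then obtain u where u: "u \<in> fst F" "u \<in> fst b" "x = snd F u" by auto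
      have uQ: "u \<in> W" "\<Psi> u \<in> R" using u(1) by (auto simp: fstF Q_def)
      have "inv_chart ?d x = \<Psi> u"
        using inv_d[OF uQ(2)] u(3) by (simp add: sndF)
      then show "transition F b x = (snd b \<circ> \<Phi> \<circ> inv_chart ?d) x"
        using u \<Psi>_in(3)[OF uQ(1)] by (simp add: transition_def inv_chart_left[OF injF])
    qed
    show ?thesis
      using 1 2 4 5 injF injB by (simp add: smooth_change_def)
  qed
  have "adapted_chart a F"
    unfolding adapted_chart_def total.compatible_chart_def
  proof (intro conjI ballI a(1) injF)
    show "openin Y (fst F)" using Qo by (simp add: fstF)
    show "smooth_change F b" "smooth_change b F" if "b \<in> B" for b
      using compat[OF that] by auto
    fix u assume "u \<in> fst F"
    then have u: "u \<in> W" "fst (\<Psi> u) \<in> fst a" "fst (\<Psi> u) \<in> U" "snd (\<Psi> u) \<in> arc"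
      by (auto simp: fstF Q_def R_def mem_Times_iff)
    show "\<pi> u \<in> fst a" "fst (snd F u) = snd a (\<pi> u)"
      using u fst_\<Psi>[OF u(1)] by (simp_all add: sndF G_def)
    define t where "t = ang (snd (\<Psi> u))"
    have t: "t \<in> I" "snd (\<Psi> u) = cis t"
      using cis_ang[OF u(4)] by (simp_all add: t_def)
    show "\<exists>\<epsilon>>0. \<forall>s. \<bar>s\<bar> < \<epsilon> \<longrightarrow>
        act (u, cis s) \<in> fst F \<and> snd F (act (u, cis s)) = snd F u + (0, s)"
    \<comment> \<open>The rotated point stays in the chart until the angle leaves the branch.\<close>
    proof (intro exI[of _ "min (t - \<alpha>) (\<alpha> + 2 * pi - t)"] conjI allI impI)
      show "0 < min (t - \<alpha>) (\<alpha> + 2 * pi - t)"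
        using t(1) by (simp add: I_def)
      fix s assume s: "\<bar>s\<bar> < min (t - \<alpha>) (\<alpha> + 2 * pi - t)"
      have tsI: "t + s \<in> I"
        using s by (auto simp: I_def)
      let ?v = "act (u, cis s)"
      have uY: "u \<in> topspace Y" using u(1) WY by blast
      have vW: "?v \<in> W"
        using u(1) act_in[OF uY cis_in_circle] proj_act[OF uY cis_in_circle] by (simp add: W_def)
      have v: "fst (\<Psi> ?v) = fst (\<Psi> u)" "snd (\<Psi> ?v) = cis (t + s)"
        using fst_\<Psi>[OF vW] fst_\<Psi>[OF u(1)] proj_act[OF uY cis_in_circle] snd_\<Psi>[OF u(1) cis_in_circle] t(2)
        by (simp_all add: cis_mult)
      have "\<Psi> ?v \<in> R"
        using u v tsI by (simp add: R_def mem_Times_iff arc_def)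
      then show "?v \<in> fst F"
        using vW by (simp add: fstF Q_def)
      show "snd F ?v = snd F u + (0, s)"
        using v t tsI by (simp add: sndF G_def map_prod_def split_beta ang prod_eq_iff)
    qed
  qed
  then show ?thesis
    using u0Q fstF by blast
qed

section \<open>The differential of the projection and the fundamental vector field\<close>

text \<open>The differential of \<open>\<pi>\<close>, written in a chart of the bundle chosen at the point; on tangent vectors
  the choice does not matter, by \<open>proj_diff_adapted\<close>.\<close>

definition proj_diff :: "'p \<Rightarrow> ('p, 'f) tvec \<Rightarrow> ('a, 'e) tvec" where
  "proj_diff p v = (let b = (SOME b. b \<in> B \<and> p \<in> fst b) in
     (\<lambda>a. if a \<in> A \<and> \<pi> p \<in> fst a
       then frechet_derivative (snd a \<circ> \<pi> \<circ> inv_chart b) (at (snd b p)) (v b) else 0))"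

text \<open>Near the point \<open>\<pi>\<close> is, in coordinates, the transition to \<open>F\<close> followed by the first projection
  and the transition from \<open>a\<close>; the chain rule gives the formula.\<close>

lemma proj_diff_adapted:
  assumes aF: "adapted_chart a F" and p: "p \<in> fst F" and v: "v \<in> tangent_space B p"
  shows "proj_diff p v = chart_vector A a (\<pi> p) (fst (chart_coords B F p v))"
proof
  fix a'
  define b where "b = (SOME b. b \<in> B \<and> p \<in> fst b)"
  obtain b' where "b' \<in> B" "p \<in> fst b'"
    using total.chart_at adapted_chartD(5)[OF aF] p by blast
  then have b: "b \<in> B" "p \<in> fst b"
    using someI[of "\<lambda>b. b \<in> B \<and> p \<in> fst b" b'] by (auto simp: b_def)
  have injb: "inj_on (snd b) (fst b)" by (rule total.chart_inj[OF b(1)])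
  have inja: "inj_on (snd a) (fst a)" by (rule base.chart_inj[OF adapted_chartD(1)[OF aF]])
  have bF: "smooth_change b F"
    by (rule total.compatible_chartD(5)[OF adapted_chartD(3)[OF aF] b(1)])
  show "proj_diff p v a' = chart_vector A a (\<pi> p) (fst (chart_coords B F p v)) a'"
  proof (cases "a' \<in> A \<and> \<pi> p \<in> fst a'")
    case True
    have "fst (transition b F (snd b p)) = snd a (\<pi> p)"
      by (simp add: transition_apply[OF injb b(2)] adapted_chartD(7)[OF aF p])
    then have "(transition a a' has_derivative frechet_derivative (transition a a') (at (snd a (\<pi> p))))
        (at (fst (transition b F (snd b p))))"
      using smooth_change_has_derivative[OF base.atlas_smooth_change[OF adapted_chartD(1)[OF aF]]
          adapted_chartD(6)[OF aF p], of a'] True by simp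
    from has_derivative_compose[OF
        has_derivative_fst[OF smooth_change_has_derivative[OF bF b(2) p]] this]
    have "((\<lambda>x. transition a a' (fst (transition b F x))) has_derivative
        (\<lambda>y. frechet_derivative (transition a a') (at (snd a (\<pi> p)))
          (fst (frechet_derivative (transition b F) (at (snd b p)) y)))) (at (snd b p))" .
    then have "((snd a' \<circ> \<pi> \<circ> inv_chart b) has_derivative
        (\<lambda>y. frechet_derivative (transition a a') (at (snd a (\<pi> p)))
          (fst (frechet_derivative (transition b F) (at (snd b p)) y)))) (at (snd b p))"
    proof (rule has_derivative_transform_within_open)
      show "open (snd b ` (fst b \<inter> fst F))" using bF by (simp add: smooth_change_def)
      show "snd b p \<in> snd b ` (fst b \<inter> fst F)" using b p by blast
      fix x assume "x \<in> snd b ` (fst b \<inter> fst F)"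
      then obtain u where u: "u \<in> fst b" "u \<in> fst F" "x = snd b u" by auto
      show "transition a a' (fst (transition b F x)) = (snd a' \<circ> \<pi> \<circ> inv_chart b) x"
        by (simp add: u(3) transition_apply[OF injb u(1)] adapted_chartD(7)[OF aF u(2)]
            transition_apply[OF inja adapted_chartD(6)[OF aF u(2)]] inv_chart_left[OF injb u(1)])
    qed
    then have "frechet_derivative (snd a' \<circ> \<pi> \<circ> inv_chart b) (at (snd b p))
        = (\<lambda>y. frechet_derivative (transition a a') (at (snd a (\<pi> p)))
          (fst (frechet_derivative (transition b F) (at (snd b p)) y)))"
      using frechet_derivative_at by metis
    then show ?thesis
      using True total.chart_coords_eq[OF adapted_chartD(3)[OF aF] p v b]
      by (simp add: proj_diff_def b_def[symmetric] chart_vector_def)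
  next
    case False
    then show ?thesis by (auto simp: proj_diff_def Let_def chart_vector_def)
  qed
qed

lemma proj_diff_in:
  assumes "p \<in> topspace Y" "v \<in> tangent_space B p"
  shows "proj_diff p v \<in> tangent_space A (\<pi> p)"
proof -
  obtain a F where aF: "adapted_chart a F" "p \<in> fst F"
    using adapted_chart_at[OF assms(1)] by blast
  show ?thesis
    unfolding proj_diff_adapted[OF aF assms(2)]
    by (rule base.tangent_vector_in[OF adapted_chartD(2)[OF aF(1)] adapted_chartD(6)[OF aF]])
qed

lemma proj_diff_linear_extension:
  assumes "p \<in> topspace Y"
  shows "\<exists>L. linear L \<and> (\<forall>v\<in>tangent_space B p. proj_diff p v = L v)"
proof -
  obtain a F where aF: "adapted_chart a F" "p \<in> fst F"
    using adapted_chart_at[OF assms(1)] by blast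
  have "linear (\<lambda>v. chart_vector A a (\<pi> p) (fst (chart_coords B F p v)))"
    using linear_compose[OF linear_compose[OF
          total.chart_coords_linear[OF adapted_chartD(3)[OF aF(1)] aF(2)] linear_fst]
        base.chart_vector_linear[OF adapted_chartD(2)[OF aF(1)] adapted_chartD(6)[OF aF]]]
    by (simp add: o_def)
  then show ?thesis
    using proj_diff_adapted[OF aF] by blast
qed

lemma proj_diff_linear:
  assumes "p \<in> topspace Y"
  shows "v \<in> tangent_space B p \<Longrightarrow> w \<in> tangent_space B p \<Longrightarrow>
      proj_diff p (v + w) = proj_diff p v + proj_diff p w"
    "v \<in> tangent_space B p \<Longrightarrow> proj_diff p (r *\<^sub>R v) = r *\<^sub>R proj_diff p v"
proof -
  obtain L where L: "linear L" "\<forall>v\<in>tangent_space B p. proj_diff p v = L v"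
    using proj_diff_linear_extension[OF assms(1)] by blast
  show "v \<in> tangent_space B p \<Longrightarrow> w \<in> tangent_space B p \<Longrightarrow>
      proj_diff p (v + w) = proj_diff p v + proj_diff p w"
    "v \<in> tangent_space B p \<Longrightarrow> proj_diff p (r *\<^sub>R v) = r *\<^sub>R proj_diff p v"
    using subspace_add[OF total.subspace_tangent_space] subspace_scale[OF total.subspace_tangent_space]
    by (simp_all add: L(2) linear_add[OF L(1)] linear_scale[OF L(1)])
qed

text \<open>The velocity of the orbit through \<open>p\<close>, in the components of all charts around \<open>p\<close>.\<close>

definition fundamental :: "'p \<Rightarrow> ('p, 'f) tvec" where
  "fundamental p = (\<lambda>b. if b \<in> B \<and> p \<in> fst b
     then vector_derivative (\<lambda>s. snd b (act (p, cis s))) (at 0) else 0)"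

text \<open>In an adapted chart the orbit is the straight line \<open>s \<mapsto> F(p) + (0, s)\<close> for small \<open>s\<close>.\<close>

lemma fundamental_adapted:
  assumes aF: "adapted_chart a F" and p: "p \<in> fst F"
  shows "fundamental p = chart_vector B F p (0, 1)"
proof
  fix b
  show "fundamental p b = chart_vector B F p (0, 1) b"
  proof (cases "b \<in> B \<and> p \<in> fst b")
    case True
    let ?D = "frechet_derivative (transition F b) (at (snd F p))"
    have Fb: "smooth_change F b"
      using total.compatible_chartD(4)[OF adapted_chartD(3)[OF aF]] True by blast
    have "\<exists>\<epsilon>>0. \<forall>s. \<bar>s\<bar> < \<epsilon> \<longrightarrow>
        act (p, cis s) \<in> fst F \<and> snd F (act (p, cis s)) = snd F p + (0, s)"
      using aF p by (simp only: adapted_chart_def)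
    then obtain \<epsilon> where \<epsilon>: "\<epsilon> > 0" "\<forall>s. \<bar>s\<bar> < \<epsilon> \<longrightarrow>
        act (p, cis s) \<in> fst F \<and> snd F (act (p, cis s)) = snd F p + (0, s)"
      by (elim exE conjE)
    have "((\<lambda>s::real. snd F p + (0, s)) has_derivative (\<lambda>s. (0, s))) (at 0)"
      by (auto intro!: derivative_eq_intros)
    moreover have "(transition F b has_derivative ?D) (at (snd F p + (0, 0)))"
      using smooth_change_has_derivative[OF Fb p] True by (simp add: zero_prod_def[symmetric])
    ultimately have "((\<lambda>s. transition F b (snd F p + (0, s))) has_derivative (\<lambda>s. ?D (0, s))) (at 0)"
      by (rule has_derivative_compose)
    moreover have "(\<lambda>s. ?D (0, s)) = (\<lambda>s. s *\<^sub>R ?D (0, 1))"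
    proof
      show "?D (0, s) = s *\<^sub>R ?D (0, 1)" for s
        using linear_scale[OF smooth_change_linear[OF Fb p], of s "(0, 1)"] True
        by (simp only: scaleR_Pair scaleR_zero_right real_scaleR_def mult_1_right simp_thms)
    qed
    ultimately have "((\<lambda>s. transition F b (snd F p + (0, s))) has_vector_derivative ?D (0, 1)) (at 0)"
      by (simp only: has_vector_derivative_def)
    then have "((\<lambda>s. snd b (act (p, cis s))) has_vector_derivative ?D (0, 1)) (at 0)"
    proof (rule has_vector_derivative_transform_within_open[where S = "{-\<epsilon><..<\<epsilon>}"])
      fix s assume "s \<in> {-\<epsilon><..<\<epsilon>}"
      then have s: "act (p, cis s) \<in> fst F" "snd F (act (p, cis s)) = snd F p + (0, s)"
        using \<epsilon>(2)[rule_format, of s] by auto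
      show "transition F b (snd F p + (0, s)) = snd b (act (p, cis s))"
        unfolding s(2)[symmetric] by (rule transition_apply[OF adapted_chartD(4)[OF aF] s(1)])
    qed (use \<epsilon>(1) in auto)
    then show ?thesis
      using True by (simp add: fundamental_def chart_vector_def vector_derivative_at)
  next
    case False
    then show ?thesis by (auto simp: fundamental_def chart_vector_def)
  qed
qed

lemma fundamental_in:
  assumes "p \<in> topspace Y" shows "fundamental p \<in> tangent_space B p"
proof -
  obtain a F where aF: "adapted_chart a F" "p \<in> fst F"
    using adapted_chart_at[OF assms(1)] by blast
  show ?thesis
    unfolding fundamental_adapted[OF aF]
    by (rule total.tangent_vector_in[OF adapted_chartD(3)[OF aF(1)] aF(2)])
qed

lemma proj_diff_fundamental:
  assumes "p \<in> topspace Y" shows "proj_diff p (fundamental p) = 0"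
proof -
  obtain a F where aF: "adapted_chart a F" "p \<in> fst F"
    using adapted_chart_at[OF assms(1)] by blast
  have "chart_coords B F p (fundamental p) = (0, 1)"
    unfolding fundamental_adapted[OF aF]
    by (rule total.chart_coords_vector[OF adapted_chartD(3)[OF aF(1)] aF(2)])
  then show ?thesis
    unfolding proj_diff_adapted[OF aF fundamental_in[OF assms]]
    by (simp add: linear_0[OF base.chart_vector_linear[OF adapted_chartD(2)[OF aF(1)] adapted_chartD(6)[OF aF]]])
qed

lemma fundamental_nonzero:
  assumes "p \<in> topspace Y" shows "fundamental p \<noteq> 0"
proof
  assume *: "fundamental p = 0"
  obtain a F where aF: "adapted_chart a F" "p \<in> fst F"
    using adapted_chart_at[OF assms(1)] by blast
  have "(0, 1) = chart_coords B F p (fundamental p)"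
    unfolding fundamental_adapted[OF aF]
    by (rule total.chart_coords_vector[OF adapted_chartD(3)[OF aF(1)] aF(2), symmetric])
  also have "\<dots> = 0"
    unfolding * by (rule linear_0[OF total.chart_coords_linear[OF adapted_chartD(3)[OF aF(1)] aF(2)]])
  finally show False by (simp add: zero_prod_def)
qed

lemma smooth_on_adaptedI:
  assumes b: "b \<in> B"
    and sm: "\<And>a F. adapted_chart a F \<Longrightarrow> smooth_on (snd b ` (fst b \<inter> fst F)) h"
  shows "smooth_on (chart_image b) h"
proof (rule total.smooth_on_chartI[OF total.compatible_chart_atlas[OF b]])
  fix p assume "p \<in> fst b"
  then have "p \<in> topspace Y"
    using total.compatible_chartD(3)[OF total.compatible_chart_atlas[OF b]] by blast
  then obtain a F where aF: "adapted_chart a F" "p \<in> fst F"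
    using adapted_chart_at by blast
  then show "\<exists>U. openin Y U \<and> p \<in> U \<and> smooth_on (snd b ` (fst b \<inter> U)) h"
    using sm[OF aF(1)] total.compatible_chartD(1)[OF adapted_chartD(3)[OF aF(1)]] by blast
qed

lemma adapted_overlap:
  assumes "adapted_chart a F" "b \<in> B"
  shows "open (snd b ` (fst b \<inter> fst F))" "smooth_on (snd b ` (fst b \<inter> fst F)) (transition b F)"
    "open (snd F ` (fst F \<inter> fst b))" "smooth_on (snd F ` (fst F \<inter> fst b)) (transition F b)"
    "transition b F ` snd b ` (fst b \<inter> fst F) \<subseteq> snd F ` (fst F \<inter> fst b)"
proof -
  show "open (snd b ` (fst b \<inter> fst F))" "smooth_on (snd b ` (fst b \<inter> fst F)) (transition b F)"
    "open (snd F ` (fst F \<inter> fst b))" "smooth_on (snd F ` (fst F \<inter> fst b)) (transition F b)"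
    using total.compatible_chartD(4,5)[OF adapted_chartD(3)[OF assms(1)] assms(2)]
    by (simp_all add: smooth_change_def)
  show "transition b F ` snd b ` (fst b \<inter> fst F) \<subseteq> snd F ` (fst F \<inter> fst b)"
    by (auto simp: transition_apply[OF total.chart_inj[OF assms(2)]] intro!: imageI)
qed

lemma smooth_adapted_vector:
  fixes y :: "'f \<Rightarrow> 'e \<times> real"
  assumes aF: "adapted_chart a F" and b: "b \<in> B"
    and y: "smooth_on (snd b ` (fst b \<inter> fst F)) y"
  shows "smooth_on (snd b ` (fst b \<inter> fst F)) (\<lambda>x. chart_vector B F (inv_chart b x) (y x) b)"
proof (rule smooth_on_eq[OF adapted_overlap(1)[OF aF b]])
  show "smooth_on (snd b ` (fst b \<inter> fst F))
      (\<lambda>x. frechet_derivative (transition F b) (at (transition b F x)) (y x))"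
    using adapted_overlap[OF aF b] y by (intro smooth_on_frechet_apply)
  fix x assume "x \<in> snd b ` (fst b \<inter> fst F)"
  then obtain u where "u \<in> fst b" "u \<in> fst F" "x = snd b u" by auto
  then show "chart_vector B F (inv_chart b x) (y x) b
      = frechet_derivative (transition F b) (at (transition b F x)) (y x)"
    using b by (simp add: inv_chart_left[OF total.chart_inj[OF b]] transition_apply[OF total.chart_inj[OF b]]
        chart_vector_def)
qed

lemma fundamental_vector_field: "vector_field B fundamental"
  unfolding vector_field_def
proof (intro conjI ballI)
  show "fundamental p \<in> tangent_space B p" if "p \<in> points B" for p
    using fundamental_in that total.points_eq by blast
  fix b assume b: "b \<in> B"
  show "smooth_on (chart_image b) (\<lambda>x. fundamental (inv_chart b x) b)"
  proof (rule smooth_on_adaptedI[OF b])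
    fix a F assume aF: "adapted_chart a F"
    have o: "open (snd b ` (fst b \<inter> fst F))" by (rule adapted_overlap(1)[OF aF b])
    show "smooth_on (snd b ` (fst b \<inter> fst F)) (\<lambda>x. fundamental (inv_chart b x) b)"
    proof (rule smooth_on_eq[OF o smooth_adapted_vector[OF aF b smooth_on_const[OF o]]])
      fix x assume "x \<in> snd b ` (fst b \<inter> fst F)"
      then have "inv_chart b x \<in> fst F"
        by (auto simp: inv_chart_left[OF total.chart_inj[OF b]])
      then show "fundamental (inv_chart b x) b = chart_vector B F (inv_chart b x) (0, 1) b"
        by (simp add: fundamental_adapted[OF aF])
    qed
  qed
qed

text \<open>In adapted coordinates the projection is smooth, being a transition map followed by the first
  projection.\<close>

lemma smooth_pullback:
  assumes aF: "adapted_chart a F" and b: "b \<in> B"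
    and f: "smooth_on (chart_image a) (\<lambda>z. f (inv_chart a z))"
  shows "smooth_on (snd b ` (fst b \<inter> fst F)) (\<lambda>x. f (\<pi> (inv_chart b x)))"
proof (rule smooth_on_eq)
  let ?S = "snd b ` (fst b \<inter> fst F)"
  show o: "open ?S" by (rule adapted_overlap(1)[OF aF b])
  have u: "transition b F (snd b u) = snd F u" "fst (snd F u) = snd a (\<pi> u)" "\<pi> u \<in> fst a"
    "inv_chart b (snd b u) = u" "inv_chart a (snd a (\<pi> u)) = \<pi> u"
    if "u \<in> fst b" "u \<in> fst F" for u
    using that adapted_chartD(6,7)[OF aF] transition_apply[OF total.chart_inj[OF b]]
      inv_chart_left[OF total.chart_inj[OF b]] inv_chart_left[OF base.chart_inj[OF adapted_chartD(1)[OF aF]]]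
    by blast+
  show "smooth_on ?S (\<lambda>x. f (inv_chart a (fst (transition b F x))))"
  proof (rule smooth_on_compose[OF o _ f])
    show "open (chart_image a)"
      by (rule base.compatible_chart_open_image[OF adapted_chartD(2)[OF aF]])
    show "smooth_on ?S (\<lambda>x. fst (transition b F x))"
      by (rule smooth_on_bounded_linear[OF bounded_linear_fst o adapted_overlap(2)[OF aF b]])
    show "(\<lambda>x. fst (transition b F x)) ` ?S \<subseteq> chart_image a"
      by (auto simp: u chart_image_def)
  qed
  show "f (\<pi> (inv_chart b x)) = f (inv_chart a (fst (transition b F x)))" if "x \<in> ?S" for x
    using that by (auto simp: u)
qed

text \<open>The base coordinates of \<open>d\<pi>\<close> applied to the coordinate field \<open>e\<close> of \<open>b\<close>, at coordinates \<open>x\<close> in \<open>b\<close>.\<close>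

definition proj_coords :: "('p, 'e \<times> real) chart \<Rightarrow> ('p, 'f) chart \<Rightarrow> 'f \<Rightarrow> 'f \<Rightarrow> 'e" where
  "proj_coords F b e x = fst (frechet_derivative (transition b F) (at x) e)"

lemma smooth_proj_coords:
  assumes aF: "adapted_chart a F" and b: "b \<in> B"
  shows "smooth_on (snd b ` (fst b \<inter> fst F)) (proj_coords F b e)"
  unfolding proj_coords_def
  by (rule smooth_on_bounded_linear[OF bounded_linear_fst adapted_overlap(1)[OF aF b]
        smooth_on_frechet[OF adapted_overlap(2)[OF aF b]]])

lemma proj_diff_coord_vector:
  assumes aF: "adapted_chart a F" and b: "b \<in> B" and x: "x \<in> snd b ` (fst b \<inter> fst F)"
  shows "proj_diff (inv_chart b x) (chart_vector B b (inv_chart b x) e)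
    = chart_vector A a (\<pi> (inv_chart b x)) (proj_coords F b e x)"
proof -
  obtain u where u: "u \<in> fst b" "u \<in> fst F" "x = snd b u" using x by auto
  have T: "chart_vector B b u e \<in> tangent_space B u"
    by (rule total.tangent_vector_in[OF total.compatible_chart_atlas[OF b] u(1)])
  show ?thesis
    using total.chart_coords_eq[OF adapted_chartD(3)[OF aF] u(2) T b u(1)]
    by (simp add: u(3) inv_chart_left[OF total.chart_inj[OF b] u(1)] proj_diff_adapted[OF aF u(2) T]
        proj_coords_def total.chart_vector_atlas(2)[OF b u(1)])
qed

end

section \<open>Linear algebra of tensors at a point\<close>

lemma dim_image_inj_on:
  fixes f :: "'v::real_vector \<Rightarrow> 'w::real_vector"
  assumes "linear f" "subspace W" "inj_on f W"
  shows "dim (f ` W) = dim W"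
proof -
  obtain S where S: "S \<subseteq> W" "independent S" "W \<subseteq> span S" "card S = dim W"
    using real_vector.basis_exists by blast
  have "span S = W"
    using S(1,3) assms(2) by (simp add: subset_antisym span_minimal)
  then have "independent (f ` S)" "f ` W = span (f ` S)"
    using linear_independent_injective_image[OF assms(1) S(2)] linear_span_image[OF assms(1), of S] assms(3)
    by auto
  moreover have "card (f ` S) = card S"
    using assms(3) S(1) by (meson card_image inj_on_subset)
  ultimately show ?thesis
    using S(1,4) by (intro real_vector.dim_unique[of "f ` S"]) (auto intro: span_base)
qed

lemma linear_on_subspaceD:
  assumes L: "linear_on_subspace V L" and V: "subspace V"
  shows "v \<in> V \<Longrightarrow> w \<in> V \<Longrightarrow> L (v + w) = L v + L w" "v \<in> V \<Longrightarrow> L (r *\<^sub>R v) = r *\<^sub>R L v"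
    "v \<in> V \<Longrightarrow> w \<in> V \<Longrightarrow> L (v - w) = L v - L w" "L 0 = 0"
proof -
  have *: "L (a *\<^sub>R v + b *\<^sub>R w) = a *\<^sub>R L v + b *\<^sub>R L w" if "v \<in> V" "w \<in> V" for a b v w
    using that L unfolding linear_on_subspace_def by blast
  show "v \<in> V \<Longrightarrow> w \<in> V \<Longrightarrow> L (v + w) = L v + L w" using *[of v w 1 1] by simp
  show "v \<in> V \<Longrightarrow> L (r *\<^sub>R v) = r *\<^sub>R L v" using *[of v v r 0] by simp
  show "v \<in> V \<Longrightarrow> w \<in> V \<Longrightarrow> L (v - w) = L v - L w" using *[of v w 1 "-1"] by simp
  show "L 0 = 0" using *[OF subspace_0[OF V] subspace_0[OF V], of 0 0] by simp
qed

lemma linear_on_subspace_linear: "linear_on_subspace V L \<Longrightarrow> linear f \<Longrightarrow> range f \<subseteq> V \<Longrightarrow> linear (\<lambda>y. L (f y))"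
proof (rule linearI)
  assume *: "linear_on_subspace V L" "linear f" "range f \<subseteq> V"
  have L: "L (a *\<^sub>R f x + b *\<^sub>R f y) = a *\<^sub>R L (f x) + b *\<^sub>R L (f y)" for a b x y
    using * unfolding linear_on_subspace_def by blast
  show "L (f (x + y)) = L (f x) + L (f y)" for x y
    using L[of 1 x 1 y] by (simp add: linear_add[OF *(2)])
  show "L (f (r *\<^sub>R x)) = r *\<^sub>R L (f x)" for r x
    using L[of r x 0 x] by (simp add: linear_scale[OF *(2)])
qed

text \<open>Evaluate \<open>\<phi>\<^sup>3 v\<close> as \<open>\<phi> (\<phi>\<^sup>2 v)\<close> and as \<open>\<phi>\<^sup>2 (\<phi> v)\<close>; the comparison gives \<open>\<eta>(v) \<phi> \<xi> = \<eta>(\<phi> v) \<xi>\<close>.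
  For \<open>v = \<xi>\<close> this makes \<open>\<phi> \<xi>\<close> a multiple of \<open>\<xi>\<close>, and \<open>\<phi>\<^sup>2 \<xi> = 0\<close> forces the multiple to be 0. Then the
  left-hand side vanishes for all \<open>v\<close>.\<close>

lemma contact_identities:
  fixes \<phi> :: "'v::real_vector \<Rightarrow> 'v" and \<eta> :: "'v \<Rightarrow> real"
  assumes V: "subspace V" and \<phi>: "linear_on_subspace V \<phi>" "\<phi> ` V \<subseteq> V"
    and \<eta>: "linear_on_subspace V \<eta>" and \<xi>: "\<xi> \<in> V" "\<eta> \<xi> = \<epsilon>" "\<epsilon> \<noteq> 0"
    and sq: "\<And>v. v \<in> V \<Longrightarrow> \<phi> (\<phi> v) = - (\<epsilon> *\<^sub>R v) + \<eta> v *\<^sub>R \<xi>"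
  shows "\<phi> \<xi> = 0" "v \<in> V \<Longrightarrow> \<eta> (\<phi> v) = 0"
proof -
  have \<phi>V: "\<phi> v \<in> V" if "v \<in> V" for v using \<phi>(2) that by blast
  have sc: "r *\<^sub>R v \<in> V" if "v \<in> V" for r v by (rule subspace_scale[OF V that])
  have \<eta>\<phi>: "\<eta> v *\<^sub>R \<phi> \<xi> = \<eta> (\<phi> v) *\<^sub>R \<xi>" if v: "v \<in> V" for v
  proof -
    have "\<phi> (\<phi> (\<phi> v)) = \<phi> (\<eta> v *\<^sub>R \<xi> - \<epsilon> *\<^sub>R v)"
      by (simp add: sq[OF v])
    also have "\<dots> = \<eta> v *\<^sub>R \<phi> \<xi> - \<epsilon> *\<^sub>R \<phi> v"
      by (simp add: linear_on_subspaceD(2,3)[OF \<phi>(1) V] sc v \<xi>(1))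
    finally show ?thesis
      by (simp add: sq[OF \<phi>V[OF v]])
  qed
  have c: "\<epsilon> *\<^sub>R \<phi> \<xi> = \<eta> (\<phi> \<xi>) *\<^sub>R \<xi>"
    using \<eta>\<phi>[OF \<xi>(1)] \<xi>(2) by simp
  have "\<eta> (\<phi> \<xi>) *\<^sub>R \<phi> \<xi> = \<phi> (\<epsilon> *\<^sub>R \<phi> \<xi>)"
    by (simp add: c linear_on_subspaceD(2)[OF \<phi>(1) V \<xi>(1)])
  also have "\<dots> = 0"
    using \<xi>(2) by (simp add: linear_on_subspaceD(2)[OF \<phi>(1) V \<phi>V[OF \<xi>(1)]] sq[OF \<xi>(1)])
  finally have "\<phi> \<xi> = 0 \<or> \<eta> (\<phi> \<xi>) = 0" by auto
  then show 0: "\<phi> \<xi> = 0"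
    using c \<xi>(3) linear_on_subspaceD(4)[OF \<eta> V] by auto
  have "\<xi> \<noteq> 0"
    using \<xi>(2,3) linear_on_subspaceD(4)[OF \<eta> V] by auto
  then show "v \<in> V \<Longrightarrow> \<eta> (\<phi> v) = 0"
    using \<eta>\<phi>[of v] 0 by simp
qed

lemma one_formD:
  assumes "one_form A \<eta>"
  shows "p \<in> points A \<Longrightarrow> linear_on_subspace (tangent_space A p) (\<eta> p)"
    "c \<in> A \<Longrightarrow> smooth_on (chart_image c) (\<lambda>x. \<eta> (inv_chart c x) (chart_vector A c (inv_chart c x) e))"
  using assms by (auto simp: one_form_def Let_def coord_vector_eq_chart_vector)

lemma vector_fieldD:
  assumes "vector_field A V"
  shows "p \<in> points A \<Longrightarrow> V p \<in> tangent_space A p"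
    "c \<in> A \<Longrightarrow> smooth_on (chart_image c) (\<lambda>x. V (inv_chart c x) c)"
  using assms by (auto simp: vector_field_def)

lemma endo_fieldD:
  assumes "endo_field A J"
  shows "p \<in> points A \<Longrightarrow> linear_on_subspace (tangent_space A p) (J p)"
    "p \<in> points A \<Longrightarrow> v \<in> tangent_space A p \<Longrightarrow> J p v \<in> tangent_space A p"
    "c \<in> A \<Longrightarrow> smooth_on (chart_image c) (\<lambda>x. J (inv_chart c x) (chart_vector A c (inv_chart c x) e) c)"
  using assms by (auto simp: endo_field_def Let_def coord_vector_eq_chart_vector)

lemma bilinear_form_fieldD:
  assumes "bilinear_form_field A g"
  shows "p \<in> points A \<Longrightarrow> v \<in> tangent_space A p \<Longrightarrow> linear_on_subspace (tangent_space A p) (\<lambda>w. g p v w)"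
    "p \<in> points A \<Longrightarrow> v \<in> tangent_space A p \<Longrightarrow> linear_on_subspace (tangent_space A p) (\<lambda>w. g p w v)"
    "c \<in> A \<Longrightarrow> smooth_on (chart_image c)
      (\<lambda>x. g (inv_chart c x) (chart_vector A c (inv_chart c x) e) (chart_vector A c (inv_chart c x) e'))"
  using assms by (auto simp: bilinear_form_field_def Let_def coord_vector_eq_chart_vector)

section \<open>Splitting the tangent spaces of the bundle\<close>

text \<open>The form \<open>\<omega>\<close> splits off the vertical line: its kernel is a complement of the line spanned by the
  fundamental vector.\<close>

locale split_circle_bundle = principal_circle_bundle Y B X A \<pi> act
  for Y :: "'p topology" and B :: "('p, 'f::euclidean_space) atlas"
    and X :: "'a topology" and A :: "('a, 'e::euclidean_space) atlas"
    and \<pi> :: "'p \<Rightarrow> 'a" and act :: "'p \<times> complex \<Rightarrow> 'p" +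
  fixes \<omega> :: "'p \<Rightarrow> ('p, 'f) tvec \<Rightarrow> real"
  assumes form: "one_form B \<omega>"
    and form_fundamental: "p \<in> topspace Y \<Longrightarrow> \<omega> p (fundamental p) = 1"
begin

lemma form_on: "p \<in> topspace Y \<Longrightarrow> linear_on_subspace (tangent_space B p) (\<omega> p)"
  using one_formD(1)[OF form] total.points_eq by blast

lemmas form_linear = linear_on_subspaceD[OF form_on total.subspace_tangent_space]

lemma proj_in: "p \<in> topspace Y \<Longrightarrow> \<pi> p \<in> topspace X"
  using proj_surj by blast

text \<open>The kernel of the differential of the projection is spanned by the fundamental vector, on which
  \<open>\<omega>\<close> is 1.\<close>

lemma split_eqI:
  assumes p: "p \<in> topspace Y" and v: "v \<in> tangent_space B p" and w: "w \<in> tangent_space B p"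
    and d: "proj_diff p v = proj_diff p w" and eq: "\<omega> p v = \<omega> p w"
  shows "v = w"
proof -
  obtain a F where aF: "adapted_chart a F" "p \<in> fst F"
    using adapted_chart_at[OF p] by blast
  note F = adapted_chartD(3)[OF aF(1)] aF(2)
  note a = adapted_chartD(2)[OF aF(1)] adapted_chartD(6)[OF aF]
  let ?c = "chart_coords B F p"
  have "fst (?c v) = fst (?c w)"
    using d unfolding proj_diff_adapted[OF aF v] proj_diff_adapted[OF aF w]
    using base.chart_coords_vector[OF a] by metis
  then have cv: "?c v = ?c w + (snd (?c v) - snd (?c w)) *\<^sub>R (0, 1)"
    by (simp add: prod_eq_iff)
  have "chart_vector B F p (?c v)
      = chart_vector B F p (?c w) + (snd (?c v) - snd (?c w)) *\<^sub>R chart_vector B F p (0, 1)"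
    by (subst cv) (simp only: linear_add[OF total.chart_vector_linear[OF F]]
        linear_scale[OF total.chart_vector_linear[OF F]])
  then have *: "v = w + (snd (?c v) - snd (?c w)) *\<^sub>R fundamental p"
    by (simp only: total.chart_vector_coords[OF F v] total.chart_vector_coords[OF F w] fundamental_adapted[OF aF])
  have "\<omega> p v = \<omega> p w + (snd (?c v) - snd (?c w))"
    by (subst *) (simp add: form_linear(1,2)[OF p] w fundamental_in[OF p] form_fundamental[OF p]
        subspace_scale[OF total.subspace_tangent_space])
  then show ?thesis
    using * eq by simp
qed

text \<open>The inverse of \<open>v \<mapsto> (d\<pi> v, \<omega> v)\<close> on the tangent space.\<close>

definition assemble :: "'p \<Rightarrow> ('a, 'e) tvec \<Rightarrow> real \<Rightarrow> ('p, 'f) tvec" where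
  "assemble p w t = (THE v. v \<in> tangent_space B p \<and> proj_diff p v = w \<and> \<omega> p v = t)"

lemma assemble_eqI:
  assumes "p \<in> topspace Y" "v \<in> tangent_space B p" "proj_diff p v = w" "\<omega> p v = t"
  shows "assemble p w t = v"
  unfolding assemble_def by (rule the_equality) (use assms split_eqI in auto)

text \<open>In an adapted chart take any vector with the right base coordinates and correct it by a multiple of
  \<open>(0, 1)\<close>, which changes \<open>\<omega>\<close> by that multiple. The formula makes the smooth dependence on the
  arguments and the point visible.\<close>

lemma assemble_adapted:
  fixes t :: real
  assumes aF: "adapted_chart a F" "p \<in> fst F" and w: "w \<in> tangent_space A (\<pi> p)"
  defines "v \<equiv> chart_vector B F p (w a, t - \<omega> p (chart_vector B F p (w a, 0)))"
  shows "v \<in> tangent_space B p" "proj_diff p v = w" "\<omega> p v = t" "assemble p w t = v"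
proof -
  note F = adapted_chartD(3)[OF aF(1)] aF(2)
  have p: "p \<in> topspace Y" using adapted_chartD(5)[OF aF(1)] aF(2) by blast
  have T: "chart_vector B F p y \<in> tangent_space B p" for y
    by (rule total.tangent_vector_in[OF F])
  show 1: "v \<in> tangent_space B p" by (simp add: v_def T)
  show 2: "proj_diff p v = w"
    unfolding proj_diff_adapted[OF aF 1]
    by (simp add: v_def total.chart_coords_vector[OF F]
        base.chart_vector_atlas(1)[OF adapted_chartD(1)[OF aF(1)] adapted_chartD(6)[OF aF] w])
  define s where "s = t - \<omega> p (chart_vector B F p (w a, 0))"
  have ws: "(w a, s) = (w a, 0) + s *\<^sub>R (0, 1)" by simp
  have "v = chart_vector B F p (w a, 0) + s *\<^sub>R fundamental p"
    unfolding v_def s_def[symmetric] fundamental_adapted[OF aF] ws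
    by (simp only: linear_add[OF total.chart_vector_linear[OF F]]
        linear_scale[OF total.chart_vector_linear[OF F]])
  then show 3: "\<omega> p v = t"
    by (simp add: form_linear(1,2)[OF p] T fundamental_in[OF p] form_fundamental[OF p]
        subspace_scale[OF total.subspace_tangent_space] s_def)
  show "assemble p w t = v" by (rule assemble_eqI[OF p 1 2 3])
qed

lemma assemble_props:
  assumes p: "p \<in> topspace Y" and w: "w \<in> tangent_space A (\<pi> p)"
  shows "assemble p w t \<in> tangent_space B p" "proj_diff p (assemble p w t) = w" "\<omega> p (assemble p w t) = t"
proof -
  obtain a F where aF: "adapted_chart a F" "p \<in> fst F"
    using adapted_chart_at[OF p] by blast
  show "assemble p w t \<in> tangent_space B p" "proj_diff p (assemble p w t) = w" "\<omega> p (assemble p w t) = t"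
    unfolding assemble_adapted(4)[OF aF w] by (rule assemble_adapted(1-3)[OF aF w])+
qed

lemma smooth_form_adapted:
  fixes y :: "'f \<Rightarrow> 'e \<times> real"
  assumes aF: "adapted_chart a F" and b: "b \<in> B" and y: "smooth_on (snd b ` (fst b \<inter> fst F)) y"
  shows "smooth_on (snd b ` (fst b \<inter> fst F)) (\<lambda>x. \<omega> (inv_chart b x) (chart_vector B F (inv_chart b x) (y x)))"
proof (rule smooth_on_eq)
  let ?S = "snd b ` (fst b \<inter> fst F)"
  show o: "open ?S" by (rule adapted_overlap(1)[OF aF b])
  have bc: "total.compatible_chart b" by (rule total.compatible_chart_atlas[OF b])
  have u: "inv_chart b x \<in> fst b" "inv_chart b x \<in> fst F" "inv_chart b x \<in> topspace Y" if "x \<in> ?S" for x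
    using that adapted_chartD(5)[OF aF] by (auto simp: inv_chart_left[OF total.chart_inj[OF b]])
  show "smooth_on ?S (\<lambda>x. \<omega> (inv_chart b x)
      (chart_vector B b (inv_chart b x) (chart_vector B F (inv_chart b x) (y x) b)))"
  proof (rule smooth_on_linear_family[OF o _ _ smooth_adapted_vector[OF aF b y]])
    show "linear (\<lambda>z. \<omega> (inv_chart b x) (chart_vector B b (inv_chart b x) z))" if "x \<in> ?S" for x
      using u[OF that] total.tangent_vector_in[OF bc]
      by (intro linear_on_subspace_linear[OF form_on] total.chart_vector_linear[OF bc]) auto
    show "smooth_on ?S (\<lambda>x. \<omega> (inv_chart b x) (chart_vector B b (inv_chart b x) i))" for i
      by (rule smooth_on_subset[OF one_formD(2)[OF form b]]) (auto simp: chart_image_def)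
  qed
  show "\<omega> (inv_chart b x) (chart_vector B F (inv_chart b x) (y x))
      = \<omega> (inv_chart b x) (chart_vector B b (inv_chart b x) (chart_vector B F (inv_chart b x) (y x) b))"
    if "x \<in> ?S" for x
    using u[OF that] b total.tangent_vector_in[OF adapted_chartD(3)[OF aF]]
    by (simp add: total.chart_vector_atlas(1))
qed

lemma smooth_assemble:
  assumes aF: "adapted_chart a F" and b: "b \<in> B"
    and w: "\<And>x. x \<in> snd b ` (fst b \<inter> fst F) \<Longrightarrow> w x \<in> tangent_space A (\<pi> (inv_chart b x))"
    and sm: "smooth_on (snd b ` (fst b \<inter> fst F)) (\<lambda>x. w x a)" "smooth_on (snd b ` (fst b \<inter> fst F)) t"
  shows "smooth_on (snd b ` (fst b \<inter> fst F)) (\<lambda>x. assemble (inv_chart b x) (w x) (t x) b)"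
proof (rule smooth_on_eq)
  let ?S = "snd b ` (fst b \<inter> fst F)"
  show o: "open ?S" by (rule adapted_overlap(1)[OF aF b])
  show "smooth_on ?S (\<lambda>x. chart_vector B F (inv_chart b x)
      (w x a, t x - \<omega> (inv_chart b x) (chart_vector B F (inv_chart b x) (w x a, 0))) b)"
    by (intro smooth_adapted_vector[OF aF b] smooth_on_Pair[OF o] smooth_on_diff[OF o]
        smooth_form_adapted[OF aF b] smooth_on_const[OF o] sm)
  show "assemble (inv_chart b x) (w x) (t x) b = chart_vector B F (inv_chart b x)
      (w x a, t x - \<omega> (inv_chart b x) (chart_vector B F (inv_chart b x) (w x a, 0))) b"
    if "x \<in> ?S" for x
    using that assemble_adapted(4)[OF aF _ w[OF that]]
    by (auto simp: inv_chart_left[OF total.chart_inj[OF b]])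
qed

text \<open>This covers all tensors of the base at once: \<open>K\<close> is the tensor, or its component in the chart,
  with all arguments but one inserted.\<close>

lemma smooth_pullback_apply:
  fixes K :: "'a \<Rightarrow> ('a, 'e) tvec \<Rightarrow> 'b::real_normed_vector"
  assumes aF: "adapted_chart a F" and b: "b \<in> B"
    and K: "\<And>q. q \<in> fst a \<Longrightarrow> linear_on_subspace (tangent_space A q) (K q)"
    and sm: "\<And>i. smooth_on (chart_image a) (\<lambda>z. K (inv_chart a z) (chart_vector A a (inv_chart a z) i))"
    and y: "smooth_on (snd b ` (fst b \<inter> fst F)) y"
  shows "smooth_on (snd b ` (fst b \<inter> fst F))
    (\<lambda>x. K (\<pi> (inv_chart b x)) (chart_vector A a (\<pi> (inv_chart b x)) (y x)))"
proof (rule smooth_on_linear_family[OF adapted_overlap(1)[OF aF b] _ _ y])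
  let ?S = "snd b ` (fst b \<inter> fst F)"
  show "linear (\<lambda>z. K (\<pi> (inv_chart b x)) (chart_vector A a (\<pi> (inv_chart b x)) z))" if "x \<in> ?S" for x
  proof -
    have q: "\<pi> (inv_chart b x) \<in> fst a"
      using that adapted_chartD(6)[OF aF] by (auto simp: inv_chart_left[OF total.chart_inj[OF b]])
    show ?thesis
      using base.tangent_vector_in[OF adapted_chartD(2)[OF aF] q]
      by (intro linear_on_subspace_linear[OF K[OF q]] base.chart_vector_linear[OF adapted_chartD(2)[OF aF] q]) auto
  qed
  show "smooth_on ?S (\<lambda>x. K (\<pi> (inv_chart b x)) (chart_vector A a (\<pi> (inv_chart b x)) i))" for i
    by (rule smooth_pullback[OF aF b sm])
qed

section \<open>Lifting tensors to the bundle\<close>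

text \<open>In the splitting of the tangent space this is \<open>(X, f) \<mapsto> (\<phi> X - f \<xi>, \<eta> X)\<close>.\<close>

definition lift_endo where
  "lift_endo \<phi> \<xi> \<eta> p v =
     assemble p (\<phi> (\<pi> p) (proj_diff p v) - \<omega> p v *\<^sub>R \<xi> (\<pi> p)) (\<eta> (\<pi> p) (proj_diff p v))"

lemma lift_endo:
  assumes \<phi>: "endo_field A \<phi>" and \<xi>: "vector_field A \<xi>"
    and p: "p \<in> topspace Y" and v: "v \<in> tangent_space B p"
  shows "lift_endo \<phi> \<xi> \<eta> p v \<in> tangent_space B p"
    "proj_diff p (lift_endo \<phi> \<xi> \<eta> p v) = \<phi> (\<pi> p) (proj_diff p v) - \<omega> p v *\<^sub>R \<xi> (\<pi> p)"
    "\<omega> p (lift_endo \<phi> \<xi> \<eta> p v) = \<eta> (\<pi> p) (proj_diff p v)"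
proof -
  have "\<phi> (\<pi> p) (proj_diff p v) - \<omega> p v *\<^sub>R \<xi> (\<pi> p) \<in> tangent_space A (\<pi> p)"
    using proj_in[OF p] base.points_eq
    by (intro subspace_diff subspace_scale base.subspace_tangent_space endo_fieldD(2)[OF \<phi>]
        vector_fieldD(1)[OF \<xi>] proj_diff_in p v) auto
  from assemble_props[OF p this] show "lift_endo \<phi> \<xi> \<eta> p v \<in> tangent_space B p"
    "proj_diff p (lift_endo \<phi> \<xi> \<eta> p v) = \<phi> (\<pi> p) (proj_diff p v) - \<omega> p v *\<^sub>R \<xi> (\<pi> p)"
    "\<omega> p (lift_endo \<phi> \<xi> \<eta> p v) = \<eta> (\<pi> p) (proj_diff p v)"
    by (simp_all add: lift_endo_def)
qed

lemma smooth_form_coord: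
  assumes "b \<in> B"
  shows "smooth_on (snd b ` (fst b \<inter> fst F)) (\<lambda>x. \<omega> (inv_chart b x) (chart_vector B b (inv_chart b x) e))"
  by (rule smooth_on_subset[OF one_formD(2)[OF form assms]]) (auto simp: chart_image_def)

text \<open>Linearity follows by comparing the two components of the splitting. For smoothness, all ingredients
  are written in an adapted chart, where \<open>d\<pi>\<close> of a coordinate field has the smooth base coordinates
  \<open>proj_coords\<close>.\<close>

lemma endo_field_lift_endo:
  assumes \<phi>: "endo_field A \<phi>" and \<xi>: "vector_field A \<xi>" and \<eta>: "one_form A \<eta>"
  shows "endo_field B (lift_endo \<phi> \<xi> \<eta>)"
  unfolding endo_field_def
proof (intro conjI ballI allI)
  note lift = lift_endo[OF \<phi> \<xi>]
  fix p assume "p \<in> points B"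
  then have p: "p \<in> topspace Y" by (simp add: total.points_eq)
  have q: "\<pi> p \<in> points A" using proj_in[OF p] by (simp add: base.points_eq)
  have add: "v + w \<in> tangent_space B p" if "v \<in> tangent_space B p" "w \<in> tangent_space B p" for v w
    by (rule subspace_add[OF total.subspace_tangent_space that])
  have scale: "r *\<^sub>R v \<in> tangent_space B p" if "v \<in> tangent_space B p" for r v
    by (rule subspace_scale[OF total.subspace_tangent_space that])
  have scaleA: "r *\<^sub>R v \<in> tangent_space A (\<pi> p)" if "v \<in> tangent_space A (\<pi> p)" for r v
    by (rule subspace_scale[OF base.subspace_tangent_space that])
  show "linear_on_subspace (tangent_space B p) (lift_endo \<phi> \<xi> \<eta> p)"
    unfolding linear_on_subspace_def
  proof (intro ballI allI)
    fix v w r s assume v: "v \<in> tangent_space B p" and w: "w \<in> tangent_space B p"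
    note rs = scale[OF v, of r] scale[OF w, of s]
    note vw = add[OF rs]
    note lrs = scale[OF lift(1)[OF p v], of r] scale[OF lift(1)[OF p w], of s]
    note lin\<phi> = linear_on_subspaceD[OF endo_fieldD(1)[OF \<phi> q] base.subspace_tangent_space]
    note lin\<eta> = linear_on_subspaceD[OF one_formD(1)[OF \<eta> q] base.subspace_tangent_space]
    show "lift_endo \<phi> \<xi> \<eta> p (r *\<^sub>R v + s *\<^sub>R w) = r *\<^sub>R lift_endo \<phi> \<xi> \<eta> p v + s *\<^sub>R lift_endo \<phi> \<xi> \<eta> p w"
    proof (rule split_eqI[OF p lift(1)[OF p vw] add[OF lrs]])
      show "proj_diff p (lift_endo \<phi> \<xi> \<eta> p (r *\<^sub>R v + s *\<^sub>R w))
          = proj_diff p (r *\<^sub>R lift_endo \<phi> \<xi> \<eta> p v + s *\<^sub>R lift_endo \<phi> \<xi> \<eta> p w)"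
        by (simp add: lift(2)[OF p] v w vw proj_diff_linear[OF p] rs lrs lift(1)[OF p]
            lin\<phi>(1,2) form_linear(1,2)[OF p] scaleA proj_diff_in[OF p] algebra_simps)
      show "\<omega> p (lift_endo \<phi> \<xi> \<eta> p (r *\<^sub>R v + s *\<^sub>R w))
          = \<omega> p (r *\<^sub>R lift_endo \<phi> \<xi> \<eta> p v + s *\<^sub>R lift_endo \<phi> \<xi> \<eta> p w)"
        by (simp add: lift(3)[OF p] v w vw proj_diff_linear[OF p] rs lrs lift(1)[OF p]
            lin\<eta>(1,2) form_linear(1,2)[OF p] scaleA proj_diff_in[OF p])
    qed
  qed
  show "lift_endo \<phi> \<xi> \<eta> p ` tangent_space B p \<subseteq> tangent_space B p"
    using lift(1)[OF p] by blast
next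
  fix b e assume b: "b \<in> B"
  have "smooth_on (chart_image b) (\<lambda>x. lift_endo \<phi> \<xi> \<eta> (inv_chart b x) (chart_vector B b (inv_chart b x) e) b)"
  proof (rule smooth_on_adaptedI[OF b])
    fix a F assume aF: "adapted_chart a F"
    let ?S = "snd b ` (fst b \<inter> fst F)" and ?v = "\<lambda>x. chart_vector B b (inv_chart b x) e"
    have a: "a \<in> A" by (rule adapted_chartD(1)[OF aF])
    have aX: "fst a \<subseteq> points A" using a by (auto simp: points_def)
    have o: "open ?S" by (rule adapted_overlap(1)[OF aF b])
    have u: "inv_chart b x \<in> fst b" "inv_chart b x \<in> topspace Y" "\<pi> (inv_chart b x) \<in> fst a"
      if "x \<in> ?S" for x
      using that adapted_chartD(5,6)[OF aF] by (auto simp: inv_chart_left[OF total.chart_inj[OF b]])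
    have uA: "\<pi> (inv_chart b x) \<in> points A" if "x \<in> ?S" for x
      using u(3)[OF that] aX by blast
    note dv = proj_diff_coord_vector[OF aF b]
    have dT: "proj_diff (inv_chart b x) (?v x) \<in> tangent_space A (\<pi> (inv_chart b x))" if "x \<in> ?S" for x
      by (rule proj_diff_in[OF u(2)[OF that]
            total.tangent_vector_in[OF total.compatible_chart_atlas[OF b] u(1)[OF that]]])
    have e1: "smooth_on ?S (\<lambda>x. \<phi> (\<pi> (inv_chart b x)) (proj_diff (inv_chart b x) (?v x)) a)"
    proof (rule smooth_on_eq[OF o])
      show "smooth_on ?S (\<lambda>x. \<phi> (\<pi> (inv_chart b x))
          (chart_vector A a (\<pi> (inv_chart b x)) (proj_coords F b e x)) a)"
      proof (rule smooth_pullback_apply[where K = "\<lambda>q v. \<phi> q v a", OF aF b _ endo_fieldD(3)[OF \<phi> a]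
            smooth_proj_coords[OF aF b]])
        show "linear_on_subspace (tangent_space A q) (\<lambda>v. \<phi> q v a)" if "q \<in> fst a" for q
          using endo_fieldD(1)[OF \<phi>, of q] that aX
          by (auto simp: linear_on_subspace_def plus_fun_def scaleR_fun_def)
      qed
    qed (simp add: dv)
    have e2: "smooth_on ?S (\<lambda>x. \<eta> (\<pi> (inv_chart b x)) (proj_diff (inv_chart b x) (?v x)))"
    proof (rule smooth_on_eq[OF o])
      show "smooth_on ?S (\<lambda>x. \<eta> (\<pi> (inv_chart b x))
          (chart_vector A a (\<pi> (inv_chart b x)) (proj_coords F b e x)))"
        using aX by (intro smooth_pullback_apply[where K = \<eta>, OF aF b one_formD(1)[OF \<eta>]
              one_formD(2)[OF \<eta> a] smooth_proj_coords[OF aF b]]) auto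
    qed (simp add: dv)
    have e3: "smooth_on ?S (\<lambda>x. \<xi> (\<pi> (inv_chart b x)) a)"
      by (rule smooth_pullback[OF aF b vector_fieldD(2)[OF \<xi> a]])
    show "smooth_on ?S (\<lambda>x. lift_endo \<phi> \<xi> \<eta> (inv_chart b x) (?v x) b)"
      unfolding lift_endo_def
    proof (rule smooth_assemble[OF aF b _ _ e2])
      show "\<phi> (\<pi> (inv_chart b x)) (proj_diff (inv_chart b x) (?v x))
          - \<omega> (inv_chart b x) (?v x) *\<^sub>R \<xi> (\<pi> (inv_chart b x)) \<in> tangent_space A (\<pi> (inv_chart b x))"
        if "x \<in> ?S" for x
        by (intro subspace_diff subspace_scale base.subspace_tangent_space endo_fieldD(2)[OF \<phi>]
            vector_fieldD(1)[OF \<xi>] dT that uA)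
      have "smooth_on ?S (\<lambda>x. \<phi> (\<pi> (inv_chart b x)) (proj_diff (inv_chart b x) (?v x)) a
          - \<omega> (inv_chart b x) (?v x) *\<^sub>R \<xi> (\<pi> (inv_chart b x)) a)"
        by (intro smooth_on_diff smooth_on_scaleR o e1 e3 smooth_form_coord[OF b])
      then show "smooth_on ?S (\<lambda>x. (\<phi> (\<pi> (inv_chart b x)) (proj_diff (inv_chart b x) (?v x))
          - \<omega> (inv_chart b x) (?v x) *\<^sub>R \<xi> (\<pi> (inv_chart b x))) a)"
        by (simp add: fun_diff_def scaleR_fun_def)
    qed
  qed
  then show "smooth_on (chart_image b) (\<lambda>x. let p = inv_chart b x in lift_endo \<phi> \<xi> \<eta> p (coord_vector B b p e) b)"
    by (simp add: coord_vector_eq_chart_vector Let_def)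
qed

definition lift_metric where
  "lift_metric g p v w = g (\<pi> p) (proj_diff p v) (proj_diff p w) + \<omega> p v * \<omega> p w"

lemma bilinear_lift_metric:
  assumes g: "bilinear_form_field A g"
  shows "bilinear_form_field B (lift_metric g)"
  unfolding bilinear_form_field_def
proof (intro conjI ballI allI)
  fix p v assume "p \<in> points B" and v: "v \<in> tangent_space B p"
  then have p: "p \<in> topspace Y" by (simp add: total.points_eq)
  have q: "\<pi> p \<in> points A" using proj_in[OF p] by (simp add: base.points_eq)
  note gl = linear_on_subspaceD(1,2)[OF bilinear_form_fieldD(1)[OF g q] base.subspace_tangent_space]
  note gr = linear_on_subspaceD(1,2)[OF bilinear_form_fieldD(2)[OF g q] base.subspace_tangent_space]
  show "linear_on_subspace (tangent_space B p) (\<lambda>w. lift_metric g p v w)"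
    "linear_on_subspace (tangent_space B p) (\<lambda>w. lift_metric g p w v)"
    unfolding linear_on_subspace_def lift_metric_def
    by (auto simp: proj_diff_linear[OF p] form_linear(1,2)[OF p] gl gr proj_diff_in[OF p] v
        subspace_scale[OF total.subspace_tangent_space] subspace_scale[OF base.subspace_tangent_space]
        algebra_simps)
next
  fix b e e' assume b: "b \<in> B"
  have "smooth_on (chart_image b) (\<lambda>x. lift_metric g (inv_chart b x)
      (chart_vector B b (inv_chart b x) e) (chart_vector B b (inv_chart b x) e'))"
  proof (rule smooth_on_adaptedI[OF b])
    fix a F assume aF: "adapted_chart a F"
    let ?S = "snd b ` (fst b \<inter> fst F)"
    have a: "a \<in> A" by (rule adapted_chartD(1)[OF aF])
    have aX: "fst a \<subseteq> points A" using a by (auto simp: points_def)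
    have o: "open ?S" by (rule adapted_overlap(1)[OF aF b])
    let ?q = "\<lambda>x. \<pi> (inv_chart b x)"
    have q: "?q x \<in> fst a" if "x \<in> ?S" for x
      using that adapted_chartD(6)[OF aF] by (auto simp: inv_chart_left[OF total.chart_inj[OF b]])
    have T: "chart_vector A a r y \<in> tangent_space A r" if "r \<in> fst a" for r y
      by (rule base.tangent_vector_in[OF adapted_chartD(2)[OF aF] that])
    have half: "smooth_on ?S (\<lambda>x. g (?q x) (chart_vector A a (?q x) i)
        (chart_vector A a (?q x) (proj_coords F b e' x)))" for i
      using aX T by (intro smooth_pullback_apply[where K = "\<lambda>r. g r (chart_vector A a r i)", OF aF b]
          bilinear_form_fieldD(1)[OF g] bilinear_form_fieldD(3)[OF g a] smooth_proj_coords[OF aF b]) auto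
    have full: "smooth_on ?S (\<lambda>x. g (?q x) (chart_vector A a (?q x) (proj_coords F b e x))
        (chart_vector A a (?q x) (proj_coords F b e' x)))"
    proof (rule smooth_on_linear_family[OF o _ half smooth_proj_coords[OF aF b]])
      fix x assume x: "x \<in> ?S"
      show "linear (\<lambda>z. g (?q x) (chart_vector A a (?q x) z)
          (chart_vector A a (?q x) (proj_coords F b e' x)))"
        using T[OF q[OF x]] q[OF x] aX
        by (intro linear_on_subspace_linear[OF bilinear_form_fieldD(2)[OF g]]
            base.chart_vector_linear[OF adapted_chartD(2)[OF aF]]) auto
    qed
    have "smooth_on ?S (\<lambda>x. g (?q x) (chart_vector A a (?q x) (proj_coords F b e x))
        (chart_vector A a (?q x) (proj_coords F b e' x))
        + \<omega> (inv_chart b x) (chart_vector B b (inv_chart b x) e)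
          * \<omega> (inv_chart b x) (chart_vector B b (inv_chart b x) e'))"
      by (intro smooth_on_add smooth_on_mult o full smooth_form_coord[OF b])
    then show "smooth_on ?S (\<lambda>x. lift_metric g (inv_chart b x)
        (chart_vector B b (inv_chart b x) e) (chart_vector B b (inv_chart b x) e'))"
      by (rule smooth_on_eq[OF o]) (simp add: lift_metric_def proj_diff_coord_vector[OF aF b])
  qed
  then show "smooth_on (chart_image b) (\<lambda>x. let p = inv_chart b x in
      lift_metric g p (coord_vector B b p e) (coord_vector B b p e'))"
    by (simp add: coord_vector_eq_chart_vector Let_def)
qed

text \<open>On horizontal lifts \<open>h\<close> is \<open>g\<close>, so a negative definite subspace for \<open>g\<close> lifts to one of the same
  dimension. Conversely \<open>h (v, v) \<ge> g (d\<pi> v, d\<pi> v)\<close>, so \<open>d\<pi>\<close> is injective on a negative definite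
  subspace for \<open>h\<close> and its image is negative definite for \<open>g\<close>.\<close>

lemma has_index_lift_metric:
  assumes p: "p \<in> topspace Y" and g: "bilinear_form_field A g"
    and ind: "has_index (tangent_space A (\<pi> p)) (g (\<pi> p)) \<nu>"
  shows "has_index (tangent_space B p) (lift_metric g p) \<nu>"
proof -
  let ?T = "tangent_space B p" and ?U = "tangent_space A (\<pi> p)"
  obtain L where L: "linear L" "\<forall>v\<in>?T. proj_diff p v = L v"
    using proj_diff_linear_extension[OF p] by blast
  have T: "subspace ?T" by (rule total.subspace_tangent_space)
  have LU: "L v \<in> ?U" if "v \<in> ?T" for v
    using proj_diff_in[OF p that] L(2) that by simp
  have h: "lift_metric g p v v = g (\<pi> p) (L v) (L v) + \<omega> p v * \<omega> p v" if "v \<in> ?T" for v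
    using that L(2) by (simp add: lift_metric_def)
  have \<omega>0: "\<omega> p 0 = 0" by (rule form_linear(4)[OF p])
  have g0: "g (\<pi> p) 0 0 = 0"
    using linear_on_subspaceD(4)[OF bilinear_form_fieldD(1)[OF g] base.subspace_tangent_space]
      proj_in[OF p] subspace_0[OF base.subspace_tangent_space] by (simp add: base.points_eq)
  show ?thesis
    unfolding has_index_def
  proof (intro conjI allI impI)
    obtain W where W: "subspace W" "W \<subseteq> ?U" "negative_definite_on W (g (\<pi> p))" "dim W = \<nu>"
      using ind unfolding has_index_def by blast
    \<comment> \<open>The horizontal lift of \<open>W\<close>.\<close>
    let ?W = "{v \<in> ?T. \<omega> p v = 0 \<and> L v \<in> W}"
    have sub: "subspace ?W"
      unfolding subspace_def
      by (auto simp: subspace_0[OF T] subspace_add[OF T] subspace_scale[OF T] \<omega>0 form_linear(1,2)[OF p]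
          linear_0[OF L(1)] linear_add[OF L(1)] linear_scale[OF L(1)]
          subspace_0[OF W(1)] subspace_add[OF W(1)] subspace_scale[OF W(1)])
    have inj: "inj_on L ?W"
      by (rule inj_onI) (use split_eqI[OF p] L(2) in auto)
    have "L ` ?W = W"
    proof (intro equalityI subsetI)
      fix w assume w: "w \<in> W"
      then have *: "assemble p w 0 \<in> ?W" "L (assemble p w 0) = w"
        using assemble_props[OF p, of w 0] W(2) L(2) by auto
      show "w \<in> L ` ?W" by (rule image_eqI[where f = L, OF *(2)[symmetric] *(1)])
    qed auto
    then have "dim ?W = \<nu>"
      using dim_image_inj_on[OF L(1) sub inj] W(4) by simp
    moreover have "negative_definite_on ?W (lift_metric g p)"
      unfolding negative_definite_on_def
    proof (intro ballI impI)
      fix v assume v: "v \<in> ?W" "v \<noteq> 0"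
      then have "L v \<noteq> 0"
        using inj_onD[OF inj, of v 0] subspace_0[OF sub] linear_0[OF L(1)] by auto
      then show "lift_metric g p v v < 0"
        using v W(3) by (simp add: h negative_definite_on_def)
    qed
    ultimately show "\<exists>W. subspace W \<and> W \<subseteq> ?T \<and> negative_definite_on W (lift_metric g p) \<and> dim W = \<nu>"
      using sub by blast
  next
    fix W assume "subspace W \<and> W \<subseteq> ?T \<and> negative_definite_on W (lift_metric g p)"
    then have W: "subspace W" "W \<subseteq> ?T" "\<And>v. v \<in> W \<Longrightarrow> v \<noteq> 0 \<Longrightarrow> lift_metric g p v v < 0"
      by (auto simp: negative_definite_on_def)
    have neg: "g (\<pi> p) (L v) (L v) < 0" if "v \<in> W" "v \<noteq> 0" for v
      using W(3)[OF that] h[OF subsetD[OF W(2) that(1)]] zero_le_square[of "\<omega> p v"] by linarith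
    have inj: "inj_on L W"
    proof (rule linear_inj_on_iff_eq_0[OF L(1) W(1), THEN iffD2, rule_format])
      fix v assume "v \<in> W" "L v = 0"
      then show "v = 0" using neg[of v] g0 by auto
    qed
    have "negative_definite_on (L ` W) (g (\<pi> p))"
      unfolding negative_definite_on_def using neg linear_0[OF L(1)] by auto
    moreover have "L ` W \<subseteq> ?U" using LU W(2) by auto
    moreover have "subspace (L ` W)" by (rule linear_subspace_image[OF L(1) W(1)])
    ultimately have "dim (L ` W) \<le> \<nu>"
      using ind unfolding has_index_def by blast
    then show "dim W \<le> \<nu>"
      using dim_image_inj_on[OF L(1) W(1) inj] by simp
  qed
qed

text \<open>For nondegeneracy, pair \<open>v\<close> with the vertical vector to get \<open>\<omega>(v) = 0\<close>, then with horizontal lifts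
  to get \<open>d\<pi> v = 0\<close>.\<close>

lemma semi_Riemannian_lift_metric:
  assumes "semi_Riemannian_metric A g"
  shows "semi_Riemannian_metric B (lift_metric g)"
proof -
  note metric = assms[unfolded semi_Riemannian_metric_def]
  have g: "bilinear_form_field A g"
    by (rule metric[THEN conjunct1])
  have sym: "\<forall>q\<in>points A. \<forall>v\<in>tangent_space A q. \<forall>w\<in>tangent_space A q. g q v w = g q w v"
    by (rule metric[THEN conjunct2, THEN conjunct1])
  have nondeg: "\<forall>q\<in>points A. \<forall>v\<in>tangent_space A q. (\<forall>w\<in>tangent_space A q. g q v w = 0) \<longrightarrow> v = 0"
    by (rule metric[THEN conjunct2, THEN conjunct2, THEN conjunct1])
  have "\<exists>\<nu>. \<forall>q\<in>points A. has_index (tangent_space A q) (g q) \<nu>"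
    by (rule metric[THEN conjunct2, THEN conjunct2, THEN conjunct2])
  then obtain \<nu> where \<nu>: "\<forall>q\<in>points A. has_index (tangent_space A q) (g q) \<nu>"
    by (elim exE)
  have q: "\<pi> p \<in> points A" if "p \<in> topspace Y" for p
    using proj_in[OF that] by (simp add: base.points_eq)
  have "v = 0" if p: "p \<in> topspace Y" and v: "v \<in> tangent_space B p"
    and 0: "\<forall>w\<in>tangent_space B p. lift_metric g p v w = 0" for p v
  proof -
    have Z: "assemble p 0 1 \<in> tangent_space B p" "proj_diff p (assemble p 0 1) = 0" "\<omega> p (assemble p 0 1) = 1"
      using assemble_props[OF p subspace_0[OF base.subspace_tangent_space]] by auto
    have "lift_metric g p v (assemble p 0 1) = 0" using 0 Z(1) by blast
    then have \<omega>: "\<omega> p v = 0"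
      using linear_on_subspaceD(4)[OF bilinear_form_fieldD(1)[OF g q[OF p] proj_diff_in[OF p v]]
          base.subspace_tangent_space]
      by (simp add: lift_metric_def Z)
    have "g (\<pi> p) (proj_diff p v) w = 0" if w: "w \<in> tangent_space A (\<pi> p)" for w
      using 0 assemble_props[OF p w, of 0] \<omega> by (auto simp: lift_metric_def)
    then have "proj_diff p v = 0"
      using nondeg[rule_format, OF q[OF p] proj_diff_in[OF p v]] by blast
    then show "v = 0"
      using split_eqI[OF p v subspace_0[OF total.subspace_tangent_space]] \<omega> form_linear(4)[OF p]
        proj_diff_linear(2)[OF p v, of 0] by simp
  qed
  then have "\<forall>p\<in>topspace Y. \<forall>v\<in>tangent_space B p.
      (\<forall>w\<in>tangent_space B p. lift_metric g p v w = 0) \<longrightarrow> v = 0"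
    by simp
  moreover have "\<forall>p\<in>topspace Y. \<forall>v\<in>tangent_space B p. \<forall>w\<in>tangent_space B p.
      lift_metric g p v w = lift_metric g p w v"
    using bspec[OF bspec[OF bspec[OF sym q] proj_diff_in] proj_diff_in]
    by (simp add: lift_metric_def mult.commute)
  moreover have "\<forall>p\<in>topspace Y. has_index (tangent_space B p) (lift_metric g p) \<nu>"
    using has_index_lift_metric[OF _ g bspec[OF \<nu> q]] by simp
  ultimately show ?thesis
    unfolding semi_Riemannian_metric_def total.points_eq
    using bilinear_lift_metric[OF g] by (intro conjI exI[of _ \<nu>])
qed

context
  fixes \<phi> \<xi> \<eta> and \<epsilon> :: real
  assumes contact: "almost_eps_contact_structure A \<epsilon> \<phi> \<xi> \<eta>" and \<epsilon>: "\<epsilon> \<noteq> 0"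
begin

lemma contact_fields: "endo_field A \<phi>" "vector_field A \<xi>" "one_form A \<eta>"
  using contact by (auto simp: almost_eps_contact_structure_def)

lemma contact_at:
  assumes q: "q \<in> topspace X"
  shows "linear_on_subspace (tangent_space A q) (\<phi> q)" "linear_on_subspace (tangent_space A q) (\<eta> q)"
    "\<xi> q \<in> tangent_space A q" "v \<in> tangent_space A q \<Longrightarrow> \<phi> q v \<in> tangent_space A q"
    "v \<in> tangent_space A q \<Longrightarrow> \<phi> q (\<phi> q v) = - (\<epsilon> *\<^sub>R v) + \<eta> q v *\<^sub>R \<xi> q"
    "\<eta> q (\<xi> q) = \<epsilon>" "\<phi> q (\<xi> q) = 0" "v \<in> tangent_space A q \<Longrightarrow> \<eta> q (\<phi> q v) = 0"
proof -
  have qA: "q \<in> points A" using q by (simp add: base.points_eq)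
  show \<phi>: "linear_on_subspace (tangent_space A q) (\<phi> q)" and \<eta>: "linear_on_subspace (tangent_space A q) (\<eta> q)"
    and \<xi>: "\<xi> q \<in> tangent_space A q" and \<phi>T: "\<And>v. v \<in> tangent_space A q \<Longrightarrow> \<phi> q v \<in> tangent_space A q"
    using endo_fieldD(1,2)[OF contact_fields(1) qA] one_formD(1)[OF contact_fields(3) qA]
      vector_fieldD(1)[OF contact_fields(2) qA] by blast+
  show sq: "\<And>v. v \<in> tangent_space A q \<Longrightarrow> \<phi> q (\<phi> q v) = - (\<epsilon> *\<^sub>R v) + \<eta> q v *\<^sub>R \<xi> q"
    and n: "\<eta> q (\<xi> q) = \<epsilon>"
    using contact qA unfolding almost_eps_contact_structure_def by blast+
  have "\<phi> q ` tangent_space A q \<subseteq> tangent_space A q" using \<phi>T by blast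
  note id = contact_identities[OF base.subspace_tangent_space \<phi> this \<eta> \<xi> n \<epsilon> sq]
  show "\<phi> q (\<xi> q) = 0" "v \<in> tangent_space A q \<Longrightarrow> \<eta> q (\<phi> q v) = 0" by (rule id; assumption?)+
qed

text \<open>The components are \<open>\<phi>(\<phi> X - f \<xi>) - \<eta>(X) \<xi> = - \<epsilon> X\<close> and \<open>\<eta>(\<phi> X - f \<xi>) = - \<epsilon> f\<close>.\<close>

lemma lift_endo_square:
  assumes p: "p \<in> topspace Y" and v: "v \<in> tangent_space B p"
  shows "lift_endo \<phi> \<xi> \<eta> p (lift_endo \<phi> \<xi> \<eta> p v) = - (\<epsilon> *\<^sub>R v)"
proof -
  note c = contact_at[OF proj_in[OF p]]
  note lin = linear_on_subspaceD[OF c(1) base.subspace_tangent_space]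
    linear_on_subspaceD[OF c(2) base.subspace_tangent_space]
  note J = lift_endo[OF contact_fields(1,2) p]
  note dv = proj_diff_in[OF p v]
  have neg: "- (\<epsilon> *\<^sub>R v) = (- \<epsilon>) *\<^sub>R v" by simp
  show ?thesis
    unfolding neg
  proof (rule split_eqI[OF p J(1)[OF J(1)[OF v]] subspace_scale[OF total.subspace_tangent_space v]])
    show "proj_diff p (lift_endo \<phi> \<xi> \<eta> p (lift_endo \<phi> \<xi> \<eta> p v)) = proj_diff p ((- \<epsilon>) *\<^sub>R v)"
      by (simp add: J v lin c dv proj_diff_linear(2)[OF p v, of "- \<epsilon>", simplified] subspace_scale[OF base.subspace_tangent_space])
    show "\<omega> p (lift_endo \<phi> \<xi> \<eta> p (lift_endo \<phi> \<xi> \<eta> p v)) = \<omega> p ((- \<epsilon>) *\<^sub>R v)"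
      by (simp add: J v lin c dv form_linear(2)[OF p v, of "- \<epsilon>", simplified] subspace_scale[OF base.subspace_tangent_space])
  qed
qed

text \<open>The mixed terms vanish as \<open>g(\<phi> X, \<xi>) = \<eta>(\<phi> X) = 0\<close>. What remains is
  \<open>\<epsilon> g(X, Y) - \<eta>(X) \<eta>(Y) + f f' g(\<xi>, \<xi>) + \<eta>(X) \<eta>(Y)\<close>, and \<open>g(\<xi>, \<xi>) = \<epsilon>\<close>.\<close>

lemma lift_metric_lift_endo:
  assumes p: "p \<in> topspace Y" and v: "v \<in> tangent_space B p" and w: "w \<in> tangent_space B p"
    and bil: "bilinear_form_field A g"
    and g\<phi>: "\<And>v w. v \<in> tangent_space A (\<pi> p) \<Longrightarrow> w \<in> tangent_space A (\<pi> p) \<Longrightarrow>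
      g (\<pi> p) (\<phi> (\<pi> p) v) (\<phi> (\<pi> p) w) = \<epsilon> * g (\<pi> p) v w - \<eta> (\<pi> p) v * \<eta> (\<pi> p) w"
    and g\<xi>: "\<And>v. v \<in> tangent_space A (\<pi> p) \<Longrightarrow> g (\<pi> p) v (\<xi> (\<pi> p)) = \<eta> (\<pi> p) v"
    and sym: "\<And>v. v \<in> tangent_space A (\<pi> p) \<Longrightarrow> g (\<pi> p) (\<xi> (\<pi> p)) v = g (\<pi> p) v (\<xi> (\<pi> p))"
  shows "lift_metric g p (lift_endo \<phi> \<xi> \<eta> p v) (lift_endo \<phi> \<xi> \<eta> p w) = \<epsilon> * lift_metric g p v w"
proof -
  note c = contact_at[OF proj_in[OF p]]
  note lin = linear_on_subspaceD[OF c(2) base.subspace_tangent_space]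
  note J = lift_endo[OF contact_fields(1,2) p]
  note dv = proj_diff_in[OF p v] and dw = proj_diff_in[OF p w]
  have q: "\<pi> p \<in> points A" using proj_in[OF p] by (simp add: base.points_eq)
  note gl = linear_on_subspaceD[OF bilinear_form_fieldD(1)[OF bil q] base.subspace_tangent_space]
    and gr = linear_on_subspaceD[OF bilinear_form_fieldD(2)[OF bil q] base.subspace_tangent_space]
  note sub = subspace_scale[OF base.subspace_tangent_space] subspace_diff[OF base.subspace_tangent_space]
  show ?thesis
    by (simp add: lift_metric_def J v w gl gr lin c dv dw sub g\<phi> g\<xi> sym algebra_simps)
qed

end

text \<open>The factor \<open>r\<close> is \<open>\<epsilon>\<^sub>\<gamma>\<close> for an even and \<open>- \<epsilon>\<^sub>\<gamma>\<close> for an odd permutation of the three structures.\<close>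

lemma lift_endo_compose:
  assumes 1: "endo_field A \<phi>\<^sub>1" "vector_field A \<xi>\<^sub>1" and 2: "endo_field A \<phi>\<^sub>2" "vector_field A \<xi>\<^sub>2"
    and 3: "endo_field A \<phi>\<^sub>3" "vector_field A \<xi>\<^sub>3" and \<eta>: "one_form A \<eta>\<^sub>1"
    and p: "p \<in> topspace Y" and v: "v \<in> tangent_space B p"
    and \<phi>\<xi>: "\<phi>\<^sub>1 (\<pi> p) (\<xi>\<^sub>2 (\<pi> p)) = r *\<^sub>R \<xi>\<^sub>3 (\<pi> p)" and \<eta>\<xi>: "\<eta>\<^sub>1 (\<pi> p) (\<xi>\<^sub>2 (\<pi> p)) = 0"
    and \<eta>\<phi>: "\<And>w. w \<in> tangent_space A (\<pi> p) \<Longrightarrow> \<eta>\<^sub>1 (\<pi> p) (\<phi>\<^sub>2 (\<pi> p) w) = r * \<eta>\<^sub>3 (\<pi> p) w"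
    and \<phi>\<phi>: "\<And>w. w \<in> tangent_space A (\<pi> p) \<Longrightarrow>
      \<phi>\<^sub>1 (\<pi> p) (\<phi>\<^sub>2 (\<pi> p) w) - \<eta>\<^sub>2 (\<pi> p) w *\<^sub>R \<xi>\<^sub>1 (\<pi> p) = r *\<^sub>R \<phi>\<^sub>3 (\<pi> p) w"
  shows "lift_endo \<phi>\<^sub>1 \<xi>\<^sub>1 \<eta>\<^sub>1 p (lift_endo \<phi>\<^sub>2 \<xi>\<^sub>2 \<eta>\<^sub>2 p v) = r *\<^sub>R lift_endo \<phi>\<^sub>3 \<xi>\<^sub>3 \<eta>\<^sub>3 p v"
proof -
  have q: "\<pi> p \<in> points A" using proj_in[OF p] by (simp add: base.points_eq)
  note J1 = lift_endo[OF 1 p] and J2 = lift_endo[OF 2 p] and J3 = lift_endo[OF 3 p]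
  note lin = linear_on_subspaceD[OF endo_fieldD(1)[OF 1(1) q] base.subspace_tangent_space]
    linear_on_subspaceD[OF one_formD(1)[OF \<eta> q] base.subspace_tangent_space]
  note dv = proj_diff_in[OF p v]
  note T = endo_fieldD(2)[OF 2(1) q dv] vector_fieldD(1)[OF 2(2) q]
    subspace_scale[OF base.subspace_tangent_space]
  show ?thesis
  proof (rule split_eqI[OF p J1(1)[OF J2(1)[OF v]] subspace_scale[OF total.subspace_tangent_space J3(1)[OF v]]])
    show "proj_diff p (lift_endo \<phi>\<^sub>1 \<xi>\<^sub>1 \<eta>\<^sub>1 p (lift_endo \<phi>\<^sub>2 \<xi>\<^sub>2 \<eta>\<^sub>2 p v))
        = proj_diff p (r *\<^sub>R lift_endo \<phi>\<^sub>3 \<xi>\<^sub>3 \<eta>\<^sub>3 p v)"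
      using \<phi>\<phi>[OF dv]
      by (simp add: J1 J2 J3 v lin T \<phi>\<xi> proj_diff_linear(2)[OF p] scaleR_diff_right algebra_simps)
    show "\<omega> p (lift_endo \<phi>\<^sub>1 \<xi>\<^sub>1 \<eta>\<^sub>1 p (lift_endo \<phi>\<^sub>2 \<xi>\<^sub>2 \<eta>\<^sub>2 p v)) = \<omega> p (r *\<^sub>R lift_endo \<phi>\<^sub>3 \<xi>\<^sub>3 \<eta>\<^sub>3 p v)"
      by (simp add: J1 J2 J3 v lin T \<eta>\<xi> \<eta>\<phi>[OF dv] form_linear(2)[OF p])
  qed
qed

lemma lift_para_hyperhermitian:
  assumes M: "metric_mixed_3_structure A \<phi> \<xi> \<eta> g"
  shows "almost_para_hyperhermitian_structure B (\<lambda>\<alpha>. lift_endo (\<phi> \<alpha>) (\<xi> \<alpha>) (\<eta> \<alpha>)) (lift_metric g)"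
proof -
  let ?J = "\<lambda>\<alpha>. lift_endo (\<phi> \<alpha>) (\<xi> \<alpha>) (\<eta> \<alpha>)"
  have mixed: "mixed_3_structure A \<phi> \<xi> \<eta>" and g: "semi_Riemannian_metric A g"
    using M by (auto simp: metric_mixed_3_structure_def)
  then have bil: "bilinear_form_field A g" by (simp add: semi_Riemannian_metric_def)
  have contact: "almost_eps_contact_structure A (eps \<alpha>) (\<phi> \<alpha>) (\<xi> \<alpha>) (\<eta> \<alpha>)" if "\<alpha> \<in> {1, 2, 3}" for \<alpha>
    using mixed that unfolding mixed_3_structure_def by blast
  have eps: "eps \<alpha> \<noteq> 0" for \<alpha> by (simp add: eps_def)
  have fields: "endo_field A (\<phi> \<alpha>)" "vector_field A (\<xi> \<alpha>)" "one_form A (\<eta> \<alpha>)" if "\<alpha> \<in> {1, 2, 3}" for \<alpha>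
    using contact_fields[OF contact[OF that] eps] by auto
  have q: "\<pi> p \<in> points A" if "p \<in> topspace Y" for p
    using proj_in[OF that] by (simp add: base.points_eq)
  have square: "?J \<alpha> p (?J \<alpha> p v) = - (eps \<alpha> *\<^sub>R v)"
    if "\<alpha> \<in> {1, 2, 3}" "p \<in> topspace Y" "v \<in> tangent_space B p" for \<alpha> p v
    by (rule lift_endo_square[OF contact[OF that(1)] eps that(2,3)])
  have J12: "?J 1 p (?J 2 p v) = - ?J 3 p v" and J21: "?J 2 p (?J 1 p v) = ?J 3 p v"
    if p: "p \<in> topspace Y" and v: "v \<in> tangent_space B p" for p v
  proof -
    have \<eta>\<xi>: "\<eta> 1 (\<pi> p) (\<xi> 2 (\<pi> p)) = 0" "\<eta> 2 (\<pi> p) (\<xi> 1 (\<pi> p)) = 0"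
      using mixed q[OF p] unfolding mixed_3_structure_def by auto
    have m: "\<phi> 1 (\<pi> p) (\<xi> 2 (\<pi> p)) = - \<xi> 3 (\<pi> p)" "- \<phi> 2 (\<pi> p) (\<xi> 1 (\<pi> p)) = - \<xi> 3 (\<pi> p)"
      "\<And>w. w \<in> tangent_space A (\<pi> p) \<Longrightarrow> \<eta> 1 (\<pi> p) (\<phi> 2 (\<pi> p) w) = - \<eta> 3 (\<pi> p) w"
      "\<And>w. w \<in> tangent_space A (\<pi> p) \<Longrightarrow> - \<eta> 2 (\<pi> p) (\<phi> 1 (\<pi> p) w) = - \<eta> 3 (\<pi> p) w"
      "\<And>w. w \<in> tangent_space A (\<pi> p) \<Longrightarrow> \<phi> 1 (\<pi> p) (\<phi> 2 (\<pi> p) w) - \<eta> 2 (\<pi> p) w *\<^sub>R \<xi> 1 (\<pi> p) = - \<phi> 3 (\<pi> p) w"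
      "\<And>w. w \<in> tangent_space A (\<pi> p) \<Longrightarrow> - \<phi> 2 (\<pi> p) (\<phi> 1 (\<pi> p) w) + \<eta> 1 (\<pi> p) w *\<^sub>R \<xi> 2 (\<pi> p) = - \<phi> 3 (\<pi> p) w"
      using mixed q[OF p] unfolding mixed_3_structure_def even_perms3_def by (auto simp: eps_def)
    have "?J 1 p (?J 2 p v) = (- 1) *\<^sub>R ?J 3 p v"
      by (rule lift_endo_compose[OF fields(1,2) fields(1,2) fields(1,2) fields(3) p v])
        (simp_all add: \<eta>\<xi> m del: One_nat_def)
    then show "?J 1 p (?J 2 p v) = - ?J 3 p v" by simp
    have "?J 2 p (?J 1 p v) = 1 *\<^sub>R ?J 3 p v"
    proof (rule lift_endo_compose[OF fields(1,2) fields(1,2) fields(1,2) fields(3) p v])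
      fix w assume w: "w \<in> tangent_space A (\<pi> p)"
      show "\<eta> 2 (\<pi> p) (\<phi> 1 (\<pi> p) w) = 1 * \<eta> 3 (\<pi> p) w"
        using m(4)[OF w] by simp
      have "\<phi> 2 (\<pi> p) (\<phi> 1 (\<pi> p) w) - \<eta> 1 (\<pi> p) w *\<^sub>R \<xi> 2 (\<pi> p)
          = - (- \<phi> 2 (\<pi> p) (\<phi> 1 (\<pi> p) w) + \<eta> 1 (\<pi> p) w *\<^sub>R \<xi> 2 (\<pi> p))" by simp
      then show "\<phi> 2 (\<pi> p) (\<phi> 1 (\<pi> p) w) - \<eta> 1 (\<pi> p) w *\<^sub>R \<xi> 2 (\<pi> p) = 1 *\<^sub>R \<phi> 3 (\<pi> p) w"
        unfolding m(6)[OF w] by simp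
    qed (use \<eta>\<xi> m(2) in \<open>simp_all del: One_nat_def\<close>)
    then show "?J 2 p (?J 1 p v) = ?J 3 p v" by simp
  qed
  obtain p\<^sub>0 where p\<^sub>0: "p\<^sub>0 \<in> topspace Y" using total.nonempty by blast
  \<comment> \<open>\<open>\<omega>\<close> takes the value 0 on the image of the fundamental vector, but 1 on the vector itself.\<close>
  have not_scalar: "?J \<alpha> p\<^sub>0 (fundamental p\<^sub>0) \<noteq> r *\<^sub>R fundamental p\<^sub>0" if \<alpha>: "\<alpha> \<in> {1, 2, 3}" and r: "r \<noteq> 0" for \<alpha> r
  proof
    assume *: "?J \<alpha> p\<^sub>0 (fundamental p\<^sub>0) = r *\<^sub>R fundamental p\<^sub>0"
    have Z: "proj_diff p\<^sub>0 (fundamental p\<^sub>0) = 0" by (rule proj_diff_fundamental[OF p\<^sub>0])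
    have "\<omega> p\<^sub>0 (?J \<alpha> p\<^sub>0 (fundamental p\<^sub>0)) = \<eta> \<alpha> (\<pi> p\<^sub>0) 0"
      using lift_endo(3)[OF fields(1,2)[OF \<alpha>] p\<^sub>0 fundamental_in[OF p\<^sub>0]] Z by simp
    also have "\<dots> = 0"
      by (rule linear_on_subspaceD(4)[OF one_formD(1)[OF fields(3)[OF \<alpha>] q[OF p\<^sub>0]] base.subspace_tangent_space])
    finally show False
      using r by (simp add: * form_linear(2)[OF p\<^sub>0] fundamental_in[OF p\<^sub>0] form_fundamental[OF p\<^sub>0])
  qed
  have metric: "lift_metric g p (?J \<alpha> p v) (?J \<alpha> p w) = eps \<alpha> * lift_metric g p v w"
    if \<alpha>: "\<alpha> \<in> {1, 2, 3}" and p: "p \<in> topspace Y" and v: "v \<in> tangent_space B p" and w: "w \<in> tangent_space B p"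
    for \<alpha> p v w
  proof (rule lift_metric_lift_endo[OF contact[OF \<alpha>] eps p v w bil])
    fix x y assume x: "x \<in> tangent_space A (\<pi> p)"
    obtain V where V: "vector_field A V" "V (\<pi> p) = x"
      using base.vector_field_extension[OF proj_in[OF p] x] .
    have comp: "\<And>V W. vector_field A V \<Longrightarrow> vector_field A W \<Longrightarrow>
        g (\<pi> p) (\<phi> \<alpha> (\<pi> p) (V (\<pi> p))) (\<phi> \<alpha> (\<pi> p) (W (\<pi> p)))
          = eps \<alpha> * g (\<pi> p) (V (\<pi> p)) (W (\<pi> p)) - \<eta> \<alpha> (\<pi> p) (V (\<pi> p)) * \<eta> \<alpha> (\<pi> p) (W (\<pi> p)) \<and>
        g (\<pi> p) (V (\<pi> p)) (\<xi> \<alpha> (\<pi> p)) = \<eta> \<alpha> (\<pi> p) (V (\<pi> p))"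
      using M \<alpha> q[OF p] unfolding metric_mixed_3_structure_def by blast
    show "g (\<pi> p) x (\<xi> \<alpha> (\<pi> p)) = \<eta> \<alpha> (\<pi> p) x"
      using comp[OF V(1) V(1)] V(2) by simp
    show "g (\<pi> p) (\<xi> \<alpha> (\<pi> p)) x = g (\<pi> p) x (\<xi> \<alpha> (\<pi> p))"
      by (rule bspec[OF bspec[OF bspec[OF
              g[unfolded semi_Riemannian_metric_def, THEN conjunct2, THEN conjunct1] q[OF p]]
            vector_fieldD(1)[OF fields(2)[OF \<alpha>] q[OF p]]] x])
    assume y: "y \<in> tangent_space A (\<pi> p)"
    obtain W where W: "vector_field A W" "W (\<pi> p) = y"
      using base.vector_field_extension[OF proj_in[OF p] y] .
    show "g (\<pi> p) (\<phi> \<alpha> (\<pi> p) x) (\<phi> \<alpha> (\<pi> p) y) = eps \<alpha> * g (\<pi> p) x y - \<eta> \<alpha> (\<pi> p) x * \<eta> \<alpha> (\<pi> p) y"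
      using comp[OF V(1) W(1)] V(2) W(2) by simp
  qed
  have "almost_para_hypercomplex_structure B ?J"
    unfolding almost_para_hypercomplex_structure_def endo_eq_def total.points_eq
  proof (intro conjI ballI)
    show "endo_field B (?J \<alpha>)" if "\<alpha> \<in> {1, 2, 3}" for \<alpha>
      by (rule endo_field_lift_endo[OF fields[OF that]])
    fix p v assume p: "p \<in> topspace Y" and v: "v \<in> tangent_space B p"
    show "?J 1 p (?J 1 p v) = - v" "?J 2 p (?J 2 p v) = v" "?J 3 p (?J 3 p v) = v"
      using square[OF _ p v, of 1] square[OF _ p v, of 2] square[OF _ p v, of 3]
      by (simp_all add: eps_def)
    show "?J 2 p (?J 1 p v) = ?J 3 p v" "- ?J 1 p (?J 2 p v) = ?J 3 p v"
      using J12[OF p v] J21[OF p v] by simp_all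
  next
    fix \<alpha> :: nat assume "\<alpha> \<in> {2, 3}"
    then have \<alpha>: "\<alpha> \<in> {1, 2, 3}" by auto
    show "\<not> (\<forall>p\<in>topspace Y. \<forall>v\<in>tangent_space B p. ?J \<alpha> p v = v)"
      "\<not> (\<forall>p\<in>topspace Y. \<forall>v\<in>tangent_space B p. ?J \<alpha> p v = - v)"
      using not_scalar[OF \<alpha>, of 1] not_scalar[OF \<alpha>, of "- 1"]
      by (auto dest!: bspec[OF _ p\<^sub>0] bspec[OF _ fundamental_in[OF p\<^sub>0]])
  qed
  moreover have "\<forall>\<alpha>\<in>{1, 2, 3}. \<forall>V W. vector_field B V \<and> vector_field B W \<longrightarrow>
      (\<forall>p\<in>points B. lift_metric g p (?J \<alpha> p (V p)) (?J \<alpha> p (W p)) = eps \<alpha> * lift_metric g p (V p) (W p))"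
    unfolding total.points_eq
    by (intro ballI allI impI metric vector_fieldD(1)) (auto simp: total.points_eq)
  ultimately show ?thesis
    using semi_Riemannian_lift_metric[OF g] by (simp add: almost_para_hyperhermitian_structure_def)
qed

end

section \<open>The para-hyperhermitian structure\<close>

theorem theorem4p12:
  fixes M :: "'a topology" and A :: "('a, 'e::euclidean_space) atlas"
    and P :: "'p topology" and B :: "('p, 'f::euclidean_space) atlas"
    and \<phi> :: "nat \<Rightarrow> 'a \<Rightarrow> ('a, 'e) tvec \<Rightarrow> ('a, 'e) tvec"
    and \<xi> :: "nat \<Rightarrow> 'a \<Rightarrow> ('a, 'e) tvec"
    and \<eta> :: "nat \<Rightarrow> 'a \<Rightarrow> ('a, 'e) tvec \<Rightarrow> real"
    and g :: "'a \<Rightarrow> ('a, 'e) tvec \<Rightarrow> ('a, 'e) tvec \<Rightarrow> real"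
    and \<pi> :: "'p \<Rightarrow> 'a" and act :: "'p \<times> complex \<Rightarrow> 'p"
  assumes "smooth_manifold M A"
    and "metric_mixed_3_structure A \<phi> \<xi> \<eta> g"
    and "principal_circle_bundle P B M A \<pi> act"
  shows "\<exists>J h. almost_para_hyperhermitian_structure B J h"
proof -
  interpret principal_circle_bundle P B M A \<pi> act by (rule assms(3))
  obtain \<omega> where "one_form B \<omega>" "\<And>p. p \<in> topspace P \<Longrightarrow> \<omega> p (fundamental p) = 1"
    using total.dual_form[OF fundamental_vector_field fundamental_nonzero] by blast
  then interpret split_circle_bundle P B M A \<pi> act \<omega>
    by unfold_locales
  show ?thesis
    using lift_para_hyperhermitian[OF assms(2)] by blast
qed

end
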